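(* Let $\Lambda^\vee$ be a lattice, $J$ an integral bilinear form on $\Lambda^\vee$, $I=J+J^t$ its symmetrisation, and let $\mathcal T=\mathcal S(\Theta)$ be the categorical torus associated to $J$. The categorical group $\mathcal S(wAct^+(\Theta))$ of centre-preserving weak automorphisms of $\mathcal T$ is equivalent to the strict categorical group $\mathcal S(\Xi)$, where $\Xi$ is the crossed module $$\xi:\Lambda\longrightarrow E,\qquad \lambda\longmapsto(\operatorname{id},[\lambda\otimes\lambda]),$$ in which $(f,B)\in E$ acts on $\Lambda$ via $f^*$. (All objects are defined in the context.)
   Context: **Crossed modules and categorical groups.** A crossed module $\Psi$ is a homomorphism $\psi:G_1\to G_0$, $\alpha\mapsto\underline\alpha$, with a right action of $G_0$ on $G_1$ with $\underline{\alpha^x}=x^{-1}\underline\alpha x$, $\beta^{\underline\alpha}=\alpha^{-1}\beta\alpha$; $\pi_1(\Psi)=\ker\psi$. Its strict categorical group $\mathcal S(\Psi)$ is the strict monoidal groupoid with objects $G_0$, arrows $(x,\alpha):x\to x\underline\alpha$ ($x\in G_0,\alpha\in G_1$), composition by multiplication of the $\alpha$'s, and monoidal structure $(x,\alpha)(y,\beta)=(xy,\alpha^y\beta)$. Equivalence means monoidal equivalence. **Weak automorphisms.** A weak endomorphism of $\Psi$ is $(p,\kappa)$ with pointed maps $p_i:G_i\to G_i$ ($i=0,1$) and $\kappa:G_0\times G_0\to G_1$ satisfying: $p_0(\underline\alpha)=\underline{p_1(\alpha)}$; $p_0(x)p_0(y)\underline{\kappa_{x,y}}=p_0(xy)$;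 $p_1(\alpha)p_1(\beta)\kappa_{\underline\alpha,\underline\beta}=p_1(\alpha\beta)$; $\kappa_{x,y}^{p_0(z)}\kappa_{xy,z}=\kappa_{y,z}\kappa_{x,yz}$ (either side is denoted $\kappa_{x,y,z}$); $p_1(\alpha)^{p_0(x)}\kappa_{\underline\alpha,x}=p_1(\alpha^x)\kappa_{x,\underline{\alpha^x}}$. Composition: $(f,\kappa)(g,\gamma)=(f\circ g,\beta)$, $\beta_{x,y}=f_1(\gamma_{x,y})\kappa_{g_0(x),g_0(y),\underline{\gamma_{x,y}}}$. The weak actor $wAct(\Psi)$ is the crossed module with degree-0 group the weak endomorphisms with $f_0,f_1$ bijective, and degree-1 group the invertible elements of the semigroup of pointed maps $\eta:G_0\to G_1$ under $(\eta_1\circ\eta_2)(x)=\eta_2(x)\,\eta_1(x\underline{\eta_2(x)})$. The structure map sends $\eta$ to $(f,\kappa)$ with $f_0(x)=x\underline{\eta(x)}$, $f_1(\alpha)=\alpha\eta(\underline\alpha)$, $\kappa_{x,y}=\eta(y)^{-1}(\eta(x)^y)^{-1}\eta(xy)$. The action is $\eta^{(f,\kappa)}(x)=f_1^{-1}\big(\eta(f_0(x))\,\kappa_{x,u}^{-1}\big)$ with $u=x^{-1}f_0^{-1}(f_0(x)\underline{\eta(f_0(x))})$. $wAct^+(\Psi)$ is the sub-crossed module with the same degree-1 group and with degree-0 group the $(f,\kappa)$ for which $f_1$ is the identity on $\pi_1(\Psi)$ (centre-preserving). For the Lie crossed module $\Theta$ below, all maps $f_0,f_1,\kappa,\eta$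 (and inverses) are required to be analytic. **$\Theta$.** $\mathfrak t=\Lambda^\vee\otimes\mathbb R$, $J$ extended bilinearly. $\Theta$ is $\theta:\Lambda^\vee\times\mathbb R/\mathbb Z\to\mathfrak t$, $(m,z)\mapsto m$ ($\Lambda^\vee$ discrete), with action $(m,[a])^x=(m,[a+J(m,x)])$. **$E$.** $\Lambda=\operatorname{Hom}(\Lambda^\vee,\mathbb Z)$; $\Lambda\otimes\Lambda$ is the group of integral bilinear forms on $\Lambda^\vee$; $\Gamma_2\Lambda=(\Lambda\otimes\Lambda)^{S_2}$ the symmetric ones; $(\Gamma_2\Lambda)_{ev}$ the even symmetric ones ($B(m,m)\in2\mathbb Z$ for all $m$). $O(\Lambda^\vee,I)$ is the group of automorphisms of $\Lambda^\vee$ preserving $I$. For $f\in O(\Lambda^\vee,I)$, $f^*$ is precomposition with $f$. In the semidirect product $O(\Lambda^\vee,I)\ltimes(\Lambda\otimes\Lambda)$, with $(f,B)(g,B')=(fg,g^*B+B')$, let $\widetilde{O(\Lambda^\vee,I)}=\{(f,B)\mid B-B^t=J-f^*J\}$, and $E=\widetilde{O(\Lambda^\vee,I)}/(\Gamma_2\Lambda)_{ev}$. Here $[\lambda\otimes\lambda]$ is the class of the form $(m,n)\mapsto\lambda(m)\lambda(n)$. *)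

theory Defs
  imports "HOL-Analysis.Analysis" "HOL-Algebra.Coset"
begin

section \<open>Crossed modules and strict categorical groups\<close>

text \<open>\<^term>\<open>act \<Psi> \<alpha> x\<close> is the right action, written \<alpha> with exponent x.\<close>

record ('a, 'b) crossed_module_data =
  deg0 :: "'a monoid"
  deg1 :: "'b monoid"
  bdry :: "'b \<Rightarrow> 'a"
  act :: "'b \<Rightarrow> 'a \<Rightarrow> 'b"

definition crossed_module :: "('a, 'b) crossed_module_data \<Rightarrow> bool" where
  "crossed_module \<Psi> \<longleftrightarrow>
    group (deg0 \<Psi>) \<and> group (deg1 \<Psi>) \<and> bdry \<Psi> \<in> hom (deg1 \<Psi>) (deg0 \<Psi>) \<and>
    (\<forall>x\<in>carrier (deg0 \<Psi>). (\<lambda>\<alpha>. act \<Psi> \<alpha> x) \<in> hom (deg1 \<Psi>) (deg1 \<Psi>)) \<and>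
    (\<forall>\<alpha>\<in>carrier (deg1 \<Psi>). act \<Psi> \<alpha> \<one>\<^bsub>deg0 \<Psi>\<^esub> = \<alpha>) \<and>
    (\<forall>\<alpha>\<in>carrier (deg1 \<Psi>). \<forall>x\<in>carrier (deg0 \<Psi>). \<forall>y\<in>carrier (deg0 \<Psi>).
       act \<Psi> \<alpha> (x \<otimes>\<^bsub>deg0 \<Psi>\<^esub> y) = act \<Psi> (act \<Psi> \<alpha> x) y) \<and>
    (\<forall>\<alpha>\<in>carrier (deg1 \<Psi>). \<forall>x\<in>carrier (deg0 \<Psi>).
       bdry \<Psi> (act \<Psi> \<alpha> x) = inv\<^bsub>deg0 \<Psi>\<^esub> x \<otimes>\<^bsub>deg0 \<Psi>\<^esub> bdry \<Psi> \<alpha> \<otimes>\<^bsub>deg0 \<Psi>\<^esub> x) \<and>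
    (\<forall>\<alpha>\<in>carrier (deg1 \<Psi>). \<forall>\<beta>\<in>carrier (deg1 \<Psi>).
       act \<Psi> \<beta> (bdry \<Psi> \<alpha>) = inv\<^bsub>deg1 \<Psi>\<^esub> \<alpha> \<otimes>\<^bsub>deg1 \<Psi>\<^esub> \<beta> \<otimes>\<^bsub>deg1 \<Psi>\<^esub> \<alpha>)"

definition pi1 :: "('a, 'b) crossed_module_data \<Rightarrow> 'b set" where
  "pi1 \<Psi> = kernel (deg1 \<Psi>) (deg0 \<Psi>) (bdry \<Psi>)"

text \<open>Composition is written in diagrammatic order: \<^term>\<open>cmp C a b\<close> is first \<open>a\<close>, then \<open>b\<close>.\<close>

record ('o, 'a) monoidal_data =
  Ob :: "'o set"
  Ar :: "'a set"
  src :: "'a \<Rightarrow> 'o"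
  tgt :: "'a \<Rightarrow> 'o"
  idt :: "'o \<Rightarrow> 'a"
  cmp :: "'a \<Rightarrow> 'a \<Rightarrow> 'a"
  tens_ob :: "'o \<Rightarrow> 'o \<Rightarrow> 'o"
  tens_ar :: "'a \<Rightarrow> 'a \<Rightarrow> 'a"
  unit_ob :: "'o"

definition groupoid :: "('o, 'a) monoidal_data \<Rightarrow> bool" where
  "groupoid C \<longleftrightarrow>
    (\<forall>a\<in>Ar C. src C a \<in> Ob C \<and> tgt C a \<in> Ob C) \<and>
    (\<forall>x\<in>Ob C. idt C x \<in> Ar C \<and> src C (idt C x) = x \<and> tgt C (idt C x) = x) \<and>
    (\<forall>a\<in>Ar C. \<forall>b\<in>Ar C. tgt C a = src C b \<longrightarrow>
       cmp C a b \<in> Ar C \<and> src C (cmp C a b) = src C a \<and> tgt C (cmp C a b) = tgt C b) \<and>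
    (\<forall>a\<in>Ar C. cmp C (idt C (src C a)) a = a \<and> cmp C a (idt C (tgt C a)) = a) \<and>
    (\<forall>a\<in>Ar C. \<forall>b\<in>Ar C. \<forall>c\<in>Ar C. tgt C a = src C b \<and> tgt C b = src C c \<longrightarrow>
       cmp C (cmp C a b) c = cmp C a (cmp C b c)) \<and>
    (\<forall>a\<in>Ar C. \<exists>b\<in>Ar C. src C b = tgt C a \<and> tgt C b = src C a \<and>
       cmp C a b = idt C (src C a) \<and> cmp C b a = idt C (tgt C a))"

definition strict_categorical_group :: "('o, 'a) monoidal_data \<Rightarrow> bool" where
  "strict_categorical_group C \<longleftrightarrow>
    groupoid C \<and> unit_ob C \<in> Ob C \<and>
    (\<forall>x\<in>Ob C. \<forall>y\<in>Ob C. tens_ob C x y \<in> Ob C) \<and>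
    (\<forall>a\<in>Ar C. \<forall>b\<in>Ar C. tens_ar C a b \<in> Ar C \<and>
       src C (tens_ar C a b) = tens_ob C (src C a) (src C b) \<and>
       tgt C (tens_ar C a b) = tens_ob C (tgt C a) (tgt C b)) \<and>
    (\<forall>x\<in>Ob C. \<forall>y\<in>Ob C. tens_ar C (idt C x) (idt C y) = idt C (tens_ob C x y)) \<and>
    (\<forall>a\<in>Ar C. \<forall>a'\<in>Ar C. \<forall>b\<in>Ar C. \<forall>b'\<in>Ar C. tgt C a = src C a' \<and> tgt C b = src C b' \<longrightarrow>
       tens_ar C (cmp C a a') (cmp C b b') = cmp C (tens_ar C a b) (tens_ar C a' b')) \<and>
    (\<forall>x\<in>Ob C. \<forall>y\<in>Ob C. \<forall>z\<in>Ob C. tens_ob C (tens_ob C x y) z = tens_ob C x (tens_ob C y z)) \<and>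
    (\<forall>a\<in>Ar C. \<forall>b\<in>Ar C. \<forall>c\<in>Ar C. tens_ar C (tens_ar C a b) c = tens_ar C a (tens_ar C b c)) \<and>
    (\<forall>x\<in>Ob C. tens_ob C (unit_ob C) x = x \<and> tens_ob C x (unit_ob C) = x) \<and>
    (\<forall>a\<in>Ar C. tens_ar C (idt C (unit_ob C)) a = a \<and> tens_ar C a (idt C (unit_ob C)) = a) \<and>
    (\<forall>x\<in>Ob C. \<exists>y\<in>Ob C. tens_ob C x y = unit_ob C \<and> tens_ob C y x = unit_ob C)"

text \<open>The categorical group of a crossed module: the pair \<open>(x, \<alpha>)\<close> is an arrow from \<open>x\<close> to
  \<open>x\<close> times the image of \<open>\<alpha>\<close>.\<close>

definition strict_cat_group_of ::
    "('a, 'b) crossed_module_data \<Rightarrow> ('a, 'a \<times> 'b) monoidal_data" where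
  "strict_cat_group_of \<Psi> =
    \<lparr>Ob = carrier (deg0 \<Psi>),
     Ar = carrier (deg0 \<Psi>) \<times> carrier (deg1 \<Psi>),
     src = fst,
     tgt = (\<lambda>(x, \<alpha>). x \<otimes>\<^bsub>deg0 \<Psi>\<^esub> bdry \<Psi> \<alpha>),
     idt = (\<lambda>x. (x, \<one>\<^bsub>deg1 \<Psi>\<^esub>)),
     cmp = (\<lambda>(x, \<alpha>) (y, \<beta>). (x, \<alpha> \<otimes>\<^bsub>deg1 \<Psi>\<^esub> \<beta>)),
     tens_ob = (\<lambda>x y. x \<otimes>\<^bsub>deg0 \<Psi>\<^esub> y),
     tens_ar = (\<lambda>(x, \<alpha>) (y, \<beta>). (x \<otimes>\<^bsub>deg0 \<Psi>\<^esub> y, act \<Psi> \<alpha> y \<otimes>\<^bsub>deg1 \<Psi>\<^esub> \<beta>)),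
     unit_ob = \<one>\<^bsub>deg0 \<Psi>\<^esub>\<rparr>"


section \<open>Monoidal equivalence\<close>

definition functor_between :: "('o, 'a) monoidal_data \<Rightarrow> ('p, 'b) monoidal_data \<Rightarrow>
    ('o \<Rightarrow> 'p) \<Rightarrow> ('a \<Rightarrow> 'b) \<Rightarrow> bool" where
  "functor_between C D Fo Fa \<longleftrightarrow>
    (\<forall>x\<in>Ob C. Fo x \<in> Ob D) \<and>
    (\<forall>a\<in>Ar C. Fa a \<in> Ar D \<and> src D (Fa a) = Fo (src C a) \<and> tgt D (Fa a) = Fo (tgt C a)) \<and>
    (\<forall>x\<in>Ob C. Fa (idt C x) = idt D (Fo x)) \<and>
    (\<forall>a\<in>Ar C. \<forall>b\<in>Ar C. tgt C a = src C b \<longrightarrow> Fa (cmp C a b) = cmp D (Fa a) (Fa b))"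

definition natural_transformation :: "('o, 'a) monoidal_data \<Rightarrow> ('p, 'b) monoidal_data \<Rightarrow>
    ('o \<Rightarrow> 'p) \<Rightarrow> ('a \<Rightarrow> 'b) \<Rightarrow> ('o \<Rightarrow> 'p) \<Rightarrow> ('a \<Rightarrow> 'b) \<Rightarrow> ('o \<Rightarrow> 'b) \<Rightarrow> bool" where
  "natural_transformation C D Fo Fa Fo' Fa' \<tau> \<longleftrightarrow>
    (\<forall>x\<in>Ob C. \<tau> x \<in> Ar D \<and> src D (\<tau> x) = Fo x \<and> tgt D (\<tau> x) = Fo' x) \<and>
    (\<forall>a\<in>Ar C. cmp D (Fa a) (\<tau> (tgt C a)) = cmp D (\<tau> (src C a)) (Fa' a))"

text \<open>\<open>\<phi> x y\<close> is the structure arrow from \<open>F x \<otimes> F y\<close> to \<open>F (x \<otimes> y)\<close>, and \<open>\<epsilon>\<close> the one from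
  the unit to the image of the unit. All arrows being invertible, the functor is strong.\<close>

definition monoidal_functor :: "('o, 'a) monoidal_data \<Rightarrow> ('p, 'b) monoidal_data \<Rightarrow>
    ('o \<Rightarrow> 'p) \<Rightarrow> ('a \<Rightarrow> 'b) \<Rightarrow> ('o \<Rightarrow> 'o \<Rightarrow> 'b) \<Rightarrow> 'b \<Rightarrow> bool" where
  "monoidal_functor C D Fo Fa \<phi> \<epsilon> \<longleftrightarrow>
    functor_between C D Fo Fa \<and>
    (\<forall>x\<in>Ob C. \<forall>y\<in>Ob C. \<phi> x y \<in> Ar D \<and>
       src D (\<phi> x y) = tens_ob D (Fo x) (Fo y) \<and> tgt D (\<phi> x y) = Fo (tens_ob C x y)) \<and>
    \<epsilon> \<in> Ar D \<and> src D \<epsilon> = unit_ob D \<and> tgt D \<epsilon> = Fo (unit_ob C) \<and>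
    (\<forall>a\<in>Ar C. \<forall>b\<in>Ar C.
       cmp D (tens_ar D (Fa a) (Fa b)) (\<phi> (tgt C a) (tgt C b)) =
       cmp D (\<phi> (src C a) (src C b)) (Fa (tens_ar C a b))) \<and>
    (\<forall>x\<in>Ob C. \<forall>y\<in>Ob C. \<forall>z\<in>Ob C.
       cmp D (tens_ar D (\<phi> x y) (idt D (Fo z))) (\<phi> (tens_ob C x y) z) =
       cmp D (tens_ar D (idt D (Fo x)) (\<phi> y z)) (\<phi> x (tens_ob C y z))) \<and>
    (\<forall>x\<in>Ob C.
       cmp D (tens_ar D \<epsilon> (idt D (Fo x))) (\<phi> (unit_ob C) x) = idt D (Fo x) \<and>
       cmp D (tens_ar D (idt D (Fo x)) \<epsilon>) (\<phi> x (unit_ob C)) = idt D (Fo x))"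

text \<open>A monoidal equivalence is a monoidal functor whose underlying functor is an equivalence of
  categories. In a groupoid every natural transformation is an isomorphism.\<close>

definition monoidally_equivalent ::
    "('o, 'a) monoidal_data \<Rightarrow> ('p, 'b) monoidal_data \<Rightarrow> bool" where
  "monoidally_equivalent C D \<longleftrightarrow>
    strict_categorical_group C \<and> strict_categorical_group D \<and>
    (\<exists>Fo Fa \<phi> \<epsilon> Go Ga \<tau> \<sigma>.
       monoidal_functor C D Fo Fa \<phi> \<epsilon> \<and> functor_between D C Go Ga \<and>
       natural_transformation C C id id (Go \<circ> Fo) (Ga \<circ> Fa) \<tau> \<and>
       natural_transformation D D id id (Fo \<circ> Go) (Fa \<circ> Ga) \<sigma>)"


section \<open>Weak automorphisms and the weak actor\<close>

definition kappa3 :: "('a, 'b) crossed_module_data \<Rightarrow> ('a \<Rightarrow> 'a) \<Rightarrow> ('a \<times> 'a \<Rightarrow> 'b) \<Rightarrow>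
    'a \<Rightarrow> 'a \<Rightarrow> 'a \<Rightarrow> 'b" where
  "kappa3 \<Psi> p0 \<kappa> x y z = act \<Psi> (\<kappa> (x, y)) (p0 z) \<otimes>\<^bsub>deg1 \<Psi>\<^esub> \<kappa> (x \<otimes>\<^bsub>deg0 \<Psi>\<^esub> y, z)"

text \<open>All maps are extensional, i.e. \<^term>\<open>undefined\<close> outside the carriers, so that equality of
  triples is equality of maps on the carriers.\<close>

definition weak_endomorphism :: "('a, 'b) crossed_module_data \<Rightarrow>
    ('a \<Rightarrow> 'a) \<Rightarrow> ('b \<Rightarrow> 'b) \<Rightarrow> ('a \<times> 'a \<Rightarrow> 'b) \<Rightarrow> bool" where
  "weak_endomorphism \<Psi> p0 p1 \<kappa> \<longleftrightarrow>
    (let G0 = deg0 \<Psi>; G1 = deg1 \<Psi>; \<psi> = bdry \<Psi> in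
      p0 \<in> carrier G0 \<rightarrow>\<^sub>E carrier G0 \<and> p0 \<one>\<^bsub>G0\<^esub> = \<one>\<^bsub>G0\<^esub> \<and>
      p1 \<in> carrier G1 \<rightarrow>\<^sub>E carrier G1 \<and> p1 \<one>\<^bsub>G1\<^esub> = \<one>\<^bsub>G1\<^esub> \<and>
      \<kappa> \<in> carrier G0 \<times> carrier G0 \<rightarrow>\<^sub>E carrier G1 \<and>
      (\<forall>\<alpha>\<in>carrier G1. p0 (\<psi> \<alpha>) = \<psi> (p1 \<alpha>)) \<and>
      (\<forall>x\<in>carrier G0. \<forall>y\<in>carrier G0.
         p0 x \<otimes>\<^bsub>G0\<^esub> p0 y \<otimes>\<^bsub>G0\<^esub> \<psi> (\<kappa> (x, y)) = p0 (x \<otimes>\<^bsub>G0\<^esub> y)) \<and>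
      (\<forall>\<alpha>\<in>carrier G1. \<forall>\<beta>\<in>carrier G1.
         p1 \<alpha> \<otimes>\<^bsub>G1\<^esub> p1 \<beta> \<otimes>\<^bsub>G1\<^esub> \<kappa> (\<psi> \<alpha>, \<psi> \<beta>) = p1 (\<alpha> \<otimes>\<^bsub>G1\<^esub> \<beta>)) \<and>
      (\<forall>x\<in>carrier G0. \<forall>y\<in>carrier G0. \<forall>z\<in>carrier G0.
         kappa3 \<Psi> p0 \<kappa> x y z = \<kappa> (y, z) \<otimes>\<^bsub>G1\<^esub> \<kappa> (x, y \<otimes>\<^bsub>G0\<^esub> z)) \<and>
      (\<forall>\<alpha>\<in>carrier G1. \<forall>x\<in>carrier G0.
         act \<Psi> (p1 \<alpha>) (p0 x) \<otimes>\<^bsub>G1\<^esub> \<kappa> (\<psi> \<alpha>, x) =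
         p1 (act \<Psi> \<alpha> x) \<otimes>\<^bsub>G1\<^esub> \<kappa> (x, \<psi> (act \<Psi> \<alpha> x))))"

text \<open>The regularity imposed on the maps \<open>f\<^sub>0\<close>, \<open>f\<^sub>1\<close>, \<open>\<kappa>\<close> and \<open>\<eta>\<close> respectively: every class
  is \<^term>\<open>UNIV\<close> for an abstract crossed module, and consists of the analytic maps for a Lie
  crossed module.\<close>

record ('a, 'b) regularity =
  reg_f0 :: "('a \<Rightarrow> 'a) set"
  reg_f1 :: "('b \<Rightarrow> 'b) set"
  reg_kappa :: "('a \<times> 'a \<Rightarrow> 'b) set"
  reg_eta :: "('a \<Rightarrow> 'b) set"

type_synonym ('a, 'b) weak_map = "('a \<Rightarrow> 'a) \<times> ('b \<Rightarrow> 'b) \<times> ('a \<times> 'a \<Rightarrow> 'b)"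

definition weak_automorphism_group :: "('a, 'b) crossed_module_data \<Rightarrow> ('a, 'b) regularity \<Rightarrow>
    ('a, 'b) weak_map monoid" where
  "weak_automorphism_group \<Psi> R =
    (let G0 = deg0 \<Psi>; G1 = deg1 \<Psi>; \<psi> = bdry \<Psi> in
     \<lparr>carrier = {(f0, f1, \<kappa>). weak_endomorphism \<Psi> f0 f1 \<kappa> \<and>
        bij_betw f0 (carrier G0) (carrier G0) \<and> bij_betw f1 (carrier G1) (carrier G1) \<and>
        f0 \<in> reg_f0 R \<and> restrict (inv_into (carrier G0) f0) (carrier G0) \<in> reg_f0 R \<and>
        f1 \<in> reg_f1 R \<and> restrict (inv_into (carrier G1) f1) (carrier G1) \<in> reg_f1 R \<and>
        \<kappa> \<in> reg_kappa R},
      mult = (\<lambda>(f0, f1, \<kappa>) (g0, g1, \<gamma>).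
        (compose (carrier G0) f0 g0,
         compose (carrier G1) f1 g1,
         restrict (\<lambda>(x, y). f1 (\<gamma> (x, y)) \<otimes>\<^bsub>G1\<^esub>
             kappa3 \<Psi> f0 \<kappa> (g0 x) (g0 y) (\<psi> (\<gamma> (x, y))))
           (carrier G0 \<times> carrier G0))),
      one =
        (restrict id (carrier G0),
         restrict id (carrier G1),
         restrict (\<lambda>_. \<one>\<^bsub>G1\<^esub>) (carrier G0 \<times> carrier G0))\<rparr>)"

definition pointed_map_monoid :: "('a, 'b) crossed_module_data \<Rightarrow> ('a, 'b) regularity \<Rightarrow>
    ('a \<Rightarrow> 'b) monoid" where
  "pointed_map_monoid \<Psi> R =
    (let G0 = deg0 \<Psi>; G1 = deg1 \<Psi> in
     \<lparr>carrier = {\<eta> \<in> carrier G0 \<rightarrow>\<^sub>E carrier G1. \<eta> \<one>\<^bsub>G0\<^esub> = \<one>\<^bsub>G1\<^esub> \<and> \<eta> \<in> reg_eta R},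
      mult = (\<lambda>\<eta>1 \<eta>2. restrict
        (\<lambda>x. \<eta>2 x \<otimes>\<^bsub>G1\<^esub> \<eta>1 (x \<otimes>\<^bsub>G0\<^esub> bdry \<Psi> (\<eta>2 x))) (carrier G0)),
      one = restrict (\<lambda>_. \<one>\<^bsub>G1\<^esub>) (carrier G0)\<rparr>)"

definition wAct :: "('a, 'b) crossed_module_data \<Rightarrow> ('a, 'b) regularity \<Rightarrow>
    (('a, 'b) weak_map, 'a \<Rightarrow> 'b) crossed_module_data" where
  "wAct \<Psi> R =
    (let G0 = deg0 \<Psi>; G1 = deg1 \<Psi>; \<psi> = bdry \<Psi> in
     \<lparr>deg0 = weak_automorphism_group \<Psi> R,
      deg1 = units_of (pointed_map_monoid \<Psi> R),
      bdry = (\<lambda>\<eta>.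
        (restrict (\<lambda>x. x \<otimes>\<^bsub>G0\<^esub> \<psi> (\<eta> x)) (carrier G0),
         restrict (\<lambda>\<alpha>. \<alpha> \<otimes>\<^bsub>G1\<^esub> \<eta> (\<psi> \<alpha>)) (carrier G1),
         restrict (\<lambda>(x, y). inv\<^bsub>G1\<^esub> (\<eta> y) \<otimes>\<^bsub>G1\<^esub> inv\<^bsub>G1\<^esub> (act \<Psi> (\<eta> x) y) \<otimes>\<^bsub>G1\<^esub>
             \<eta> (x \<otimes>\<^bsub>G0\<^esub> y))
           (carrier G0 \<times> carrier G0))),
      act = (\<lambda>\<eta> (f0, f1, \<kappa>). restrict
        (\<lambda>x. let u = inv\<^bsub>G0\<^esub> x \<otimes>\<^bsub>G0\<^esub>
                   inv_into (carrier G0) f0 (f0 x \<otimes>\<^bsub>G0\<^esub> \<psi> (\<eta> (f0 x)))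
             in inv_into (carrier G1) f1 (\<eta> (f0 x) \<otimes>\<^bsub>G1\<^esub> inv\<^bsub>G1\<^esub> (\<kappa> (x, u))))
        (carrier G0))\<rparr>)"

definition wAct_plus :: "('a, 'b) crossed_module_data \<Rightarrow> ('a, 'b) regularity \<Rightarrow>
    (('a, 'b) weak_map, 'a \<Rightarrow> 'b) crossed_module_data" where
  "wAct_plus \<Psi> R = (wAct \<Psi> R)\<lparr>deg0 := (deg0 (wAct \<Psi> R))
     \<lparr>carrier := {(f0, f1, \<kappa>) \<in> carrier (deg0 (wAct \<Psi> R)). \<forall>\<alpha>\<in>pi1 \<Psi>. f1 \<alpha> = \<alpha>}\<rparr>\<rparr>"


section \<open>The Lie crossed module of a categorical torus\<close>

text \<open>A lattice is an abelian group \<open>'l\<close> together with a model \<open>\<iota>\<close> of the inclusion of \<open>'l\<close> into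
  its real extension of scalars: \<open>\<iota>\<close> identifies \<open>'l\<close> with the integral span of a finite real
  basis. The norm on \<open>'v\<close> serves only to name the standard topology of a finite-dimensional real
  vector space; rank zero is allowed.\<close>

definition lattice_extension :: "('l::ab_group_add \<Rightarrow> 'v::real_normed_vector) \<Rightarrow> bool" where
  "lattice_extension \<iota> \<longleftrightarrow> Modules.additive \<iota> \<and> inj \<iota> \<and>
    (\<exists>b. finite b \<and> independent b \<and> span b = UNIV \<and>
       range \<iota> = {v. \<exists>c :: 'v \<Rightarrow> int. v = (\<Sum>e\<in>b. of_int (c e) *\<^sub>R e)})"

definition dual_lattice :: "('l::ab_group_add \<Rightarrow> int) set" where
  "dual_lattice = {l. Modules.additive l}"

definition integral_forms :: "('l::ab_group_add \<Rightarrow> 'l \<Rightarrow> int) set" where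
  "integral_forms = {B. (\<forall>m. Modules.additive (B m)) \<and> (\<forall>n. Modules.additive (\<lambda>m. B m n))}"

text \<open>Bilinear extension of scalars; it is unique when \<open>\<iota>\<close> is a lattice extension and \<open>J\<close> an
  integral form.\<close>

definition real_form :: "('l::ab_group_add \<Rightarrow> 'v::real_normed_vector) \<Rightarrow>
    ('l \<Rightarrow> 'l \<Rightarrow> int) \<Rightarrow> 'v \<Rightarrow> 'v \<Rightarrow> real" where
  "real_form \<iota> J = (THE b. bilinear b \<and> (\<forall>m n. b (\<iota> m) (\<iota> n) = of_int (J m n)))"

definition additive_group :: "'a::ab_group_add monoid" where
  "additive_group = \<lparr>carrier = UNIV, mult = (+), one = 0\<rparr>"

definition circle_group :: "real set monoid" where
  "circle_group = (additive_group :: real monoid) Mod \<int>"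

definition circle_class :: "real \<Rightarrow> real set" where
  "circle_class a = \<int> #>\<^bsub>additive_group\<^esub> a"

definition Theta :: "('l::ab_group_add \<Rightarrow> 'v::real_normed_vector) \<Rightarrow> ('l \<Rightarrow> 'l \<Rightarrow> int) \<Rightarrow>
    ('v, 'l \<times> real set) crossed_module_data" where
  "Theta \<iota> J =
    \<lparr>deg0 = additive_group,
     deg1 = additive_group \<times>\<times> circle_group,
     bdry = (\<lambda>(m, z). \<iota> m),
     act = (\<lambda>(m, z) x. (m, z \<otimes>\<^bsub>circle_group\<^esub> circle_class (real_form \<iota> J (\<iota> m) x)))\<rparr>"

text \<open>Real analyticity: near every point the map is the sum of a power series whose degree-\<open>k\<close>
  term is \<open>c [h, \<dots>, h]\<close> (with \<open>k\<close> entries) for a \<open>k\<close>-linear map, the norms of these maps growing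
  at most geometrically. Multilinear maps of all degrees are packed into one map on lists.\<close>

definition real_analytic_at ::
    "('v::real_normed_vector \<Rightarrow> 'w::real_normed_vector) \<Rightarrow> 'v \<Rightarrow> bool" where
  "real_analytic_at f a \<longleftrightarrow> (\<exists>(c :: 'v list \<Rightarrow> 'w) r C. r > 0 \<and>
    (\<forall>us vs. linear (\<lambda>h. c (us @ h # vs))) \<and>
    (\<forall>vs. norm (c vs) \<le> C * (\<Prod>v\<leftarrow>vs. norm v / r)) \<and>
    (\<forall>h. norm h < r \<longrightarrow> (\<lambda>k. c (replicate k h)) sums f (a + h)))"

text \<open>The group \<open>\<Lambda>\<^sup>\<or> \<times> \<real>/\<int>\<close> has the charts \<open>t \<mapsto> (m, [t])\<close>, the lattice being discrete.\<close>

definition analytic_to_deg1 :: "('v::real_normed_vector \<Rightarrow> 'l \<times> real set) \<Rightarrow> bool" where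
  "analytic_to_deg1 g \<longleftrightarrow> (\<forall>a. \<exists>m \<phi>. real_analytic_at \<phi> a \<and>
     eventually (\<lambda>y. g y = (m, circle_class (\<phi> y))) (nhds a))"

definition analytic_maps :: "('v::real_normed_vector, 'l \<times> real set) regularity" where
  "analytic_maps =
    \<lparr>reg_f0 = {f. \<forall>a. real_analytic_at f a},
     reg_f1 = {f. \<forall>m. analytic_to_deg1 (\<lambda>t :: real. f (m, circle_class t))},
     reg_kappa = {\<kappa>. analytic_to_deg1 \<kappa>},
     reg_eta = {\<eta>. analytic_to_deg1 \<eta>}\<rparr>"


section \<open>The crossed module \<open>\<Xi>\<close>\<close>

definition symmetrisation :: "('l \<Rightarrow> 'l \<Rightarrow> int) \<Rightarrow> 'l \<Rightarrow> 'l \<Rightarrow> int" where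
  "symmetrisation J m n = J m n + J n m"

definition orthogonal_group :: "('l::ab_group_add \<Rightarrow> 'l \<Rightarrow> int) \<Rightarrow> ('l \<Rightarrow> 'l) set" where
  "orthogonal_group I =
    {f. bij f \<and> Modules.additive f \<and> (\<forall>m n. I (f m) (f n) = I m n)}"

definition pullback_form :: "('l \<Rightarrow> 'l) \<Rightarrow> ('l \<Rightarrow> 'l \<Rightarrow> int) \<Rightarrow> 'l \<Rightarrow> 'l \<Rightarrow> int" where
  "pullback_form f B m n = B (f m) (f n)"

definition form_semidirect :: "('l::ab_group_add \<Rightarrow> 'l \<Rightarrow> int) \<Rightarrow>
    (('l \<Rightarrow> 'l) \<times> ('l \<Rightarrow> 'l \<Rightarrow> int)) monoid" where
  "form_semidirect I =
    \<lparr>carrier = orthogonal_group I \<times> integral_forms,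
     mult = (\<lambda>(f, B) (g, B'). (f \<circ> g, \<lambda>m n. pullback_form g B m n + B' m n)),
     one = (id, \<lambda>_ _. 0)\<rparr>"

definition O_tilde :: "('l::ab_group_add \<Rightarrow> 'l \<Rightarrow> int) \<Rightarrow>
    (('l \<Rightarrow> 'l) \<times> ('l \<Rightarrow> 'l \<Rightarrow> int)) monoid" where
  "O_tilde J = (form_semidirect (symmetrisation J))
    \<lparr>carrier := {(f, B) \<in> carrier (form_semidirect (symmetrisation J)).
       \<forall>m n. B m n - B n m = J m n - pullback_form f J m n}\<rparr>"

definition even_symmetric_forms :: "('l::ab_group_add \<Rightarrow> 'l \<Rightarrow> int) set" where
  "even_symmetric_forms =
    {B \<in> integral_forms. (\<forall>m n. B m n = B n m) \<and> (\<forall>m. even (B m m))}"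

definition E_group :: "('l::ab_group_add \<Rightarrow> 'l \<Rightarrow> int) \<Rightarrow>
    (('l \<Rightarrow> 'l) \<times> ('l \<Rightarrow> 'l \<Rightarrow> int)) set monoid" where
  "E_group J = O_tilde J Mod ({id} \<times> even_symmetric_forms)"

text \<open>All elements of one class in \<^term>\<open>E_group J\<close> have the same first component \<open>f\<close>.\<close>

definition Xi :: "('l::ab_group_add \<Rightarrow> 'l \<Rightarrow> int) \<Rightarrow>
    ((('l \<Rightarrow> 'l) \<times> ('l \<Rightarrow> 'l \<Rightarrow> int)) set, 'l \<Rightarrow> int) crossed_module_data" where
  "Xi J =
    \<lparr>deg0 = E_group J,
     deg1 = \<lparr>carrier = dual_lattice, mult = (\<lambda>l1 l2 m. l1 m + l2 m), one = (\<lambda>_. 0)\<rparr>,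
     bdry = (\<lambda>l. ({id} \<times> even_symmetric_forms) #>\<^bsub>O_tilde J\<^esub> (id, \<lambda>m n. l m * l n)),
     act = (\<lambda>l e. l \<circ> fst (SOME p. p \<in> e))\<rparr>"

end

theory Submission
  imports Defs
begin

text \<open>An analytic map into \<open>\<Lambda>\<^sup>\<or> \<times> \<real>/\<int>\<close> has constant lattice component and lifts to a real analytic
  function. Hence a centre-preserving weak automorphism amounts to an isometry \<open>f\<close> of the lattice, a
  function \<open>c\<close> on the lattice and a real analytic cocycle \<open>k\<close> with antisymmetrisation \<open>J - f\<^sup>*J\<close>.
  If \<open>B\<close> is an integral form with \<open>B - B\<^sup>t = J - f\<^sup>*J\<close>, then \<open>k - B\<close> is a symmetric cocycle, so it is
  the coboundary of an analytic function, and the weak automorphism is isomorphic to the strict one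
  that \<open>(f, B)\<close> defines. The arrows trivialising the weak automorphism of \<open>(id, B)\<close> are the classes
  of the functions \<open>(B(x, x) + \<lambda>(x)) / 2\<close> with \<open>\<lambda>\<close> in the dual lattice and
  \<open>\<lambda>(m) \<equiv> B(m, m)\<close> modulo 2; then \<open>[B] = [\<lambda> \<otimes> \<lambda>]\<close>. So the pairs \<open>(B, \<lambda>)\<close>, over the group of
  all \<open>(f, B)\<close>, form a crossed module that maps to \<open>wAct\<^sup>+(\<Theta>)\<close> and to \<open>\<Xi>\<close> by equivalences.\<close>


text \<open>Neither crossed module has an evident homomorphism to the other: a class in E has no
  preferred form B, and a weak automorphism determines B only up to a symmetric integral form. The
  group of all pairs (f, B) maps strictly to both degree-0 groups, and arbitrary choices enter only
  in the abstract passage from a span to a monoidal equivalence. The square of \<lambda> comes from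
  parity. If h has coboundary B and is integral on the lattice, then \<lambda>(m) = 2 h(m) - B(m, m)
  is additive and congruent to B(m, m) modulo 2. Since \<lambda>(m)^2 and \<lambda>(m) have the same
  parity, B minus the tensor square of \<lambda> is symmetric and even. Analyticity enters mostly
  through connectedness: a congruence modulo the integers between continuous functions on the vector
  space is an equality once it holds exactly at one point, whereas on the discrete lattice it stays
  a congruence. Hence k is a genuine real cocycle, while c is determined only modulo the
  integers.\<close>

section \<open>Crossed modules and their strict categorical groups\<close>

lemma crossed_moduleD:
  assumes "crossed_module \<Psi>"
  shows "group (deg0 \<Psi>)" "group (deg1 \<Psi>)" "bdry \<Psi> \<in> hom (deg1 \<Psi>) (deg0 \<Psi>)"
    and "\<And>x \<alpha>. \<lbrakk>\<alpha> \<in> carrier (deg1 \<Psi>); x \<in> carrier (deg0 \<Psi>)\<rbrakk> \<Longrightarrow> act \<Psi> \<alpha> x \<in> carrier (deg1 \<Psi>)"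
    and "\<And>x \<alpha> \<beta>. \<lbrakk>\<alpha> \<in> carrier (deg1 \<Psi>); \<beta> \<in> carrier (deg1 \<Psi>); x \<in> carrier (deg0 \<Psi>)\<rbrakk> \<Longrightarrow>
       act \<Psi> (\<alpha> \<otimes>\<^bsub>deg1 \<Psi>\<^esub> \<beta>) x = act \<Psi> \<alpha> x \<otimes>\<^bsub>deg1 \<Psi>\<^esub> act \<Psi> \<beta> x"
    and "\<And>\<alpha>. \<alpha> \<in> carrier (deg1 \<Psi>) \<Longrightarrow> act \<Psi> \<alpha> \<one>\<^bsub>deg0 \<Psi>\<^esub> = \<alpha>"
    and "\<And>x y \<alpha>. \<lbrakk>\<alpha> \<in> carrier (deg1 \<Psi>); x \<in> carrier (deg0 \<Psi>); y \<in> carrier (deg0 \<Psi>)\<rbrakk> \<Longrightarrow>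
       act \<Psi> \<alpha> (x \<otimes>\<^bsub>deg0 \<Psi>\<^esub> y) = act \<Psi> (act \<Psi> \<alpha> x) y"
    and "\<And>x \<alpha>. \<lbrakk>\<alpha> \<in> carrier (deg1 \<Psi>); x \<in> carrier (deg0 \<Psi>)\<rbrakk> \<Longrightarrow>
       bdry \<Psi> (act \<Psi> \<alpha> x) = inv\<^bsub>deg0 \<Psi>\<^esub> x \<otimes>\<^bsub>deg0 \<Psi>\<^esub> (bdry \<Psi> \<alpha> \<otimes>\<^bsub>deg0 \<Psi>\<^esub> x)"
    and "\<And>\<alpha> \<beta>. \<lbrakk>\<alpha> \<in> carrier (deg1 \<Psi>); \<beta> \<in> carrier (deg1 \<Psi>)\<rbrakk> \<Longrightarrow>
       act \<Psi> \<beta> (bdry \<Psi> \<alpha>) = inv\<^bsub>deg1 \<Psi>\<^esub> \<alpha> \<otimes>\<^bsub>deg1 \<Psi>\<^esub> (\<beta> \<otimes>\<^bsub>deg1 \<Psi>\<^esub> \<alpha>)"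
    and "\<And>\<alpha>. \<alpha> \<in> carrier (deg1 \<Psi>) \<Longrightarrow> bdry \<Psi> \<alpha> \<in> carrier (deg0 \<Psi>)"
    and "\<And>\<alpha> \<beta>. \<lbrakk>\<alpha> \<in> carrier (deg1 \<Psi>); \<beta> \<in> carrier (deg1 \<Psi>)\<rbrakk> \<Longrightarrow>
       bdry \<Psi> (\<alpha> \<otimes>\<^bsub>deg1 \<Psi>\<^esub> \<beta>) = bdry \<Psi> \<alpha> \<otimes>\<^bsub>deg0 \<Psi>\<^esub> bdry \<Psi> \<beta>"
    and "\<And>x. x \<in> carrier (deg0 \<Psi>) \<Longrightarrow> act \<Psi> \<one>\<^bsub>deg1 \<Psi>\<^esub> x = \<one>\<^bsub>deg1 \<Psi>\<^esub>"
    and "bdry \<Psi> \<one>\<^bsub>deg1 \<Psi>\<^esub> = \<one>\<^bsub>deg0 \<Psi>\<^esub>"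
    and "\<And>\<alpha>. \<alpha> \<in> carrier (deg1 \<Psi>) \<Longrightarrow> bdry \<Psi> (inv\<^bsub>deg1 \<Psi>\<^esub> \<alpha>) = inv\<^bsub>deg0 \<Psi>\<^esub> (bdry \<Psi> \<alpha>)"
    and "\<And>\<alpha> x. \<lbrakk>\<alpha> \<in> carrier (deg1 \<Psi>); x \<in> carrier (deg0 \<Psi>)\<rbrakk> \<Longrightarrow>
       act \<Psi> (inv\<^bsub>deg1 \<Psi>\<^esub> \<alpha>) x = inv\<^bsub>deg1 \<Psi>\<^esub> (act \<Psi> \<alpha> x)"
proof -
  note cm = assms[unfolded crossed_module_def]
  show g0: "group (deg0 \<Psi>)" and g1: "group (deg1 \<Psi>)"
    and b: "bdry \<Psi> \<in> hom (deg1 \<Psi>) (deg0 \<Psi>)" using cm by auto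
  interpret G0: group "deg0 \<Psi>" by (rule g0)
  interpret G1: group "deg1 \<Psi>" by (rule g1)
  interpret bh: group_hom "deg1 \<Psi>" "deg0 \<Psi>" "bdry \<Psi>" by unfold_locales (rule b)
  have ah: "group_hom (deg1 \<Psi>) (deg1 \<Psi>) (\<lambda>\<alpha>. act \<Psi> \<alpha> x)" if "x \<in> carrier (deg0 \<Psi>)" for x
    using cm that by unfold_locales auto
  show "act \<Psi> \<alpha> x \<in> carrier (deg1 \<Psi>)" if "\<alpha> \<in> carrier (deg1 \<Psi>)" "x \<in> carrier (deg0 \<Psi>)" for \<alpha> x
    using group_hom.hom_closed[OF ah] that by blast
  show "act \<Psi> (\<alpha> \<otimes>\<^bsub>deg1 \<Psi>\<^esub> \<beta>) x = act \<Psi> \<alpha> x \<otimes>\<^bsub>deg1 \<Psi>\<^esub> act \<Psi> \<beta> x"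
    if "\<alpha> \<in> carrier (deg1 \<Psi>)" "\<beta> \<in> carrier (deg1 \<Psi>)" "x \<in> carrier (deg0 \<Psi>)" for \<alpha> \<beta> x
    using group_hom.hom_mult[OF ah] that by blast
  show "act \<Psi> \<one>\<^bsub>deg1 \<Psi>\<^esub> x = \<one>\<^bsub>deg1 \<Psi>\<^esub>" if "x \<in> carrier (deg0 \<Psi>)" for x
    using group_hom.hom_one[OF ah] that by blast
  show "act \<Psi> (inv\<^bsub>deg1 \<Psi>\<^esub> \<alpha>) x = inv\<^bsub>deg1 \<Psi>\<^esub> (act \<Psi> \<alpha> x)"
    if "\<alpha> \<in> carrier (deg1 \<Psi>)" "x \<in> carrier (deg0 \<Psi>)" for \<alpha> x
    using group_hom.hom_inv[OF ah] that by blast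
  show "bdry \<Psi> (act \<Psi> \<alpha> x) = inv\<^bsub>deg0 \<Psi>\<^esub> x \<otimes>\<^bsub>deg0 \<Psi>\<^esub> (bdry \<Psi> \<alpha> \<otimes>\<^bsub>deg0 \<Psi>\<^esub> x)"
    if "\<alpha> \<in> carrier (deg1 \<Psi>)" "x \<in> carrier (deg0 \<Psi>)" for \<alpha> x
    using cm that by (simp add: G0.m_assoc)
  show "act \<Psi> \<beta> (bdry \<Psi> \<alpha>) = inv\<^bsub>deg1 \<Psi>\<^esub> \<alpha> \<otimes>\<^bsub>deg1 \<Psi>\<^esub> (\<beta> \<otimes>\<^bsub>deg1 \<Psi>\<^esub> \<alpha>)"
    if "\<alpha> \<in> carrier (deg1 \<Psi>)" "\<beta> \<in> carrier (deg1 \<Psi>)" for \<alpha> \<beta>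
    using cm that by (simp add: G1.m_assoc)
qed (use assms[unfolded crossed_module_def] group_hom.hom_one[of "deg1 \<Psi>" "deg0 \<Psi>"]
      group_hom.hom_inv[of "deg1 \<Psi>" "deg0 \<Psi>"] in
      \<open>auto simp: hom_mult hom_in_carrier group_hom_def group_hom_axioms_def\<close>)

context group begin

text \<open>Once words are bracketed to the right, an inverse meets its factor at the head of a
  longer word. These rules cancel there; together with \<open>word_simps\<close> and the
  right-bracketed laws of \<open>crossed_moduleD\<close> they let simp normalise words.\<close>

lemma inv_mult_cancel_left [simp]:
  "\<lbrakk>x \<in> carrier G; y \<in> carrier G\<rbrakk> \<Longrightarrow> inv x \<otimes> (x \<otimes> y) = y"
  "\<lbrakk>x \<in> carrier G; y \<in> carrier G\<rbrakk> \<Longrightarrow> x \<otimes> (inv x \<otimes> y) = y"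
  by (simp_all add: m_assoc[symmetric])

lemmas word_simps = m_assoc inv_mult_group

end

text \<open>The interchange law is the Peiffer identity, and equivariance of the boundary makes
  targets multiply under the tensor product.\<close>

lemma strict_categorical_group_of_crossed_module:
  assumes cm: "crossed_module \<Psi>"
  shows "strict_categorical_group (strict_cat_group_of \<Psi>)"
proof -
  note [simp] = crossed_moduleD(3-)[OF cm]
  interpret G0: group "deg0 \<Psi>" by (rule crossed_moduleD(1)[OF cm])
  interpret G1: group "deg1 \<Psi>" by (rule crossed_moduleD(2)[OF cm])
  have "groupoid (strict_cat_group_of \<Psi>)"
    unfolding groupoid_def strict_cat_group_of_def
    apply (auto simp: G0.word_simps G1.word_simps)
    subgoal for \<alpha> by (rule bexI[of _ "inv\<^bsub>deg1 \<Psi>\<^esub> \<alpha>"]) auto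
    done
  then show ?thesis
    unfolding strict_categorical_group_def strict_cat_group_of_def
    apply (auto simp: G0.word_simps G1.word_simps)
    subgoal for x by (rule bexI[of _ "inv\<^bsub>deg0 \<Psi>\<^esub> x"]) auto
    done
qed

section \<open>Equivalences of groupoids\<close>

definition hom_set :: "('o, 'a) monoidal_data \<Rightarrow> 'o \<Rightarrow> 'o \<Rightarrow> 'a set" where
  "hom_set C x y = {a \<in> Ar C. src C a = x \<and> tgt C a = y}"

text \<open>The inverse on arrows is forced by naturality of the chosen \<open>\<sigma>\<close>:
  \<open>Ga b\<close> is the unique arrow whose image is \<open>b\<close> conjugated by
  \<open>\<sigma>\<close>. Every law for \<open>Ga\<close> is checked after applying the faithful
  \<open>Fa\<close> and composing with the invertible \<open>\<sigma>\<close>.\<close>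

lemma fully_faithful_essentially_surjective_inverse:
  assumes C: "groupoid C" and D: "groupoid D" and F: "functor_between C D Fo Fa"
    and ff: "\<And>x y. \<lbrakk>x \<in> Ob C; y \<in> Ob C\<rbrakk> \<Longrightarrow> bij_betw Fa (hom_set C x y) (hom_set D (Fo x) (Fo y))"
    and es: "\<And>d. d \<in> Ob D \<Longrightarrow> \<exists>x\<in>Ob C. hom_set D d (Fo x) \<noteq> {}"
  obtains Go Ga \<tau> \<sigma> where "functor_between D C Go Ga"
    "natural_transformation C C id id (Go \<circ> Fo) (Ga \<circ> Fa) \<tau>"
    "natural_transformation D D id id (Fo \<circ> Go) (Fa \<circ> Ga) \<sigma>"
proof -
  have arC: "\<And>a. a \<in> Ar C \<Longrightarrow> src C a \<in> Ob C \<and> tgt C a \<in> Ob C"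
    and idC: "\<And>x. x \<in> Ob C \<Longrightarrow> idt C x \<in> Ar C \<and> src C (idt C x) = x \<and> tgt C (idt C x) = x"
    and cmpC: "\<And>a b. \<lbrakk>a \<in> Ar C; b \<in> Ar C; tgt C a = src C b\<rbrakk> \<Longrightarrow>
      cmp C a b \<in> Ar C \<and> src C (cmp C a b) = src C a \<and> tgt C (cmp C a b) = tgt C b"
    using C unfolding groupoid_def by auto
  have arD: "\<And>a. a \<in> Ar D \<Longrightarrow> src D a \<in> Ob D \<and> tgt D a \<in> Ob D"
    and idD: "\<And>x. x \<in> Ob D \<Longrightarrow> idt D x \<in> Ar D \<and> src D (idt D x) = x \<and> tgt D (idt D x) = x"
    and cmpD: "\<And>a b. \<lbrakk>a \<in> Ar D; b \<in> Ar D; tgt D a = src D b\<rbrakk> \<Longrightarrow>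
      cmp D a b \<in> Ar D \<and> src D (cmp D a b) = src D a \<and> tgt D (cmp D a b) = tgt D b"
    and unitD: "\<And>a. a \<in> Ar D \<Longrightarrow> cmp D (idt D (src D a)) a = a"
               "\<And>a. a \<in> Ar D \<Longrightarrow> cmp D a (idt D (tgt D a)) = a"
    and assocD: "\<And>a b c. \<lbrakk>a \<in> Ar D; b \<in> Ar D; c \<in> Ar D; tgt D a = src D b; tgt D b = src D c\<rbrakk> \<Longrightarrow>
       cmp D (cmp D a b) c = cmp D a (cmp D b c)"
    and invD: "\<forall>a\<in>Ar D. \<exists>b. b \<in> Ar D \<and> src D b = tgt D a \<and> tgt D b = src D a \<and>
       cmp D a b = idt D (src D a) \<and> cmp D b a = idt D (tgt D a)"
    using D unfolding groupoid_def by auto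
  have Fob: "\<And>x. x \<in> Ob C \<Longrightarrow> Fo x \<in> Ob D"
    and Far: "\<And>a. a \<in> Ar C \<Longrightarrow> Fa a \<in> Ar D \<and> src D (Fa a) = Fo (src C a) \<and> tgt D (Fa a) = Fo (tgt C a)"
    and Fid: "\<And>x. x \<in> Ob C \<Longrightarrow> Fa (idt C x) = idt D (Fo x)"
    and Fcmp: "\<And>a b. \<lbrakk>a \<in> Ar C; b \<in> Ar C; tgt C a = src C b\<rbrakk> \<Longrightarrow> Fa (cmp C a b) = cmp D (Fa a) (Fa b)"
    using F unfolding functor_between_def by auto
  obtain V where V: "\<And>a. a \<in> Ar D \<Longrightarrow> V a \<in> Ar D \<and> src D (V a) = tgt D a \<and> tgt D (V a) = src D a \<and>
       cmp D a (V a) = idt D (src D a) \<and> cmp D (V a) a = idt D (tgt D a)"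
    using bchoice[OF invD] by blast
  have "\<forall>d\<in>Ob D. \<exists>x s. x \<in> Ob C \<and> s \<in> Ar D \<and> src D s = d \<and> tgt D s = Fo x"
    using es unfolding hom_set_def by blast
  then obtain Go \<sigma> where G: "\<And>d. d \<in> Ob D \<Longrightarrow>
      Go d \<in> Ob C \<and> \<sigma> d \<in> Ar D \<and> src D (\<sigma> d) = d \<and> tgt D (\<sigma> d) = Fo (Go d)"
    by metis
  define L where "L x y b = inv_into (hom_set C x y) Fa b" for x y b
  have L: "L x y b \<in> Ar C \<and> src C (L x y b) = x \<and> tgt C (L x y b) = y \<and> Fa (L x y b) = b"
    if "x \<in> Ob C" "y \<in> Ob C" "b \<in> Ar D" "src D b = Fo x" "tgt D b = Fo y" for x y b
  proof -
    have b: "b \<in> Fa ` hom_set C x y"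
      using ff[OF that(1,2)] that(3-) by (auto simp: bij_betw_def hom_set_def)
    show ?thesis
      using inv_into_into[OF b] f_inv_into_f[OF b] by (auto simp: L_def hom_set_def)
  qed
  have faithful: "a = b" if "a \<in> Ar C" "b \<in> Ar C" "src C a = src C b" "tgt C a = tgt C b" "Fa a = Fa b" for a b
    using ff[of "src C a" "tgt C a"] arC that
    by (auto simp: bij_betw_def hom_set_def inj_on_def)
  define Ga where "Ga b = L (Go (src D b)) (Go (tgt D b))
    (cmp D (V (\<sigma> (src D b))) (cmp D b (\<sigma> (tgt D b))))" for b
  have Ga: "Ga b \<in> Ar C \<and> src C (Ga b) = Go (src D b) \<and> tgt C (Ga b) = Go (tgt D b) \<and>
      Fa (Ga b) = cmp D (V (\<sigma> (src D b))) (cmp D b (\<sigma> (tgt D b)))" if "b \<in> Ar D" for b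
    unfolding Ga_def by (rule L) (use that arD G V cmpD in simp_all)
  have nat: "cmp D (\<sigma> (src D b)) (Fa (Ga b)) = cmp D b (\<sigma> (tgt D b))" if b: "b \<in> Ar D" for b
  proof -
    define s t where "s = \<sigma> (src D b)" and "t = cmp D b (\<sigma> (tgt D b))"
    have s: "s \<in> Ar D" "tgt D (V s) = src D b" "src D s = src D b" and Vs: "V s \<in> Ar D" "tgt D s = src D (V s)"
      "cmp D s (V s) = idt D (src D b)"
      using b arD G V by (simp_all add: s_def)
    have t: "t \<in> Ar D" "src D t = src D b" using b arD G cmpD by (simp_all add: t_def)
    have "cmp D s (cmp D (V s) t) = cmp D (cmp D s (V s)) t"
      by (rule assocD[symmetric]) (simp_all add: s t Vs)
    also have "\<dots> = t"
      using unitD(1)[OF t(1)] t Vs by simp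
    finally have "cmp D s (cmp D (V s) t) = t" .
    then show ?thesis using Ga[OF b] by (simp add: s_def t_def)
  qed
  have GF: "Ga b \<in> Ar C \<and> src C (Ga b) = Go (src D b) \<and> tgt C (Ga b) = Go (tgt D b) \<and>
      Fa (Ga b) \<in> Ar D \<and> src D (Fa (Ga b)) = Fo (Go (src D b)) \<and> tgt D (Fa (Ga b)) = Fo (Go (tgt D b))"
    if "b \<in> Ar D" for b
    using Ga[OF that] Far[of "Ga b"] by metis
  have cancel: "a = b" if "s \<in> Ar D" "a \<in> Ar D" "b \<in> Ar D" "tgt D s = src D a" "tgt D s = src D b"
    "cmp D s a = cmp D s b" for s a b
  proof -
    have "a = cmp D (cmp D (V s) s) a" using that V unitD(1)[of a] by simp
    also have "\<dots> = cmp D (cmp D (V s) s) b" by (subst (1 2) assocD) (use that V in auto)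
    also have "\<dots> = b" using that V unitD(1)[of b] by simp
    finally show ?thesis .
  qed
  have functorG: "functor_between D C Go Ga"
    unfolding functor_between_def
  proof (intro conjI ballI impI)
    fix d assume d: "d \<in> Ob D"
    have i: "idt D d \<in> Ar D" "src D (idt D d) = d" "tgt D (idt D d) = d" using d idD by auto
    have g: "Ga (idt D d) \<in> Ar C" "src C (Ga (idt D d)) = Go d" "tgt C (Ga (idt D d)) = Go d"
      using Ga[OF i(1)] i by auto
    have f: "Fa (Ga (idt D d)) \<in> Ar D" "src D (Fa (Ga (idt D d))) = Fo (Go d)"
      using Far[OF g(1)] g by auto
    have "cmp D (\<sigma> d) (Fa (Ga (idt D d))) = cmp D (\<sigma> d) (idt D (Fo (Go d)))"
      using nat[OF i(1)] i unitD(1)[of "\<sigma> d"] unitD(2)[of "\<sigma> d"] G[OF d] by simp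
    then have "Fa (Ga (idt D d)) = idt D (Fo (Go d))"
      using cancel[of "\<sigma> d" "Fa (Ga (idt D d))" "idt D (Fo (Go d))"] G[OF d] f idD Fob by simp
    then show "Ga (idt D d) = idt C (Go d)"
      using d G GF idD idC Fid by (intro faithful) auto
  next
    fix a b assume ab: "a \<in> Ar D" "b \<in> Ar D" "tgt D a = src D b"
    have "Fa (Ga (cmp D a b)) = cmp D (Fa (Ga a)) (Fa (Ga b))"
    proof (rule cancel[of "\<sigma> (src D a)"])
      have "cmp D (\<sigma> (src D a)) (Fa (Ga (cmp D a b))) = cmp D (cmp D a b) (\<sigma> (tgt D b))"
        using ab nat[of "cmp D a b"] cmpD by simp
      also have "\<dots> = cmp D a (cmp D (\<sigma> (src D b)) (Fa (Ga b)))"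
        using ab nat[of b] G arD assocD[of a b] by simp
      also have "\<dots> = cmp D (cmp D a (\<sigma> (tgt D a))) (Fa (Ga b))"
        using ab G arD assocD GF by simp
      also have "\<dots> = cmp D (cmp D (\<sigma> (src D a)) (Fa (Ga a))) (Fa (Ga b))"
        using ab nat[of a] by simp
      also have "\<dots> = cmp D (\<sigma> (src D a)) (cmp D (Fa (Ga a)) (Fa (Ga b)))"
        by (rule assocD) (use ab G arD GF in auto)
      finally show "cmp D (\<sigma> (src D a)) (Fa (Ga (cmp D a b))) =
        cmp D (\<sigma> (src D a)) (cmp D (Fa (Ga a)) (Fa (Ga b)))" .
    qed (use ab G arD GF cmpD in auto)
    then show "Ga (cmp D a b) = cmp C (Ga a) (Ga b)"
      using ab GF cmpD cmpC Fcmp by (intro faithful) auto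
  qed (use G GF in auto)
  define \<tau> where "\<tau> x = L x (Go (Fo x)) (\<sigma> (Fo x))" for x
  have \<tau>: "\<tau> x \<in> Ar C \<and> src C (\<tau> x) = x \<and> tgt C (\<tau> x) = Go (Fo x) \<and> Fa (\<tau> x) = \<sigma> (Fo x)"
    if "x \<in> Ob C" for x
    unfolding \<tau>_def using that G Fob by (intro L) auto
  have "natural_transformation C C id id (Go \<circ> Fo) (Ga \<circ> Fa) \<tau>"
    unfolding natural_transformation_def
  proof (intro conjI ballI)
    fix a assume a: "a \<in> Ar C"
    have "Fa (cmp C a (\<tau> (tgt C a))) = Fa (cmp C (\<tau> (src C a)) (Ga (Fa a)))"
      using a \<tau> arC GF Far Fcmp nat[of "Fa a"] by simp
    then show "cmp C (id a) (\<tau> (tgt C a)) = cmp C (\<tau> (src C a)) ((Ga \<circ> Fa) a)"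
      using a \<tau> arC GF Far cmpC by (intro faithful) auto
  qed (use \<tau> in auto)
  moreover have "natural_transformation D D id id (Fo \<circ> Go) (Fa \<circ> Ga) \<sigma>"
    unfolding natural_transformation_def using G nat by auto
  ultimately show ?thesis using that functorG by blast
qed


text \<open>A span of crossed modules \<open>C \<leftarrow> M \<rightarrow> D\<close>, both legs of which are equivalences. The
  degree-1 group of \<open>M\<close> is the fibre product of \<open>q\<close> with the structure map of \<open>C\<close>, and
  \<open>l\<close> is the degree-1 part of the right leg; bijectivity of \<open>l\<close> says that this is also the
  fibre product of \<open>r\<close> with the structure map of \<open>D\<close>.\<close>

locale crossed_module_span =
  fixes C :: "('a, 'b) crossed_module_data" and D :: "('c, 'd) crossed_module_data"
    and H :: "'h monoid" and q :: "'h \<Rightarrow> 'a" and r :: "'h \<Rightarrow> 'c" and l :: "'h \<Rightarrow> 'b \<Rightarrow> 'd"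
  assumes C: "crossed_module C" and D: "crossed_module D" and H: "group H"
    and q_hom: "q \<in> hom H (deg0 C)" and r_hom: "r \<in> hom H (deg0 D)"
    and l_closed: "\<And>h \<gamma>. \<lbrakk>h \<in> carrier H; \<gamma> \<in> carrier (deg1 C); q h = bdry C \<gamma>\<rbrakk> \<Longrightarrow>
      l h \<gamma> \<in> carrier (deg1 D) \<and> bdry D (l h \<gamma>) = r h"
    and l_inj: "\<And>h \<gamma> \<gamma>'. \<lbrakk>h \<in> carrier H; \<gamma> \<in> carrier (deg1 C); q h = bdry C \<gamma>;
      \<gamma>' \<in> carrier (deg1 C); q h = bdry C \<gamma>'; l h \<gamma> = l h \<gamma>'\<rbrakk> \<Longrightarrow> \<gamma> = \<gamma>'"
    and l_surj: "\<And>h \<delta>. \<lbrakk>h \<in> carrier H; \<delta> \<in> carrier (deg1 D); r h = bdry D \<delta>\<rbrakk> \<Longrightarrow>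
      \<exists>\<gamma>\<in>carrier (deg1 C). q h = bdry C \<gamma> \<and> l h \<gamma> = \<delta>"
    and l_mult: "\<And>h \<gamma> h' \<gamma>'. \<lbrakk>h \<in> carrier H; \<gamma> \<in> carrier (deg1 C); q h = bdry C \<gamma>;
      h' \<in> carrier H; \<gamma>' \<in> carrier (deg1 C); q h' = bdry C \<gamma>'\<rbrakk> \<Longrightarrow>
      l (h \<otimes>\<^bsub>H\<^esub> h') (\<gamma> \<otimes>\<^bsub>deg1 C\<^esub> \<gamma>') = l h \<gamma> \<otimes>\<^bsub>deg1 D\<^esub> l h' \<gamma>'"
    and l_act: "\<And>h \<gamma> g. \<lbrakk>h \<in> carrier H; \<gamma> \<in> carrier (deg1 C); q h = bdry C \<gamma>; g \<in> carrier H\<rbrakk> \<Longrightarrow>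
      l (inv\<^bsub>H\<^esub> g \<otimes>\<^bsub>H\<^esub> h \<otimes>\<^bsub>H\<^esub> g) (act C \<gamma> (q g)) = act D (l h \<gamma>) (r g)"
    and q_es: "\<And>p. p \<in> carrier (deg0 C) \<Longrightarrow>
      \<exists>a\<in>carrier H. \<exists>\<gamma>\<in>carrier (deg1 C). q a = p \<otimes>\<^bsub>deg0 C\<^esub> bdry C \<gamma>"
    and r_es: "\<And>d. d \<in> carrier (deg0 D) \<Longrightarrow>
      \<exists>a\<in>carrier H. \<exists>\<delta>\<in>carrier (deg1 D). r a = d \<otimes>\<^bsub>deg0 D\<^esub> bdry D \<delta>"
begin

sublocale C0: group "deg0 C" by (rule crossed_moduleD(1)[OF C])
sublocale C1: group "deg1 C" by (rule crossed_moduleD(2)[OF C])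
sublocale D0: group "deg0 D" by (rule crossed_moduleD(1)[OF D])
sublocale D1: group "deg1 D" by (rule crossed_moduleD(2)[OF D])
sublocale H: group H by (rule H)
sublocale q: group_hom H "deg0 C" q by unfold_locales (rule q_hom)
sublocale r: group_hom H "deg0 D" r by unfold_locales (rule r_hom)

abbreviation multC0 (infixl "\<cdot>\<^sub>0" 70) where "x \<cdot>\<^sub>0 y \<equiv> x \<otimes>\<^bsub>deg0 C\<^esub> y"
abbreviation multC1 (infixl "\<cdot>\<^sub>1" 70) where "\<alpha> \<cdot>\<^sub>1 \<beta> \<equiv> \<alpha> \<otimes>\<^bsub>deg1 C\<^esub> \<beta>"
abbreviation cC where "cC \<equiv> strict_cat_group_of C"
abbreviation cD where "cD \<equiv> strict_cat_group_of D"

lemmas Csimps [simp] = crossed_moduleD(3-)[OF C]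
lemmas Dsimps [simp] = crossed_moduleD(3-)[OF D]
lemmas words = C0.word_simps C1.word_simps D0.word_simps D1.word_simps H.word_simps

text \<open>The arrow of \<open>D\<close> between the images of \<open>a\<close> and \<open>b\<close> that corresponds to the arrow
  \<open>\<gamma>\<close> of \<open>C\<close> between them.\<close>

definition arr :: "'h \<Rightarrow> 'b \<Rightarrow> 'h \<Rightarrow> 'c \<times> 'd" where
  "arr a \<gamma> b = (r a, l (inv\<^bsub>H\<^esub> a \<otimes>\<^bsub>H\<^esub> b) \<gamma>)"

definition is_arr :: "'h \<Rightarrow> 'b \<Rightarrow> 'h \<Rightarrow> bool" where
  "is_arr a \<gamma> b \<longleftrightarrow> a \<in> carrier H \<and> b \<in> carrier H \<and> \<gamma> \<in> carrier (deg1 C) \<and>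
     q b = q a \<cdot>\<^sub>0 bdry C \<gamma>"

lemma is_arrD:
  assumes "is_arr a \<gamma> b"
  shows "a \<in> carrier H" "b \<in> carrier H" "\<gamma> \<in> carrier (deg1 C)"
    "q (inv\<^bsub>H\<^esub> a \<otimes>\<^bsub>H\<^esub> b) = bdry C \<gamma>"
  using assms by (auto simp: is_arr_def)

lemma arr_in:
  assumes "is_arr a \<gamma> b"
  shows "arr a \<gamma> b \<in> Ar cD" "src cD (arr a \<gamma> b) = r a" "tgt cD (arr a \<gamma> b) = r b"
  using l_closed[OF _ is_arrD(3,4)[OF assms]] is_arrD[OF assms]
  by (auto simp: arr_def strict_cat_group_of_def)

lemma arr_cmp:
  assumes "is_arr a \<gamma> b" "is_arr b \<gamma>' c"
  shows "cmp cD (arr a \<gamma> b) (arr b \<gamma>' c) = arr a (\<gamma> \<cdot>\<^sub>1 \<gamma>') c"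
    "is_arr a (\<gamma> \<cdot>\<^sub>1 \<gamma>') c"
proof -
  have "l ((inv\<^bsub>H\<^esub> a \<otimes>\<^bsub>H\<^esub> b) \<otimes>\<^bsub>H\<^esub> (inv\<^bsub>H\<^esub> b \<otimes>\<^bsub>H\<^esub> c)) (\<gamma> \<cdot>\<^sub>1 \<gamma>') =
      l (inv\<^bsub>H\<^esub> a \<otimes>\<^bsub>H\<^esub> b) \<gamma> \<otimes>\<^bsub>deg1 D\<^esub> l (inv\<^bsub>H\<^esub> b \<otimes>\<^bsub>H\<^esub> c) \<gamma>'"
    using is_arrD[OF assms(1)] is_arrD[OF assms(2)] by (intro l_mult) auto
  moreover have "(inv\<^bsub>H\<^esub> a \<otimes>\<^bsub>H\<^esub> b) \<otimes>\<^bsub>H\<^esub> (inv\<^bsub>H\<^esub> b \<otimes>\<^bsub>H\<^esub> c) = inv\<^bsub>H\<^esub> a \<otimes>\<^bsub>H\<^esub> c"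
    using is_arrD[OF assms(1)] is_arrD[OF assms(2)] by (simp add: words)
  ultimately show "cmp cD (arr a \<gamma> b) (arr b \<gamma>' c) = arr a (\<gamma> \<cdot>\<^sub>1 \<gamma>') c"
    by (simp add: arr_def strict_cat_group_of_def)
  show "is_arr a (\<gamma> \<cdot>\<^sub>1 \<gamma>') c"
    using assms by (auto simp: is_arr_def words)
qed

text \<open>The inverse of a a' times b b' equals the conjugate of a^-1 b by a' followed by a'^-1
  b'. This is why \<open>l_act\<close> is stated for conjugates and \<open>l_mult\<close> for
  products.\<close>

lemma arr_tens:
  assumes "is_arr a \<gamma> b" "is_arr a' \<gamma>' b'"
  shows "tens_ar cD (arr a \<gamma> b) (arr a' \<gamma>' b') =
      arr (a \<otimes>\<^bsub>H\<^esub> a') (act C \<gamma> (q a') \<cdot>\<^sub>1 \<gamma>') (b \<otimes>\<^bsub>H\<^esub> b')"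
    "is_arr (a \<otimes>\<^bsub>H\<^esub> a') (act C \<gamma> (q a') \<cdot>\<^sub>1 \<gamma>') (b \<otimes>\<^bsub>H\<^esub> b')"
proof -
  note ar = is_arrD[OF assms(1)] is_arrD[OF assms(2)]
  have "q (inv\<^bsub>H\<^esub> a' \<otimes>\<^bsub>H\<^esub> (inv\<^bsub>H\<^esub> a \<otimes>\<^bsub>H\<^esub> b) \<otimes>\<^bsub>H\<^esub> a') = bdry C (act C \<gamma> (q a'))"
    using ar by (simp add: words del: q.hom_inv) (simp add: C0.m_assoc[symmetric])
  then have "l ((inv\<^bsub>H\<^esub> a' \<otimes>\<^bsub>H\<^esub> (inv\<^bsub>H\<^esub> a \<otimes>\<^bsub>H\<^esub> b) \<otimes>\<^bsub>H\<^esub> a') \<otimes>\<^bsub>H\<^esub> (inv\<^bsub>H\<^esub> a' \<otimes>\<^bsub>H\<^esub> b'))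
      (act C \<gamma> (q a') \<cdot>\<^sub>1 \<gamma>') =
      act D (l (inv\<^bsub>H\<^esub> a \<otimes>\<^bsub>H\<^esub> b) \<gamma>) (r a') \<otimes>\<^bsub>deg1 D\<^esub> l (inv\<^bsub>H\<^esub> a' \<otimes>\<^bsub>H\<^esub> b') \<gamma>'"
    using ar by (subst l_mult) (auto simp: l_act)
  moreover have "(inv\<^bsub>H\<^esub> a' \<otimes>\<^bsub>H\<^esub> (inv\<^bsub>H\<^esub> a \<otimes>\<^bsub>H\<^esub> b) \<otimes>\<^bsub>H\<^esub> a') \<otimes>\<^bsub>H\<^esub> (inv\<^bsub>H\<^esub> a' \<otimes>\<^bsub>H\<^esub> b') =
      inv\<^bsub>H\<^esub> (a \<otimes>\<^bsub>H\<^esub> a') \<otimes>\<^bsub>H\<^esub> (b \<otimes>\<^bsub>H\<^esub> b')"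
    using ar by (simp add: words)
  ultimately show "tens_ar cD (arr a \<gamma> b) (arr a' \<gamma>' b') =
      arr (a \<otimes>\<^bsub>H\<^esub> a') (act C \<gamma> (q a') \<cdot>\<^sub>1 \<gamma>') (b \<otimes>\<^bsub>H\<^esub> b')"
    using ar by (simp add: arr_def strict_cat_group_of_def)
  show "is_arr (a \<otimes>\<^bsub>H\<^esub> a') (act C \<gamma> (q a') \<cdot>\<^sub>1 \<gamma>') (b \<otimes>\<^bsub>H\<^esub> b')"
    using assms by (auto simp: is_arr_def words)
qed

lemma arr_id:
  assumes "a \<in> carrier H"
  shows "arr a \<one>\<^bsub>deg1 C\<^esub> a = idt cD (r a)" "is_arr a \<one>\<^bsub>deg1 C\<^esub> a"
proof -
  \<comment> \<open>The value at the two units is idempotent, hence the unit of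
    \<open>deg1 D\<close>.\<close>
  have "l \<one>\<^bsub>H\<^esub> \<one>\<^bsub>deg1 C\<^esub> \<otimes>\<^bsub>deg1 D\<^esub> l \<one>\<^bsub>H\<^esub> \<one>\<^bsub>deg1 C\<^esub> = l \<one>\<^bsub>H\<^esub> \<one>\<^bsub>deg1 C\<^esub>"
    using l_mult[of "\<one>\<^bsub>H\<^esub>" "\<one>\<^bsub>deg1 C\<^esub>" "\<one>\<^bsub>H\<^esub>" "\<one>\<^bsub>deg1 C\<^esub>"] by simp
  then have "l \<one>\<^bsub>H\<^esub> \<one>\<^bsub>deg1 C\<^esub> = \<one>\<^bsub>deg1 D\<^esub>"
    using l_closed[of "\<one>\<^bsub>H\<^esub>" "\<one>\<^bsub>deg1 C\<^esub>"] by simp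
  then show "arr a \<one>\<^bsub>deg1 C\<^esub> a = idt cD (r a)" "is_arr a \<one>\<^bsub>deg1 C\<^esub> a"
    using assms by (simp_all add: arr_def strict_cat_group_of_def is_arr_def)
qed

text \<open>Full faithfulness of the right leg relative to the left one: \<open>l_inj\<close> gives
  injectivity, and \<open>l_surj\<close> lifts an arrow of \<open>D\<close> between images of
  \<open>a\<close> and \<open>b\<close> to \<open>C\<close>.\<close>

lemma bij_betw_arr:
  assumes "a \<in> carrier H" "b \<in> carrier H"
  shows "bij_betw (\<lambda>\<gamma>. arr a \<gamma> b) {\<gamma>. is_arr a \<gamma> b} (hom_set cD (r a) (r b))"
proof (rule bij_betwI')
  fix \<gamma> \<gamma>' assume "\<gamma> \<in> {\<gamma>. is_arr a \<gamma> b}" "\<gamma>' \<in> {\<gamma>. is_arr a \<gamma> b}"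
  then have g: "is_arr a \<gamma> b" "is_arr a \<gamma>' b" by auto
  show "(arr a \<gamma> b = arr a \<gamma>' b) = (\<gamma> = \<gamma>')"
    using l_inj[OF _ is_arrD(3,4)[OF g(1)] is_arrD(3,4)[OF g(2)]] assms by (auto simp: arr_def)
next
  fix \<gamma> assume "\<gamma> \<in> {\<gamma>. is_arr a \<gamma> b}"
  then show "arr a \<gamma> b \<in> hom_set cD (r a) (r b)" using arr_in by (simp add: hom_set_def)
next
  fix e assume "e \<in> hom_set cD (r a) (r b)"
  then obtain \<delta> where e: "e = (r a, \<delta>)" "\<delta> \<in> carrier (deg1 D)" "r b = r a \<otimes>\<^bsub>deg0 D\<^esub> bdry D \<delta>"
    by (auto simp: hom_set_def strict_cat_group_of_def)
  then have "r (inv\<^bsub>H\<^esub> a \<otimes>\<^bsub>H\<^esub> b) = bdry D \<delta>" using assms by simp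
  then obtain \<gamma> where g: "\<gamma> \<in> carrier (deg1 C)" "q (inv\<^bsub>H\<^esub> a \<otimes>\<^bsub>H\<^esub> b) = bdry C \<gamma>"
      "l (inv\<^bsub>H\<^esub> a \<otimes>\<^bsub>H\<^esub> b) \<gamma> = \<delta>"
    using l_surj[of "inv\<^bsub>H\<^esub> a \<otimes>\<^bsub>H\<^esub> b" \<delta>] assms e by auto
  have "is_arr a \<gamma> b"
    using assms g(1) by (simp add: is_arr_def g(2)[symmetric])
  then show "\<exists>\<gamma>\<in>{\<gamma>. is_arr a \<gamma> b}. e = arr a \<gamma> b"
    using g e by (auto simp: arr_def)
qed

text \<open>Every object \<open>p\<close> of \<open>C\<close> is joined by a chosen arrow \<open>v p\<close> to the image of a chosen
  \<open>u p\<close>; the functor transports everything along these arrows.\<close>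

theorem monoidally_equivalent_span: "monoidally_equivalent cC cD"
proof -
  obtain u v where uv: "\<And>p. p \<in> carrier (deg0 C) \<Longrightarrow> u p \<in> carrier H \<and> v p \<in> carrier (deg1 C) \<and>
      q (u p) = p \<cdot>\<^sub>0 bdry C (v p)"
    using q_es by metis
  define Fo where "Fo p = r (u p)" for p
  define w where "w p \<eta> = inv\<^bsub>deg1 C\<^esub> (v p) \<cdot>\<^sub>1 (\<eta> \<cdot>\<^sub>1 v (p \<cdot>\<^sub>0 bdry C \<eta>))" for p \<eta>
  define Fa where "Fa = (\<lambda>(p, \<eta>). arr (u p) (w p \<eta>) (u (p \<cdot>\<^sub>0 bdry C \<eta>)))"
  \<comment> \<open>The tensor product of the arrows \<open>(p, v p)\<close> and
    \<open>(p', v p')\<close> has the label \<open>act C (v p) p' \<cdot>\<^sub>1 v p'\<close>.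
    Going back along it and then forward along \<open>v (p \<cdot>\<^sub>0 p')\<close> gives
    \<open>z\<close>.\<close>
  define z where "z p p' = inv\<^bsub>deg1 C\<^esub> (v p') \<cdot>\<^sub>1 (inv\<^bsub>deg1 C\<^esub> (act C (v p) p')
      \<cdot>\<^sub>1 v (p \<cdot>\<^sub>0 p'))" for p p'
  define \<phi> where "\<phi> p p' = arr (u p \<otimes>\<^bsub>H\<^esub> u p') (z p p') (u (p \<cdot>\<^sub>0 p'))" for p p'
  define \<epsilon> where "\<epsilon> = arr \<one>\<^bsub>H\<^esub> (v \<one>\<^bsub>deg0 C\<^esub>) (u \<one>\<^bsub>deg0 C\<^esub>)"
  have [simp]: "u p \<in> carrier H" "v p \<in> carrier (deg1 C)" "q (u p) = p \<cdot>\<^sub>0 bdry C (v p)"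
    if "p \<in> carrier (deg0 C)" for p using uv[OF that] by auto
  have w_arr: "is_arr (u p) (w p \<eta>) (u (p \<cdot>\<^sub>0 bdry C \<eta>))"
    if "p \<in> carrier (deg0 C)" "\<eta> \<in> carrier (deg1 C)" for p \<eta>
    using that by (simp add: is_arr_def w_def words)
  have z_arr: "is_arr (u p \<otimes>\<^bsub>H\<^esub> u p') (z p p') (u (p \<cdot>\<^sub>0 p'))"
    if "p \<in> carrier (deg0 C)" "p' \<in> carrier (deg0 C)" for p p'
    using that by (simp add: is_arr_def z_def words)
  have e_arr: "is_arr \<one>\<^bsub>H\<^esub> (v \<one>\<^bsub>deg0 C\<^esub>) (u \<one>\<^bsub>deg0 C\<^esub>)"
    by (simp add: is_arr_def)
  have F: "functor_between cC cD Fo Fa"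
  proof -
    have 1: "Fa (p, \<one>\<^bsub>deg1 C\<^esub>) = idt cD (Fo p)" if "p \<in> carrier (deg0 C)" for p
      using that by (simp add: Fa_def w_def Fo_def arr_id)
    have 2: "Fa (p, \<eta> \<cdot>\<^sub>1 \<eta>') = cmp cD (Fa (p, \<eta>)) (Fa (p \<cdot>\<^sub>0 bdry C \<eta>, \<eta>'))"
      if "p \<in> carrier (deg0 C)" "\<eta> \<in> carrier (deg1 C)" "\<eta>' \<in> carrier (deg1 C)" for p \<eta> \<eta>'
    proof -
      have "cmp cD (Fa (p, \<eta>)) (Fa (p \<cdot>\<^sub>0 bdry C \<eta>, \<eta>')) =
          arr (u p) (w p \<eta> \<cdot>\<^sub>1 w (p \<cdot>\<^sub>0 bdry C \<eta>) \<eta>')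
            (u (p \<cdot>\<^sub>0 bdry C \<eta> \<cdot>\<^sub>0 bdry C \<eta>'))"
        unfolding Fa_def using that by (simp add: arr_cmp(1) w_arr)
      then show ?thesis using that by (simp add: Fa_def w_def words)
    qed
    show ?thesis
      unfolding functor_between_def
      using w_arr[THEN arr_in(1)] w_arr[THEN arr_in(2)] w_arr[THEN arr_in(3)] 1 2
      by (auto simp: strict_cat_group_of_def[of C] Fa_def Fo_def) (simp add: strict_cat_group_of_def)
  qed
  \<comment> \<open>By \<open>arr_cmp\<close> and \<open>arr_tens\<close> both sides of each
    coherence law become a single \<open>arr\<close> with the same ends, so what remains is a word
    identity in \<open>deg1 C\<close>.\<close>
  have monoidal: "monoidal_functor cC cD Fo Fa \<phi> \<epsilon>"
  proof -
    have nat: "cmp cD (tens_ar cD (Fa (p, \<eta>)) (Fa (p', \<eta>')))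
        (\<phi> (p \<cdot>\<^sub>0 bdry C \<eta>) (p' \<cdot>\<^sub>0 bdry C \<eta>')) =
        cmp cD (\<phi> p p') (Fa (p \<cdot>\<^sub>0 p', act C \<eta> p' \<cdot>\<^sub>1 \<eta>'))"
      if "p \<in> carrier (deg0 C)" "\<eta> \<in> carrier (deg1 C)" "p' \<in> carrier (deg0 C)" "\<eta>' \<in> carrier (deg1 C)"
      for p \<eta> p' \<eta>'
    proof -
      have e: "p \<cdot>\<^sub>0 p' \<cdot>\<^sub>0 bdry C (act C \<eta> p' \<cdot>\<^sub>1 \<eta>') =
          p \<cdot>\<^sub>0 bdry C \<eta> \<cdot>\<^sub>0 (p' \<cdot>\<^sub>0 bdry C \<eta>')"
        using that by (simp add: words)
      have "is_arr (u (p \<cdot>\<^sub>0 p')) (w (p \<cdot>\<^sub>0 p') (act C \<eta> p' \<cdot>\<^sub>1 \<eta>'))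
          (u (p \<cdot>\<^sub>0 p' \<cdot>\<^sub>0 bdry C (act C \<eta> p' \<cdot>\<^sub>1 \<eta>')))"
        by (rule w_arr) (use that in auto)
      note a = this[unfolded e]
      note t = arr_tens[OF w_arr[OF that(1,2)] w_arr[OF that(3,4)]]
      show ?thesis
        unfolding Fa_def \<phi>_def prod.case t(1) e
        apply (subst arr_cmp(1)[OF t(2) z_arr])
        using that apply (auto simp: arr_cmp(1)[OF z_arr a])
        apply (rule arg_cong[where f = "\<lambda>x. arr _ x _"])
        apply (simp add: w_def z_def words e[simplified words])
        done
    qed
    have assoc: "cmp cD (tens_ar cD (\<phi> x y) (idt cD (Fo t))) (\<phi> (x \<cdot>\<^sub>0 y) t) =
        cmp cD (tens_ar cD (idt cD (Fo x)) (\<phi> y t)) (\<phi> x (y \<cdot>\<^sub>0 t))"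
      if xyt: "x \<in> carrier (deg0 C)" "y \<in> carrier (deg0 C)" "t \<in> carrier (deg0 C)" for x y t
    proof -
      have [simp]: "u x \<in> carrier H" "u y \<in> carrier H" "u t \<in> carrier H" using xyt by auto
      note t1 = arr_tens[OF z_arr[OF xyt(1,2)] arr_id(2)[of "u t"]]
      note t2 = arr_tens[OF arr_id(2)[of "u x"] z_arr[OF xyt(2,3)]]
      have 1: "is_arr (u (x \<cdot>\<^sub>0 y) \<otimes>\<^bsub>H\<^esub> u t) (z (x \<cdot>\<^sub>0 y) t)
          (u (x \<cdot>\<^sub>0 y \<cdot>\<^sub>0 t))"
        using xyt by (intro z_arr) auto
      have 2: "is_arr (u x \<otimes>\<^bsub>H\<^esub> u (y \<cdot>\<^sub>0 t)) (z x (y \<cdot>\<^sub>0 t))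
          (u (x \<cdot>\<^sub>0 (y \<cdot>\<^sub>0 t)))"
        using xyt by (intro z_arr) auto
      show ?thesis
        unfolding \<phi>_def Fo_def arr_id(1)[symmetric, OF \<open>u t \<in> carrier H\<close>]
          arr_id(1)[symmetric, OF \<open>u x \<in> carrier H\<close>]
        apply (subst t1(1), simp, subst t2(1), simp, subst arr_cmp(1)[OF t1(2) 1], simp,
            subst arr_cmp(1)[OF t2(2) 2], simp)
        using xyt apply (simp add: z_def words)
        done
    qed
    have unit: "cmp cD (tens_ar cD \<epsilon> (idt cD (Fo x))) (\<phi> \<one>\<^bsub>deg0 C\<^esub> x) = idt cD (Fo x)"
       "cmp cD (tens_ar cD (idt cD (Fo x)) \<epsilon>) (\<phi> x \<one>\<^bsub>deg0 C\<^esub>) = idt cD (Fo x)"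
      if x: "x \<in> carrier (deg0 C)" for x
    proof -
      have ux: "u x \<in> carrier H" using x by simp
      note t1 = arr_tens[OF e_arr arr_id(2)[OF ux]]
      note t2 = arr_tens[OF arr_id(2)[OF ux] e_arr]
      note i = arr_id(1)[symmetric, OF ux]
      show "cmp cD (tens_ar cD \<epsilon> (idt cD (Fo x))) (\<phi> \<one>\<^bsub>deg0 C\<^esub> x) = idt cD (Fo x)"
        unfolding \<phi>_def Fo_def \<epsilon>_def i t1(1)
        apply (subst arr_cmp(1)[OF t1(2) z_arr])
        using x apply (simp_all add: z_def words)
        done
      show "cmp cD (tens_ar cD (idt cD (Fo x)) \<epsilon>) (\<phi> x \<one>\<^bsub>deg0 C\<^esub>) = idt cD (Fo x)"
        unfolding \<phi>_def Fo_def \<epsilon>_def i t2(1)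
        apply (subst arr_cmp(1)[OF t2(2) z_arr])
        using x apply (simp_all add: z_def words)
        done
    qed
    have o: "\<phi> p p' \<in> Ar cD \<and> src cD (\<phi> p p') = tens_ob cD (Fo p) (Fo p') \<and>
        tgt cD (\<phi> p p') = Fo (p \<cdot>\<^sub>0 p')"
      if "p \<in> carrier (deg0 C)" "p' \<in> carrier (deg0 C)" for p p'
      using arr_in[OF z_arr[OF that]] that by (simp add: \<phi>_def Fo_def strict_cat_group_of_def)
    show ?thesis
      unfolding monoidal_functor_def
      using F nat assoc unit o arr_in[OF e_arr]
      by (auto simp: strict_cat_group_of_def[of C] \<epsilon>_def Fo_def) (auto simp: strict_cat_group_of_def)
  qed
  have ff: "bij_betw Fa (hom_set cC x y) (hom_set cD (Fo x) (Fo y))" if "x \<in> Ob cC" "y \<in> Ob cC" for x y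
  proof -
    have xy: "x \<in> carrier (deg0 C)" "y \<in> carrier (deg0 C)"
      using that by (simp_all add: strict_cat_group_of_def)
    have hom: "hom_set cC x y = Pair x ` {\<eta> \<in> carrier (deg1 C). x \<cdot>\<^sub>0 bdry C \<eta> = y}"
      using xy by (auto simp: hom_set_def strict_cat_group_of_def)
    have "bij_betw (w x) {\<eta> \<in> carrier (deg1 C). x \<cdot>\<^sub>0 bdry C \<eta> = y} {\<gamma>. is_arr (u x) \<gamma> (u y)}"
      (is "bij_betw _ ?A ?B")
    proof (rule bij_betw_byWitness[where f' = "\<lambda>\<gamma>. v x \<cdot>\<^sub>1 (\<gamma> \<cdot>\<^sub>1 inv\<^bsub>deg1 C\<^esub> (v y))"])
      show "\<forall>\<eta>\<in>?A. v x \<cdot>\<^sub>1 (w x \<eta> \<cdot>\<^sub>1 inv\<^bsub>deg1 C\<^esub> v y) = \<eta>"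
        using xy by (auto simp: w_def words)
      have B: "x \<cdot>\<^sub>0 (bdry C (v x) \<cdot>\<^sub>0 (bdry C \<gamma> \<cdot>\<^sub>0 inv\<^bsub>deg0 C\<^esub> bdry C (v y))) = y"
        if "is_arr (u x) \<gamma> (u y)" for \<gamma>
      proof -
        have "x \<cdot>\<^sub>0 (bdry C (v x) \<cdot>\<^sub>0 bdry C \<gamma>) = y \<cdot>\<^sub>0 bdry C (v y)"
          using that xy by (simp add: is_arr_def words)
        from arg_cong[OF this, of "\<lambda>t. t \<cdot>\<^sub>0 inv\<^bsub>deg0 C\<^esub> bdry C (v y)"] show ?thesis
          using is_arrD(3)[OF that] xy by (simp add: words)
      qed
      show "\<forall>\<gamma>\<in>?B. w x (v x \<cdot>\<^sub>1 (\<gamma> \<cdot>\<^sub>1 inv\<^bsub>deg1 C\<^esub> v y)) = \<gamma>"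
        using xy B is_arrD(3) by (auto simp: w_def words)
      show "w x ` ?A \<subseteq> ?B" using w_arr xy by auto
      show "(\<lambda>\<gamma>. v x \<cdot>\<^sub>1 (\<gamma> \<cdot>\<^sub>1 inv\<^bsub>deg1 C\<^esub> v y)) ` ?B \<subseteq> ?A"
        using xy B is_arrD(3) by (auto simp: words)
    qed
    from bij_betw_trans[OF this bij_betw_arr]
    have "bij_betw ((\<lambda>\<gamma>. arr (u x) \<gamma> (u y)) \<circ> w x) ?A (hom_set cD (Fo x) (Fo y))"
      using xy by (simp add: Fo_def)
    moreover have "((\<lambda>\<gamma>. arr (u x) \<gamma> (u y)) \<circ> w x) \<eta> = (Fa \<circ> Pair x) \<eta>" if "\<eta> \<in> ?A" for \<eta>
      using that by (auto simp: Fa_def)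
    ultimately have "bij_betw (Fa \<circ> Pair x) ?A (hom_set cD (Fo x) (Fo y))"
      using bij_betw_cong by blast
    then show ?thesis
      unfolding hom by (subst bij_betw_comp_iff[of "Pair x" ?A, OF _ ]) (auto simp: bij_betw_def inj_on_def)
  qed
  have es: "\<exists>x\<in>Ob cC. hom_set cD d (Fo x) \<noteq> {}" if "d \<in> Ob cD" for d
  proof -
    have d: "d \<in> carrier (deg0 D)" using that by (simp add: strict_cat_group_of_def)
    obtain a \<delta> where a: "a \<in> carrier H" "\<delta> \<in> carrier (deg1 D)" "r a = d \<otimes>\<^bsub>deg0 D\<^esub> bdry D \<delta>"
      using r_es[OF d] by blast
    then have d1: "(d, \<delta>) \<in> hom_set cD d (r a)"
      using d by (simp add: hom_set_def strict_cat_group_of_def)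
    \<comment> \<open>\<open>r_es\<close> reaches \<open>r a\<close> for some arbitrary
      \<open>a\<close>, while \<open>Fo\<close> takes values only at the chosen objects; the arrow
      \<open>v (q a)\<close> joins \<open>a\<close> to the chosen \<open>u (q a)\<close>.\<close>
    have "is_arr a (v (q a)) (u (q a))" using a by (simp add: is_arr_def)
    note d2 = arr_in[OF this]
    have "cmp cD (d, \<delta>) (arr a (v (q a)) (u (q a))) \<in> hom_set cD d (Fo (q a))"
      using d1 d2 strict_categorical_group_of_crossed_module[OF D]
      unfolding strict_categorical_group_def groupoid_def hom_set_def Fo_def by auto
    then show ?thesis using a(1) by (auto simp: strict_cat_group_of_def)
  qed
  have scC: "strict_categorical_group cC" and scD: "strict_categorical_group cD"
    using strict_categorical_group_of_crossed_module C D by auto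
  then have "groupoid cC" "groupoid cD"
    unfolding strict_categorical_group_def by simp_all
  then have "\<exists>Go Ga \<tau> \<sigma>. functor_between cD cC Go Ga \<and>
    natural_transformation cC cC id id (Go \<circ> Fo) (Ga \<circ> Fa) \<tau> \<and>
    natural_transformation cD cD id id (Fo \<circ> Go) (Fa \<circ> Ga) \<sigma>"
    by (rule fully_faithful_essentially_surjective_inverse[OF _ _ F ff es]) blast+
  then show ?thesis unfolding monoidally_equivalent_def using scC scD monoidal by blast
qed

end

section \<open>Finite-dimensional normed spaces\<close>

locale finite_basis =
  fixes b :: "'v::real_normed_vector set"
  assumes finite_b: "finite b" and independent_b: "independent b" and span_b: "span b = UNIV"
begin

abbreviation rep :: "'v \<Rightarrow> 'v \<Rightarrow> real" where "rep \<equiv> representation b"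

lemma rep_sum: "(\<Sum>e\<in>b. rep v e *\<^sub>R e) = v"
  by (rule real_vector.sum_representation_eq) (auto simp: independent_b span_b finite_b)

lemma rep_add: "rep (v + w) e = rep v e + rep w e"
  and rep_scale: "rep (t *\<^sub>R v) e = t * rep v e"
  and rep_basis: "e' \<in> b \<Longrightarrow> rep e' e = (if e = e' then 1 else 0)"
  by (simp_all add: real_vector.representation_add real_vector.representation_scale
      real_vector.representation_basis independent_b span_b)

lemma rep_0 [simp]: "rep 0 e = 0"
  by (simp add: real_vector.representation_zero)

lemma rep_unique: "(\<And>e. e \<notin> b \<Longrightarrow> c e = 0) \<Longrightarrow> rep (\<Sum>e\<in>b. c e *\<^sub>R e) = c"
  by (rule real_vector.representation_eqI)
    (use finite_b in \<open>auto simp: independent_b span_b intro!: sum.mono_neutral_left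
      intro: rev_finite_subset[OF finite_b]\<close>)

text \<open>Equivalence of norms in finite dimension, for an arbitrary given norm: on each face of
  the coordinate cube the norm attains a positive minimum, because the face avoids the origin, and
  scaling carries the bound to all vectors.\<close>

lemma rep_bounded: "\<exists>K>0. \<forall>v e. \<bar>rep v e\<bar> \<le> K * norm v"
proof -
  \<comment> \<open>Coordinates outside \<open>b\<close> are pinned to 0, so the cube is compact in
    the space of all real functions on \<open>'v\<close>.\<close>
  define X :: "('v \<Rightarrow> real) set" where "X = PiE UNIV (\<lambda>e. if e \<in> b then {-1..1} else {0})"
  define g :: "('v \<Rightarrow> real) \<Rightarrow> real" where "g c = norm (\<Sum>e\<in>b. c e *\<^sub>R e)" for c
  have "compactin (product_topology (\<lambda>_. euclidean) UNIV) X"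
    unfolding X_def by (subst compactin_PiE) auto
  then have X: "compact X" by (simp add: euclidean_product_topology)
  have cg: "continuous_on S g" for S
    unfolding g_def
    by (intro continuous_intros continuous_on_subset[OF continuous_on_product_coordinates]) auto
  have "\<exists>m>0. \<forall>c\<in>X. \<bar>c e\<bar> = 1 \<longrightarrow> m \<le> g c" if e: "e \<in> b" for e
  proof (cases "X \<inter> {c. \<bar>c e\<bar> = 1} = {}")
    case True
    then show ?thesis by (intro exI[of _ 1]) auto
  next
    case False
    have "closed {c :: 'v \<Rightarrow> real. \<bar>c e\<bar> = 1}"
      by (intro closed_Collect_eq continuous_intros) auto
    then have "compact (X \<inter> {c. \<bar>c e\<bar> = 1})" using X by blast
    from continuous_attains_inf[OF this False cg] obtain c where
      c: "c \<in> X" "\<bar>c e\<bar> = 1" and min: "\<And>d. d \<in> X \<Longrightarrow> \<bar>d e\<bar> = 1 \<Longrightarrow> g c \<le> g d"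
      by auto
    have "rep (\<Sum>e\<in>b. c e *\<^sub>R e) = c"
      by (rule rep_unique) (use c(1) in \<open>auto simp: X_def PiE_def Pi_def split: if_splits\<close>)
    then have "(\<Sum>e\<in>b. c e *\<^sub>R e) \<noteq> 0" using c(2) by force
    then have "g c > 0" by (simp add: g_def)
    then show ?thesis using min by blast
  qed
  then obtain m where m: "\<And>e. e \<in> b \<Longrightarrow> m e > 0"
      "\<And>e c. \<lbrakk>e \<in> b; c \<in> X; \<bar>c e\<bar> = 1\<rbrakk> \<Longrightarrow> m e \<le> g c"
    by metis
  \<comment> \<open>The summand 1 keeps \<open>K\<close> positive when the basis is empty.\<close>
  define K where "K = 1 + (\<Sum>e\<in>b. 1 / m e)"
  have sum_nonneg: "(\<Sum>e\<in>b. 1 / m e) \<ge> 0" using m(1) by (intro sum_nonneg) (auto simp: less_imp_le)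
  have "\<bar>rep v e\<bar> \<le> K * norm v" for v e
  proof (cases "rep v e = 0")
    case True
    then show ?thesis using sum_nonneg by (simp add: K_def)
  next
    case False
    have e: "e \<in> b" using False real_vector.representation_ne_zero by blast
    \<comment> \<open>Dividing by the coordinate of largest modulus moves the vector onto a face of
      the cube.\<close>
    have "Max ((\<lambda>e. \<bar>rep v e\<bar>) ` b) \<in> (\<lambda>e. \<bar>rep v e\<bar>) ` b"
      using e finite_b by (intro Max_in) auto
    then obtain a where a: "a \<in> b" "\<bar>rep v a\<bar> = Max ((\<lambda>e. \<bar>rep v e\<bar>) ` b)" by auto
    have le: "\<bar>rep v e'\<bar> \<le> \<bar>rep v a\<bar>" if "e' \<in> b" for e'
      unfolding a(2) using that finite_b by (intro Max_ge) auto
    define M where "M = \<bar>rep v a\<bar>"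
    have M: "M > 0" using le[OF e] False by (simp add: M_def)
    have "rep v e' = 0" if "e' \<notin> b" for e' using that real_vector.representation_ne_zero by blast
    then have "(\<lambda>e'. rep v e' / M) \<in> X"
      using M le by (auto simp: X_def M_def field_simps abs_le_iff minus_le_iff)
    then have "m a \<le> g (\<lambda>e'. rep v e' / M)"
      using a(1) M by (intro m) (auto simp: M_def)
    also have "g (\<lambda>e'. rep v e' / M) = norm ((1 / M) *\<^sub>R (\<Sum>e\<in>b. rep v e *\<^sub>R e))"
      by (simp add: g_def scaleR_sum_right)
    also have "\<dots> = norm v / M" using M by (simp add: rep_sum)
    finally have "M \<le> 1 / m a * norm v" using M m(1)[OF a(1)] by (simp add: field_simps)
    moreover have "1 / m a \<le> (\<Sum>e\<in>b. 1 / m e)"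
      using m(1) a(1) finite_b by (intro member_le_sum) (auto simp: less_imp_le)
    ultimately have "M \<le> K * norm v"
      by (smt (verit) K_def mult_right_mono norm_ge_zero)
    then show ?thesis using le[OF e] by (simp add: M_def)
  qed
  then show ?thesis using sum_nonneg by (intro exI[of _ K]) (auto simp: K_def)
qed

lemma bounded_linear_linear:
  fixes F :: "'v \<Rightarrow> 'w::real_normed_vector"
  assumes F: "linear F"
  shows "bounded_linear F"
proof -
  obtain K where K: "K > 0" "\<And>v e. \<bar>rep v e\<bar> \<le> K * norm v" using rep_bounded by auto
  have "norm (F v) \<le> norm v * (K * (\<Sum>e\<in>b. norm (F e)))" for v
  proof -
    have "F v = (\<Sum>e\<in>b. rep v e *\<^sub>R F e)"
      using arg_cong[OF rep_sum, of F v] by (simp add: linear_sum[OF F] linear_scale[OF F])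
    also have "norm \<dots> \<le> (\<Sum>e\<in>b. K * norm v * norm (F e))"
      by (rule sum_norm_le) (use K in \<open>auto intro: mult_right_mono\<close>)
    finally show ?thesis by (simp add: sum_distrib_left mult_ac)
  qed
  then show ?thesis using F by (intro bounded_linear.intro bounded_linear_axioms.intro) blast+
qed

lemma bounded_bilinear_bilinear:
  fixes B :: "'v \<Rightarrow> 'v \<Rightarrow> 'w::real_normed_vector"
  assumes B: "bilinear B"
  shows "bounded_bilinear B"
proof -
  obtain K where K: "K > 0" "\<And>v e. \<bar>rep v e\<bar> \<le> K * norm v" using rep_bounded by auto
  have l: "linear (B v)" "linear (\<lambda>v. B v w)" for v w using B by (auto simp: bilinear_def)
  have bl: "bounded_linear (B e)" for e by (rule bounded_linear_linear) (rule l)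
  have "norm (B v w) \<le> norm v * norm w * (K * (\<Sum>e\<in>b. onorm (B e)))" for v w
  proof -
    have "B v w = (\<Sum>e\<in>b. rep v e *\<^sub>R B e w)"
      using arg_cong[OF rep_sum, of "\<lambda>v. B v w" v] by (simp add: linear_sum[OF l(2)] linear_scale[OF l(2)])
    also have "norm \<dots> \<le> (\<Sum>e\<in>b. (K * norm v) * (onorm (B e) * norm w))"
      by (rule sum_norm_le) (use K onorm[OF bl] in \<open>auto intro!: mult_mono\<close>)
    finally show ?thesis by (simp add: sum_distrib_left mult_ac)
  qed
  then show ?thesis
    using linear_add[OF l(1)] linear_add[OF l(2)] linear_scale[OF l(1)] linear_scale[OF l(2)]
    by (intro bounded_bilinear.intro) auto
qed

end

text \<open>Additivity yields homogeneity over the rationals, and the set of scalars for which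
  homogeneity holds is closed.\<close>

lemma linear_of_additive_continuous:
  fixes f :: "'v::real_normed_vector \<Rightarrow> 'w::real_normed_vector"
  assumes add: "\<And>x y. f (x + y) = f x + f y" and cont: "continuous_on UNIV f"
  shows "linear f"
proof
  fix x y show "f (x + y) = f x + f y" by (rule add)
next
  fix t :: real and x
  interpret additive f by unfold_locales (rule add)
  have nat: "f (of_nat n *\<^sub>R y) = of_nat n *\<^sub>R f y" for n y
    by (induction n) (simp_all add: zero add scaleR_add_left)
  have int: "f (of_int i *\<^sub>R y) = of_int i *\<^sub>R f y" for i y
    by (cases i rule: int_cases2) (simp_all add: nat minus)
  have rat: "f (s *\<^sub>R x) = s *\<^sub>R f x" if s_rat: "s \<in> \<rat>" for s
  proof -
    obtain p q :: int where s: "s = of_int p / of_int q" "q > 0"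
      using Rats_cases'[OF s_rat] by metis
    have "of_int q *\<^sub>R f (s *\<^sub>R x) = f ((of_int q * s) *\<^sub>R x)"
      by (simp flip: int)
    also have "\<dots> = of_int p *\<^sub>R f x" using s by (simp add: int)
    finally have "of_int q *\<^sub>R f (s *\<^sub>R x) = of_int p *\<^sub>R f x" .
    then have "(1 / of_int q) *\<^sub>R of_int q *\<^sub>R f (s *\<^sub>R x) = (1 / of_int q) *\<^sub>R of_int p *\<^sub>R f x"
      by simp
    then show ?thesis using s by simp
  qed
  have "closed {t. f (t *\<^sub>R x) = t *\<^sub>R f x}"
    by (intro closed_Collect_eq continuous_intros continuous_on_compose2[OF cont]) auto
  moreover have "\<rat> \<subseteq> {t. f (t *\<^sub>R x) = t *\<^sub>R f x}" using rat by auto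
  ultimately have "closure \<rat> \<subseteq> {t. f (t *\<^sub>R x) = t *\<^sub>R f x}" by (rule closure_minimal[rotated])
  then show "f (t *\<^sub>R x) = t *\<^sub>R f x" using Rats_closure_real by auto
qed

section \<open>Real analytic maps\<close>

text \<open>The prefix \<open>us\<close> is the generalisation that the induction needs: it absorbs
  entries whose scalar has already been pulled out.\<close>

lemma replicate_scaleR:
  fixes c :: "'v::real_vector list \<Rightarrow> 'w::real_vector"
  assumes "\<And>us vs. linear (\<lambda>h. c (us @ h # vs))"
  shows "c (us @ replicate k (t *\<^sub>R h)) = t ^ k *\<^sub>R c (us @ replicate k h)"
proof (induction k arbitrary: us)
  case (Suc k)
  have "c (us @ replicate (Suc k) (t *\<^sub>R h)) = t *\<^sub>R c ((us @ [h]) @ replicate k (t *\<^sub>R h))"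
    using linear_scale[OF assms[of us "replicate k (t *\<^sub>R h)"]] by simp
  also have "\<dots> = t *\<^sub>R t ^ k *\<^sub>R c ((us @ [h]) @ replicate k h)" by (simp only: Suc.IH)
  finally show ?case by simp
qed simp

lemma prod_list_mono:
  fixes g g' :: "'a \<Rightarrow> real"
  shows "(\<And>v. 0 \<le> g v) \<Longrightarrow> (\<And>v. g v \<le> g' v) \<Longrightarrow> (\<Prod>v\<leftarrow>vs. g v) \<le> (\<Prod>v\<leftarrow>vs. g' v)"
proof (induction vs)
  case (Cons v vs)
  have "0 \<le> g' v" using Cons.prems order_trans by blast
  then show ?case using Cons by (auto intro!: mult_mono prod_list_nonneg)
qed simp

text \<open>Names the witnesses of \<open>real_analytic_at\<close>, so that radii can be shrunk and
  coefficients compared.\<close>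

definition power_series_at ::
    "('v::real_normed_vector list \<Rightarrow> 'w::real_normed_vector) \<Rightarrow> real \<Rightarrow> real \<Rightarrow> ('v \<Rightarrow> 'w) \<Rightarrow> 'v \<Rightarrow> bool" where
  "power_series_at c r C f a \<longleftrightarrow> r > 0 \<and>
    (\<forall>us vs. linear (\<lambda>h. c (us @ h # vs))) \<and>
    (\<forall>vs. norm (c vs) \<le> C * (\<Prod>v\<leftarrow>vs. norm v / r)) \<and>
    (\<forall>h. norm h < r \<longrightarrow> (\<lambda>k. c (replicate k h)) sums f (a + h))"

lemma real_analytic_at_iff: "real_analytic_at f a \<longleftrightarrow> (\<exists>c r C. power_series_at c r C f a)"
  unfolding real_analytic_at_def power_series_at_def ..

lemma power_series_atD:
  assumes "power_series_at c r C f a"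
  shows "r > 0" "\<And>us vs. linear (\<lambda>h. c (us @ h # vs))"
    "\<And>vs. norm (c vs) \<le> C * (\<Prod>v\<leftarrow>vs. norm v / r)"
    "\<And>h. norm h < r \<Longrightarrow> (\<lambda>k. c (replicate k h)) sums f (a + h)"
    "C \<ge> 0" "c [] = f a"
    "\<And>t k h. c (replicate k (t *\<^sub>R h)) = t ^ k *\<^sub>R c (replicate k h)"
    "\<And>k h. norm (c (replicate k h)) \<le> C * (norm h / r) ^ k"
proof -
  note p = assms[unfolded power_series_at_def]
  show "r > 0" and lin: "\<And>us vs. linear (\<lambda>h. c (us @ h # vs))"
    and bd: "\<And>vs. norm (c vs) \<le> C * (\<Prod>v\<leftarrow>vs. norm v / r)"
    and s: "\<And>h. norm h < r \<Longrightarrow> (\<lambda>k. c (replicate k h)) sums f (a + h)" using p by blast+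
  show "C \<ge> 0" using order_trans[OF norm_ge_zero bd[of "[]"]] by simp
  show sc: "c (replicate k (t *\<^sub>R h)) = t ^ k *\<^sub>R c (replicate k h)" for t k h
    using replicate_scaleR[OF lin, where us = "[]"] by simp
  show "norm (c (replicate k h)) \<le> C * (norm h / r) ^ k" for k h
    using bd[of "replicate k h"] by (simp add: prod_list_replicate)
  \<comment> \<open>At h = 0 only the degree-0 term survives, which identifies it with the value of
    \<open>f\<close>.\<close>
  have "c (replicate k 0) = (if k = 0 then c [] else 0)" for k
    using sc[of k 0 0] by (cases k) auto
  then have "(\<lambda>k. if k = 0 then c [] else 0) sums f a" using s[of 0] \<open>r > 0\<close> by simp
  moreover have "(\<lambda>k. if k = 0 then c [] else 0) sums c []"
    using sums_If_finite_set[of "{0::nat}" "\<lambda>_. c []"] by simp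
  ultimately show "c [] = f a" using sums_unique2 by blast
qed

text \<open>Within half the radius the tail is dominated by a geometric series of ratio 1/2, whence
  the factor 2. The case n = 1 gives continuity; n = 2 gives the quadratic estimates near the
  origin.\<close>

lemma power_series_at_remainder:
  assumes ps: "power_series_at c r C f a" and h: "norm h \<le> r / 2"
  shows "norm (f (a + h) - (\<Sum>k<n. c (replicate k h))) \<le> 2 * C * (norm h / r) ^ n"
proof -
  note p = power_series_atD[OF ps]
  have q: "0 \<le> norm h / r" "norm h / r \<le> 1 / 2" using h p(1) by (auto simp: field_simps)
  have s: "(\<lambda>k. c (replicate k h)) sums f (a + h)" using p(4) h p(1) by auto
  have "(\<lambda>k. c (replicate (k + n) h)) sums (f (a + h) - (\<Sum>k<n. c (replicate k h)))"
    using s by (subst sums_iff_shift) simp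
  then have lim: "(\<lambda>N. \<Sum>k<N. c (replicate (k + n) h)) \<longlonglongrightarrow> f (a + h) - (\<Sum>k<n. c (replicate k h))"
    by (simp add: sums_def)
  have sm: "summable (\<lambda>k. C * (norm h / r) ^ n * (1 / 2) ^ k)"
    by (intro summable_mult summable_geometric) simp
  have bd: "norm (c (replicate (k + n) h)) \<le> C * (norm h / r) ^ n * (1 / 2) ^ k" for k
  proof -
    have "norm (c (replicate (k + n) h)) \<le> C * (norm h / r) ^ n * (norm h / r) ^ k"
      using p(8)[of "k + n" h] by (simp only: power_add mult_ac)
    also have "\<dots> \<le> C * (norm h / r) ^ n * (1 / 2) ^ k"
      using q p(5) by (intro mult_left_mono power_mono mult_nonneg_nonneg zero_le_power)
    finally show ?thesis .
  qed
  have "norm (\<Sum>k<N. c (replicate (k + n) h)) \<le> (\<Sum>k. C * (norm h / r) ^ n * (1 / 2) ^ k)" for N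
  proof -
    have "norm (\<Sum>k<N. c (replicate (k + n) h)) \<le> (\<Sum>k<N. C * (norm h / r) ^ n * (1 / 2) ^ k)"
      by (intro sum_norm_le bd)
    also have "\<dots> \<le> (\<Sum>k. C * (norm h / r) ^ n * (1 / 2) ^ k)"
      using sm q p(5) by (intro sum_le_suminf) auto
    finally show ?thesis .
  qed
  then have "norm (f (a + h) - (\<Sum>k<n. c (replicate k h))) \<le> (\<Sum>k. C * (norm h / r) ^ n * (1 / 2) ^ k)"
    by (intro LIMSEQ_le_const2[OF tendsto_norm[OF lim]]) auto
  also have "\<dots> = 2 * C * (norm h / r) ^ n"
    by (subst suminf_mult) (auto simp: suminf_geometric summable_geometric)
  finally show ?thesis .
qed

lemma real_analytic_at_isCont:
  assumes "real_analytic_at f a"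
  shows "isCont f a"
proof -
  obtain c r C where ps: "power_series_at c r C f a" using assms real_analytic_at_iff by blast
  note p = power_series_atD[OF ps]
  have ev: "\<forall>\<^sub>F h in at 0. norm (f (a + h) - f a) \<le> 2 * C * (norm h / r)"
  proof -
    have "\<forall>\<^sub>F h::'a in at 0. norm h < r / 2"
      using p(1) by (auto simp: eventually_at intro!: exI[of _ "r / 2"])
    then show ?thesis
      by eventually_elim (use power_series_at_remainder[OF ps, of _ 1] p(6) in auto)
  qed
  have "((\<lambda>h. 2 * C * (norm h / r)) \<longlongrightarrow> 2 * C * (norm (0::'a) / r)) (at 0)"
    using p(1) by (intro tendsto_intros) (auto intro!: tendsto_norm_zero)
  then have "((\<lambda>h::'a. 2 * C * (norm h / r)) \<longlongrightarrow> 0) (at 0)" by simp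
  from Lim_null_comparison[OF ev this] have "((\<lambda>h. f (a + h) - f a) \<longlongrightarrow> 0) (at 0)" .
  then show ?thesis
    by (simp add: isCont_iff LIM_zero_iff)
qed

lemma power_series_at_shrink:
  assumes ps: "power_series_at c r C f a" and r': "0 < r'" "r' \<le> r"
  shows "power_series_at c r' C f a"
proof -
  note p = power_series_atD[OF ps]
  have "norm (c vs) \<le> C * (\<Prod>v\<leftarrow>vs. norm v / r')" for vs
  proof -
    have "(\<Prod>v\<leftarrow>vs. norm v / r) \<le> (\<Prod>v\<leftarrow>vs. norm v / r')"
      using p(1) r' by (intro prod_list_mono) (auto intro: divide_left_mono)
    then show ?thesis using p(3)[of vs] p(5) by (meson mult_left_mono order_trans)
  qed
  then show ?thesis using p r' unfolding power_series_at_def by auto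
qed

lemma real_analytic_at_cong:
  assumes "real_analytic_at f a" "eventually (\<lambda>x. f x = g x) (nhds a)"
  shows "real_analytic_at g a"
proof -
  obtain c r C where ps: "power_series_at c r C f a" using assms real_analytic_at_iff by blast
  obtain d where d: "d > 0" "\<And>x. dist x a < d \<Longrightarrow> f x = g x"
    using assms(2) unfolding eventually_nhds_metric by auto
  have "power_series_at c (min r d) C f a"
    using power_series_atD(1)[OF ps] d(1) by (intro power_series_at_shrink[OF ps]) auto
  then have "power_series_at c (min r d) C g a"
    using d(2) unfolding power_series_at_def by (auto simp: dist_norm)
  then show ?thesis using real_analytic_at_iff by blast
qed

lemma real_analytic_at_translate:
  "real_analytic_at (\<lambda>x. f (p + x)) a \<longleftrightarrow> real_analytic_at f (p + a)"
  by (simp add: real_analytic_at_def add.assoc)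

lemma real_analytic_at_add:
  assumes "real_analytic_at f a" "real_analytic_at g a"
  shows "real_analytic_at (\<lambda>x. f x + g x) a"
proof -
  obtain c r C where c: "power_series_at c r C f a" using assms real_analytic_at_iff by blast
  obtain d s D where d: "power_series_at d s D g a" using assms real_analytic_at_iff by blast
  define t where "t = min r s"
  have t: "0 < t" using power_series_atD(1)[OF c] power_series_atD(1)[OF d] by (simp add: t_def)
  have "t \<le> r" "t \<le> s" by (simp_all add: t_def)
  note p = power_series_atD[OF power_series_at_shrink[OF c t \<open>t \<le> r\<close>]]
    and q = power_series_atD[OF power_series_at_shrink[OF d t \<open>t \<le> s\<close>]]
  have "power_series_at (\<lambda>us. c us + d us) t (C + D) (\<lambda>x. f x + g x) a"
    unfolding power_series_at_def
    using p(1-4) q(2-4) by (auto intro!: linear_compose_add sums_add norm_triangle_le add_mono simp: distrib_right)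
  then show ?thesis using real_analytic_at_iff by blast
qed

lemma real_analytic_at_linear_left:
  assumes "real_analytic_at f a" and L: "bounded_linear L"
  shows "real_analytic_at (\<lambda>x. L (f x)) a"
proof -
  obtain c r C where c: "power_series_at c r C f a" using assms real_analytic_at_iff by blast
  note p = power_series_atD[OF c]
  obtain K where K: "K \<ge> 0" "\<And>x. norm (L x) \<le> norm x * K"
    using bounded_linear.nonneg_bounded[OF L] by blast
  have "norm (L (c vs)) \<le> (C * K) * (\<Prod>v\<leftarrow>vs. norm v / r)" for vs
  proof -
    have "norm (L (c vs)) \<le> norm (c vs) * K" by (rule K)
    also have "\<dots> \<le> (C * (\<Prod>v\<leftarrow>vs. norm v / r)) * K" by (intro mult_right_mono p K)
    finally show ?thesis by (simp add: mult_ac)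
  qed
  moreover have "linear (\<lambda>h. L (c (us @ h # vs)))" for us vs
    using linear_compose[OF p(2)[of us vs] bounded_linear.linear[OF L]] by (simp add: o_def)
  ultimately have "power_series_at (\<lambda>us. L (c us)) r (C * K) (\<lambda>x. L (f x)) a"
    unfolding power_series_at_def using p(1) p(4) bounded_linear.sums[OF L] by blast
  then show ?thesis using real_analytic_at_iff by blast
qed

lemma real_analytic_at_minus:
  "real_analytic_at f a \<Longrightarrow> real_analytic_at (\<lambda>x. - f x) a"
  by (rule real_analytic_at_linear_left[OF _ bounded_linear_minus[OF bounded_linear_ident]])

lemma real_analytic_at_diff:
  assumes "real_analytic_at f a" "real_analytic_at g a"
  shows "real_analytic_at (\<lambda>x. f x - g x) a"
  using real_analytic_at_add[OF assms(1) real_analytic_at_minus[OF assms(2)]] by simp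

text \<open>Substituting \<open>L\<close> costs a factor \<open>K\<close> in each entry, so the
  radius shrinks to \<open>r / K\<close>.\<close>

lemma real_analytic_at_linear_right:
  assumes f: "real_analytic_at f (L a)" and L: "bounded_linear L"
  shows "real_analytic_at (\<lambda>x. f (L x)) a"
proof -
  obtain c r C where c: "power_series_at c r C f (L a)" using f real_analytic_at_iff by blast
  note p = power_series_atD[OF c]
  obtain K where K: "K > 0" "\<And>x. norm (L x) \<le> norm x * K"
    using bounded_linear.pos_bounded[OF L] by blast
  have "norm (c (map L vs)) \<le> C * (\<Prod>v\<leftarrow>vs. norm v / (r / K))" for vs
  proof -
    have "(\<Prod>v\<leftarrow>map L vs. norm v / r) \<le> (\<Prod>v\<leftarrow>vs. norm v / (r / K))"
      unfolding map_map o_def using p(1) K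
      by (intro prod_list_mono) (auto simp: divide_simps)
    then show ?thesis using p(3)[of "map L vs"] p(5) by (meson mult_left_mono order_trans)
  qed
  moreover have "linear (\<lambda>h. c (map L (us @ h # vs)))" for us vs
    using linear_compose[OF bounded_linear.linear[OF L] p(2)[of "map L us" "map L vs"]] by (simp add: o_def)
  moreover have "(\<lambda>k. c (map L (replicate k h))) sums f (L (a + h))" if "norm h < r / K" for h
  proof -
    have "norm (L h) < r" using K(2)[of h] that K(1) by (simp add: field_simps)
    then show ?thesis using p(4)[of "L h"] by (simp add: linear_add[OF bounded_linear.linear[OF L]])
  qed
  ultimately have "power_series_at (\<lambda>us. c (map L us)) (r / K) C (\<lambda>x. f (L x)) a"
    unfolding power_series_at_def using p(1) K(1) by simp
  then show ?thesis using real_analytic_at_iff by blast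
qed

text \<open>Covers all polynomial maps that occur: constants, linear maps, bilinear forms seen as
  quadratic maps on a product, and the functions (B(x, x) + \<lambda>(x)) / 2.\<close>

lemma real_analytic_at_quadratic:
  assumes L: "bounded_linear L" and B: "bounded_bilinear B"
  shows "real_analytic_at (\<lambda>x. p + L x + B x x) a"
proof -
  interpret L: bounded_linear L by (rule L)
  interpret B: bounded_bilinear B by (rule B)
  obtain K where K: "K \<ge> 0" "\<And>x. norm (L x) \<le> norm x * K" using L.nonneg_bounded by blast
  obtain M where M: "M \<ge> 0" "\<And>x y. norm (B x y) \<le> norm x * norm y * M" using B.nonneg_bounded by blast
  \<comment> \<open>The Taylor coefficients at \<open>a\<close>. \<open>B\<close> need not be
    symmetric, so the linear term contains both mixed values, and the degree-2 coefficient is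
    \<open>B\<close> itself.\<close>
  define c where "c us = (case us of [] \<Rightarrow> p + L a + B a a | [h] \<Rightarrow> L h + (B a h + B h a)
      | [h, h'] \<Rightarrow> B h h' | _ \<Rightarrow> 0)" for us
  define C where "C = norm (c []) + (K + 2 * norm a * M) + M"
  have C: "norm (c []) \<le> C" "K + 2 * norm a * M \<le> C" "M \<le> C"
    using K(1) M(1) by (auto simp: C_def)
  have "norm (c vs) \<le> C * (\<Prod>v\<leftarrow>vs. norm v / 1)" for vs
  proof (cases "\<exists>h. vs = [h]")
    case True
    then obtain h where h: "vs = [h]" by blast
    have "norm (c vs) \<le> norm (L h) + (norm (B a h) + norm (B h a))"
      unfolding h c_def by (simp, intro norm_triangle_le add_mono order_refl norm_triangle_ineq)
    also have "\<dots> \<le> norm h * K + (norm a * norm h * M + norm h * norm a * M)"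
      by (intro add_mono K M)
    also have "\<dots> = (K + 2 * norm a * M) * norm h" by (simp add: algebra_simps)
    also have "\<dots> \<le> C * norm h" by (intro mult_right_mono C) simp
    finally show ?thesis by (simp add: h)
  next
    case F: False
    show ?thesis
    proof (cases "\<exists>h h'. vs = [h, h']")
      case True
      then obtain h h' where h: "vs = [h, h']" by blast
      have "norm (B h h') \<le> M * (norm h * norm h')" using M(2)[of h h'] by (simp add: mult_ac)
      also have "\<dots> \<le> C * (norm h * norm h')" by (intro mult_right_mono C) simp
      finally show ?thesis by (simp add: h c_def)
    next
      case False
      show ?thesis
      proof (cases vs)
        case Nil
        then show ?thesis using C(1) by simp
      next
        case (Cons v ws)
        then have "c vs = 0" using F False by (auto simp: c_def split: list.split)
        moreover have "0 \<le> C" using C(1) norm_ge_zero order_trans by blast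
        ultimately show ?thesis by (auto intro!: mult_nonneg_nonneg prod_list_nonneg)
      qed
    qed
  qed
  moreover have c0: "c ws = 0" if "3 \<le> length ws" for ws
    using that by (auto simp: c_def split: list.split)
  moreover have "linear (\<lambda>h. c (us @ h # vs))" for us vs
  proof -
    have l: "linear L" "linear (B x)" "linear (\<lambda>y. B y x)" for x
      using L.linear_axioms B.bounded_linear_left B.bounded_linear_right bounded_linear.linear by blast+
    have l1: "linear (\<lambda>h. L h + (B a h + B h a))" by (intro linear_compose_add l)
    consider "us = []" "vs = []" | v where "us = []" "vs = [v]" | u where "us = [u]" "vs = []"
      | "2 \<le> length us + length vs"
      by (cases us rule: remdups_adj.cases; cases vs rule: remdups_adj.cases) auto
    then show ?thesis
    proof cases
      case 4
      then have "c (us @ h # vs) = 0" for h by (intro c0) simp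
      then show ?thesis by (simp add: linear_zero)
    qed (use l l1 in \<open>simp_all add: c_def\<close>)
  qed
  moreover have "(\<lambda>k. c (replicate k h)) sums (p + L (a + h) + B (a + h) (a + h))" for h
  proof -
    have z: "c (replicate k h) = 0" if "k \<notin> {..<3}" for k
      using that by (intro c0) auto
    have "(\<lambda>k. c (replicate k h)) sums (\<Sum>k<3. c (replicate k h))"
      by (rule sums_finite) (use z in auto)
    moreover have "(\<Sum>k<3. c (replicate k h)) = p + L (a + h) + B (a + h) (a + h)"
      by (simp add: eval_nat_numeral c_def L.add B.add_left B.add_right)
    ultimately show ?thesis by simp
  qed
  ultimately have "power_series_at c 1 C (\<lambda>x. p + L x + B x x) a"
    unfolding power_series_at_def by simp
  then show ?thesis using real_analytic_at_iff by blast
qed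

lemma bounded_bilinear_0: "bounded_bilinear (\<lambda>_ _. 0)"
  by (intro bounded_bilinear.intro exI[of _ 0]) auto

lemma real_analytic_at_bounded_linear:
  fixes L :: "'v::real_normed_vector \<Rightarrow> 'w::real_normed_vector"
  assumes "bounded_linear L"
  shows "real_analytic_at L a"
  using real_analytic_at_quadratic[OF assms, of "\<lambda>_ _. 0" 0] bounded_bilinear_0 by simp

lemma real_analytic_at_bounded_bilinear:
  fixes B :: "'v::real_normed_vector \<Rightarrow> 'v \<Rightarrow> 'w::real_normed_vector"
  assumes "bounded_bilinear B"
  shows "real_analytic_at (\<lambda>x. B x x) a"
  using real_analytic_at_quadratic[OF bounded_linear_zero assms, of 0] by simp

lemma real_analytic_at_const:
  "real_analytic_at (\<lambda>_ :: 'v::real_normed_vector. p :: 'w::real_normed_vector) a"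
  using real_analytic_at_quadratic[OF bounded_linear_zero, of "\<lambda>(_ :: 'v) _. 0 :: 'w" p] bounded_bilinear_0
  by simp

section \<open>The circle and liftings to it\<close>

lemma circle_class_def': "circle_class a = {n + a | n. n \<in> \<int>}"
  by (auto simp: circle_class_def additive_group_def r_coset_def)

lemma circle_class_eq_iff: "circle_class a = circle_class b \<longleftrightarrow> a - b \<in> \<int>"
proof
  assume "circle_class a = circle_class b"
  moreover have "a \<in> circle_class a" unfolding circle_class_def' by force
  ultimately have "a \<in> circle_class b" by simp
  then show "a - b \<in> \<int>" by (auto simp: circle_class_def')
next
  have *: "circle_class a \<subseteq> circle_class b" if "a - b \<in> \<int>" for a b
  proof
    fix x assume "x \<in> circle_class a"
    then obtain n where "n \<in> \<int>" "x = n + a" by (auto simp: circle_class_def')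
    then have "x = (n + (a - b)) + b" "n + (a - b) \<in> \<int>" using that by auto
    then show "x \<in> circle_class b" unfolding circle_class_def' by blast
  qed
  assume "a - b \<in> \<int>"
  moreover have "b - a \<in> \<int>" using Ints_minus[OF \<open>a - b \<in> \<int>\<close>] by simp
  ultimately show "circle_class a = circle_class b" using * by blast
qed

lemma comm_group_additive_group: "comm_group (additive_group :: 'a::ab_group_add monoid)"
proof (rule comm_groupI)
  show "\<exists>y\<in>carrier additive_group. y \<otimes>\<^bsub>additive_group\<^esub> x = \<one>\<^bsub>additive_group\<^esub>" for x :: 'a
    by (intro bexI[of _ "- x"]) (auto simp: additive_group_def)
qed (auto simp: additive_group_def add_ac)

lemma inv_additive_group [simp]: "inv\<^bsub>additive_group\<^esub> x = - (x :: 'a::ab_group_add)"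
proof -
  interpret comm_group "additive_group :: 'a monoid" by (rule comm_group_additive_group)
  show ?thesis by (rule inv_equality) (auto simp: additive_group_def)
qed

lemma normal_Ints: "normal \<int> (additive_group :: real monoid)"
proof -
  interpret A: comm_group "additive_group :: real monoid" by (rule comm_group_additive_group)
  have "subgroup \<int> (additive_group :: real monoid)"
    by (rule A.subgroupI) (simp_all, auto simp: additive_group_def)
  then show ?thesis using A.normal_iff_subgroup by blast
qed

lemma circle_group_carrier: "carrier circle_group = range circle_class"
  by (simp add: circle_group_def carrier_FactGroup circle_class_def additive_group_def)

lemma circle_group_mult [simp]:
  "circle_class a \<otimes>\<^bsub>circle_group\<^esub> circle_class b = circle_class (a + b)"
  using normal.rcos_sum[OF normal_Ints, of a b]
  by (simp add: circle_group_def circle_class_def) (simp add: additive_group_def)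

lemma circle_group_one: "\<one>\<^bsub>circle_group\<^esub> = circle_class 0"
  by (simp add: circle_group_def circle_class_def')

lemma comm_group_circle: "comm_group circle_group"
proof -
  interpret group circle_group
    unfolding circle_group_def by (rule normal.factorgroup_is_group[OF normal_Ints])
  show ?thesis by (rule group_comm_groupI) (auto simp: circle_group_carrier add_ac)
qed

lemma circle_group_inv [simp]: "inv\<^bsub>circle_group\<^esub> circle_class a = circle_class (- a)"
proof -
  interpret comm_group circle_group by (rule comm_group_circle)
  show ?thesis by (rule inv_equality) (auto simp: circle_group_carrier circle_group_one)
qed

lemma Ints_valued_constant:
  fixes f :: "'v::real_normed_vector \<Rightarrow> real"
  assumes "continuous_on UNIV f" "\<And>x. f x \<in> \<int>"
  shows "f x = f y"
proof -
  have "\<exists>e>0. \<forall>y. y \<in> UNIV \<and> f y \<noteq> f x \<longrightarrow> e \<le> norm (f y - f x)" for x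
    using Ints_nonzero_abs_ge1[of "f y - f x" for y] assms(2) by (intro exI[of _ 1]) auto
  then have "f constant_on UNIV"
    by (intro continuous_discrete_range_constant assms(1)) auto
  then show ?thesis by (metis UNIV_I constant_on_def)
qed

text \<open>The form in which connectedness is used throughout: applied to the difference of two
  continuous functions that agree modulo the integers and agree at 0.\<close>

lemma Ints_valued_eq_0:
  fixes f :: "'v::real_normed_vector \<Rightarrow> real"
  assumes "continuous_on UNIV f" "\<And>x. f x \<in> \<int>" "f 0 = 0"
  shows "f x = 0"
  using Ints_valued_constant[OF assms(1,2)] assms(3) by metis

lemma analytic_to_deg1I:
  "(\<And>a. real_analytic_at \<phi> a) \<Longrightarrow> analytic_to_deg1 (\<lambda>x. (m, circle_class (\<phi> x)))"
  unfolding analytic_to_deg1_def by (metis (mono_tags, lifting) always_eventually)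

text \<open>The lattice component is locally constant, and the circle component lifts through
  \<open>cis\<close> because a normed vector space is contractible.\<close>

lemma analytic_to_deg1_lift:
  fixes g :: "'v::real_normed_vector \<Rightarrow> 'l \<times> real set"
  assumes g: "analytic_to_deg1 g"
  obtains m \<Phi> where "\<And>a. real_analytic_at \<Phi> a" "g = (\<lambda>x. (m, circle_class (\<Phi> x)))"
proof -
  have "\<forall>a. \<exists>m \<phi>. real_analytic_at \<phi> a \<and> eventually (\<lambda>y. g y = (m, circle_class (\<phi> y))) (nhds a)"
    using g unfolding analytic_to_deg1_def .
  then obtain m \<phi> where \<phi>: "\<And>a. real_analytic_at (\<phi> a) a"
    and ev: "\<And>a. eventually (\<lambda>y. g y = (m a, circle_class (\<phi> a y))) (nhds a)" by metis
  have "(\<lambda>x. fst (g x)) constant_on UNIV"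
  proof (rule locally_constant_imp_constant)
    fix a :: 'v
    obtain T where T: "open T" "a \<in> T" "\<And>y. y \<in> T \<Longrightarrow> g y = (m a, circle_class (\<phi> a y))"
      using ev[of a] unfolding eventually_nhds by blast
    then show "\<exists>T. openin (top_of_set UNIV) T \<and> a \<in> T \<and> (\<forall>x\<in>T. fst (g x) = fst (g a))"
      by (intro exI[of _ T]) auto
  qed (intro convex_connected convex_UNIV)
  then obtain M where M: "\<And>x. fst (g x) = M" by (auto simp: constant_on_def)
  have sg: "snd (g a) = circle_class (\<phi> a a)" for a
    using eventually_nhds_x_imp_x[OF ev[of a]] by simp
  \<comment> \<open>Two representatives of a class differ by an integer, so any choice of one yields
    the embedding of the circle into the complex plane.\<close>
  define E where "E z = cis (2 * pi * (SOME t. z = circle_class t))" for z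
  have E: "E (circle_class t) = cis (2 * pi * t)" for t
  proof -
    define s where "s = (SOME s. circle_class t = circle_class s)"
    have "circle_class t = circle_class s" unfolding s_def by (rule someI[of _ t]) simp
    then obtain n where "t - s = of_int n" by (auto simp: circle_class_eq_iff elim: Ints_cases)
    then have "2 * pi * t = 2 * pi * s + 2 * pi * of_int n" by (simp add: algebra_simps)
    then have "cis (2 * pi * t) = cis (2 * pi * s) * cis (2 * pi * of_int n)" by (simp only: cis_mult)
    then show ?thesis by (simp add: E_def s_def cis_multiple_2pi)
  qed
  have "isCont (\<lambda>x. E (snd (g x))) a" for a
  proof -
    have "isCont (\<lambda>x. cis (2 * pi * \<phi> a x)) a"
      unfolding cis_conv_exp using real_analytic_at_isCont[OF \<phi>] by (intro continuous_intros)
    moreover have "eventually (\<lambda>x. cis (2 * pi * \<phi> a x) = E (snd (g x))) (nhds a)"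
      using ev[of a] by eventually_elim (simp add: E)
    ultimately show ?thesis using isCont_cong by fast
  qed
  then have "continuous_on UNIV (\<lambda>x. E (snd (g x)))" by (simp add: continuous_at_imp_continuous_on)
  moreover have "contractible (UNIV :: 'v set)" by (intro convex_imp_contractible convex_UNIV)
  moreover have "E (snd (g x)) \<noteq> 0" for x by (simp add: sg E)
  ultimately obtain l where l: "continuous_on UNIV l" "\<And>x. E (snd (g x)) = exp (l x)"
    using continuous_logarithm_on_contractible[of UNIV "\<lambda>x. E (snd (g x))"] by auto
  \<comment> \<open>The exponential of \<open>l x\<close> has modulus 1, so \<open>l x\<close> is
    purely imaginary, and its imaginary part over 2 pi lifts the circle component.\<close>
  define \<Phi> where "\<Phi> x = Im (l x) / (2 * pi)" for x
  have cont: "continuous_on UNIV \<Phi>" unfolding \<Phi>_def by (intro continuous_intros l) auto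
  have Phi: "\<Phi> x - t \<in> \<int>" if "snd (g x) = circle_class t" for x t
  proof -
    have e: "exp (l x) = cis (2 * pi * t)" using l(2)[of x] that E by simp
    then have "norm (exp (l x)) = 1" by simp
    then have "Re (l x) = 0" by simp
    then have "exp (l x) = cis (2 * pi * \<Phi> x)" by (simp add: exp_eq_polar \<Phi>_def)
    then have "cis (2 * pi * \<Phi> x - 2 * pi * t) = 1" using e by (simp flip: cis_divide)
    then have "cos (2 * pi * \<Phi> x - 2 * pi * t) = 1" by (simp add: complex_eq_iff)
    then obtain n :: int where "2 * pi * \<Phi> x - 2 * pi * t = of_int n * 2 * pi"
      unfolding cos_one_2pi_int by blast
    then have "2 * pi * (\<Phi> x - t) = 2 * pi * of_int n" by (simp add: algebra_simps)
    then have "\<Phi> x - t = of_int n" by simp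
    then show ?thesis by simp
  qed
  have "real_analytic_at \<Phi> a" for a
  proof (rule real_analytic_at_cong)
    define N where "N = \<Phi> a - \<phi> a a"
    show "real_analytic_at (\<lambda>x. \<phi> a x + N) a"
      by (intro real_analytic_at_add real_analytic_at_const \<phi>)
    \<comment> \<open>\<open>\<Phi>\<close> and the local analytic lift differ by integers. Where
      this continuous difference stays within distance 1 of its value at \<open>a\<close> it equals
      that value, so \<open>\<Phi>\<close> inherits analyticity.\<close>
    have "isCont (\<lambda>x. \<Phi> x - \<phi> a x) a"
      using cont real_analytic_at_isCont[OF \<phi>[of a]]
      by (intro continuous_intros) (auto simp: continuous_on_eq_continuous_at)
    then have "((\<lambda>x. \<Phi> x - \<phi> a x) \<longlongrightarrow> \<Phi> a - \<phi> a a) (nhds a)"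
      unfolding isCont_def using tendsto_at_iff_tendsto_nhds[of "\<lambda>x. \<Phi> x - \<phi> a x" a] by simp
    then have "eventually (\<lambda>x. dist (\<Phi> x - \<phi> a x) N < 1) (nhds a)"
      unfolding N_def by (rule tendstoD) simp
    then show "eventually (\<lambda>x. \<phi> a x + N = \<Phi> x) (nhds a)"
      using ev[of a]
    proof eventually_elim
      case (elim x)
      have "\<Phi> x - \<phi> a x \<in> \<int>" "N \<in> \<int>" 
        using Phi[of x "\<phi> a x"] Phi[OF sg] elim(2) by (simp_all add: N_def)
      then have "(\<Phi> x - \<phi> a x) - N \<in> \<int>" by simp
      then have "(\<Phi> x - \<phi> a x) - N = 0"
        using elim(1) by (intro Ints_nonzero_abs_less1) (simp_all add: dist_real_def)
      then show ?case by simp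
    qed
  qed
  moreover have "g x = (M, circle_class (\<Phi> x))" for x
    using M[of x] sg[of x] Phi[OF sg[of x]] by (simp add: prod_eq_iff flip: circle_class_eq_iff)
  ultimately show ?thesis using that by blast
qed

section \<open>Symmetric analytic cocycles are coboundaries\<close>

text \<open>A primitive must satisfy \<open>h (2 x) = 2 h x + s x x\<close>, which prescribes
  \<open>h x = (\<Sum>n. 2 ^ n * s (x / 2 ^ (n + 1)) (x / 2 ^ (n + 1)))\<close>. If \<open>c\<close> is the power
  series of \<open>s x x\<close> at the origin, that of \<open>h\<close> is \<open>c / (2 ^ k - 2)\<close> in degree \<open>k\<close>;
  analyticity elsewhere follows from \<open>h (a + x) = h a + h x + s a x\<close>.\<close>

locale symmetric_cocycle =
  fixes s :: "'v::real_normed_vector \<Rightarrow> 'v \<Rightarrow> real"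
  assumes cocycle: "s x y + s (x + y) z = s y z + s x (y + z)"
    and symmetric: "s x y = s y x"
    and zero: "s 0 0 = 0"
    and analytic: "real_analytic_at (\<lambda>(x, y). s x y) p"
begin

lemma right_zero [simp]: "s x 0 = 0" and left_zero [simp]: "s 0 x = 0"
  using cocycle[of x 0 0] zero symmetric[of 0 x] by simp_all

text \<open>The two groupings of x + x + y + y, as 2x + 2y and as (x + y) + (x + y), compared
  through the cocycle identity and symmetry.\<close>

lemma double: "s (2 *\<^sub>R x) (2 *\<^sub>R y) - 2 * s x y = s (x + y) (x + y) - s x x - s y y"
  using cocycle[of x x "y + y"] cocycle[of x y y] cocycle[of "x + y" x y] cocycle[of x "x + y" y]
    symmetric[of x "x + y"] by (simp add: scaleR_2 add_ac)

definition partial :: "nat \<Rightarrow> 'v \<Rightarrow> real" where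
  "partial N x = (\<Sum>n<N. 2 ^ n * s ((1 / 2 ^ (n + 1)) *\<^sub>R x) ((1 / 2 ^ (n + 1)) *\<^sub>R x))"

text \<open>Telescopes by \<open>double\<close>. The leftover term tends to 0 because
  \<open>s\<close> vanishes to second order at the origin.\<close>

lemma partial_coboundary:
  "partial N (x + y) - partial N x - partial N y =
     s x y - 2 ^ N * s ((1 / 2 ^ N) *\<^sub>R x) ((1 / 2 ^ N) *\<^sub>R y)"
proof (induction N)
  case (Suc N)
  have e: "(1 / 2 ^ N) *\<^sub>R z = 2 *\<^sub>R ((1 / 2 ^ (N + 1)) *\<^sub>R z)" for z :: 'v by simp
  have "s ((1 / 2 ^ N) *\<^sub>R x) ((1 / 2 ^ N) *\<^sub>R y) =
      2 * s ((1 / 2 ^ (N + 1)) *\<^sub>R x) ((1 / 2 ^ (N + 1)) *\<^sub>R y) +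
      (s ((1 / 2 ^ (N + 1)) *\<^sub>R (x + y)) ((1 / 2 ^ (N + 1)) *\<^sub>R (x + y)) -
       s ((1 / 2 ^ (N + 1)) *\<^sub>R x) ((1 / 2 ^ (N + 1)) *\<^sub>R x) -
       s ((1 / 2 ^ (N + 1)) *\<^sub>R y) ((1 / 2 ^ (N + 1)) *\<^sub>R y))"
    unfolding e[of x] e[of y] using double[of "(1 / 2 ^ (N + 1)) *\<^sub>R x" "(1 / 2 ^ (N + 1)) *\<^sub>R y"]
    by (simp only: scaleR_right_distrib)
  with Suc show ?case unfolding partial_def by (simp add: algebra_simps)
qed (simp add: partial_def)

text \<open>Relates the partial sums at x to those at the small vector x / 2^M, so convergence near
  the origin spreads everywhere.\<close>

lemma partial_add: "partial (M + N) x = partial M x + 2 ^ M * partial N ((1 / 2 ^ M) *\<^sub>R x)"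
proof (induction N)
  case (Suc N)
  have "2 ^ M * (2 ^ N * s ((1 / 2 ^ (N + 1)) *\<^sub>R (1 / 2 ^ M) *\<^sub>R x) ((1 / 2 ^ (N + 1)) *\<^sub>R (1 / 2 ^ M) *\<^sub>R x))
     = 2 ^ (M + N) * s ((1 / 2 ^ (M + N + 1)) *\<^sub>R x) ((1 / 2 ^ (M + N + 1)) *\<^sub>R x)"
    by (simp add: power_add mult_ac)
  with Suc show ?case unfolding partial_def by (simp add: distrib_left)
qed (simp add: partial_def)

text \<open>Quadratic decay contributes 4^-N against the factor 2^N, leaving 2^-N.\<close>

lemma scaled_tendsto_0:
  fixes f :: "'w::real_normed_vector \<Rightarrow> real"
  assumes d: "d > 0" and K: "\<And>x. norm x \<le> d \<Longrightarrow> \<bar>f x\<bar> \<le> K * (norm x)\<^sup>2"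
  shows "(\<lambda>N. 2 ^ N * f ((1 / 2 ^ N) *\<^sub>R x)) \<longlonglongrightarrow> 0"
proof (rule Lim_null_comparison)
  have "(\<lambda>N. norm x * (1 / 2) ^ N) \<longlonglongrightarrow> norm x * 0"
    by (intro tendsto_intros LIMSEQ_power_zero) simp
  then have "eventually (\<lambda>N. norm x * (1 / 2) ^ N < d) sequentially"
    using d by (intro order_tendstoD) auto
  then show "eventually (\<lambda>N. norm (2 ^ N * f ((1 / 2 ^ N) *\<^sub>R x)) \<le> K * (norm x)\<^sup>2 * (1 / 2) ^ N) sequentially"
  proof eventually_elim
    case (elim N)
    then have "\<bar>f ((1 / 2 ^ N) *\<^sub>R x)\<bar> \<le> K * (norm ((1 / 2 ^ N) *\<^sub>R x))\<^sup>2"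
      by (intro K) (simp add: field_simps)
    then have "2 ^ N * \<bar>f ((1 / 2 ^ N) *\<^sub>R x)\<bar> \<le> 2 ^ N * (K * (norm ((1 / 2 ^ N) *\<^sub>R x))\<^sup>2)"
      by simp
    also have "\<dots> = K * (norm x)\<^sup>2 * (1 / 2) ^ N"
      by (simp add: power2_eq_square power_one_over field_simps)
    finally show ?case by (simp add: abs_mult)
  qed
  show "(\<lambda>N. K * (norm x)\<^sup>2 * (1 / 2) ^ N) \<longlonglongrightarrow> 0"
    by (intro tendsto_mult_right_zero LIMSEQ_power_zero) simp
qed

theorem analytic_primitive:
  obtains h where "\<And>a. real_analytic_at h a" "h 0 = 0" "\<And>x y. s x y = h (x + y) - h x - h y"
proof -
  obtain c r C where ps: "power_series_at c r C (\<lambda>(x, y). s x y) (0, 0)"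
    using analytic real_analytic_at_iff by blast
  note p = power_series_atD[OF ps]
  have c0: "c [] = 0" using p(6) by (simp add: zero)
  \<comment> \<open>On a line where \<open>s\<close> vanishes the linear term is bounded by a
    multiple of t^2; dividing by t and letting t tend to 0 kills it.\<close>
  have vanish: "c [q] = 0" if q: "\<And>t. (\<lambda>(x, y). s x y) (t *\<^sub>R q) = 0" for q
  proof -
    define K where "K = 2 * C * (norm q / r)\<^sup>2"
    have "\<bar>c [q]\<bar> \<le> K * t" if t: "t > 0" "t * norm q \<le> r / 2" for t
    proof -
      have "(0, 0) + t *\<^sub>R q = t *\<^sub>R q" by (simp flip: zero_prod_def)
      moreover have "norm (t *\<^sub>R q) \<le> r / 2" using t by simp
      ultimately have "\<bar>(\<Sum>k<2. c (replicate k (t *\<^sub>R q)))\<bar> \<le> 2 * C * (norm (t *\<^sub>R q) / r) ^ 2"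
        using power_series_at_remainder[OF ps, of "t *\<^sub>R q" 2] q[of t] by simp
      then have "t * \<bar>c [q]\<bar> \<le> t * (K * t)"
        using p(7)[of 1 t q] t(1) c0
        by (simp add: eval_nat_numeral abs_mult K_def power_mult_distrib power_divide mult_ac)
      then show ?thesis using t(1) by simp
    qed
    note K = this
    have "((\<lambda>t. K * t) \<longlongrightarrow> K * 0) (at_right 0)" by (intro tendsto_intros)
    moreover have "eventually (\<lambda>t. \<bar>c [q]\<bar> \<le> K * t) (at_right 0)"
    proof -
      have "((\<lambda>t. t * norm q) \<longlongrightarrow> 0 * norm q) (at_right 0)" by (intro tendsto_intros)
      then have "eventually (\<lambda>t. t * norm q < r / 2) (at_right 0)"
        using p(1) by (intro order_tendstoD) auto
      then show ?thesis using eventually_at_right_less[of 0] by eventually_elim (use K in auto)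
    qed
    ultimately have "\<bar>c [q]\<bar> \<le> K * 0" by (intro tendsto_lowerbound) auto
    then show ?thesis by simp
  qed
  \<comment> \<open>The linear term splits along the two axes, and \<open>s\<close> vanishes on
    both.\<close>
  have c1: "c [(x, y)] = 0" for x y
  proof -
    have "c [(x, y)] = c [(x, 0)] + c [(0, y)]"
      using linear_add[OF p(2)[of "[]" "[]"], of "(x, 0)" "(0, y)"] by simp
    then show ?thesis using vanish[of "(x, 0)"] vanish[of "(0, y)"] by simp
  qed
  define K where "K = 2 * C / r\<^sup>2"
  have quad: "\<bar>s x y\<bar> \<le> K * (norm (x, y))\<^sup>2" if "norm (x, y) \<le> r / 2" for x y
  proof -
    have "c [(x, y)] = 0" by (rule c1)
    then have "\<bar>s x y\<bar> \<le> 2 * C * (norm (x, y) / r) ^ 2"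
      using power_series_at_remainder[OF ps, of "(x, y)" 2] that c0 by (simp add: eval_nat_numeral)
    then show ?thesis by (simp add: K_def power_divide)
  qed
  \<comment> \<open>In degree k the equation h(2 x) = 2 h(x) + s(x, x) reads 2^k e = 2 e + c. The
    divisor is unusable in degree 1, but \<open>c\<close> vanishes in degrees 0 and 1, and 0 is a
    consistent value there.\<close>
  define e where "e us = (if length us < 2 then 0 else c (map (\<lambda>u. (u, u)) us) / (2 ^ length us - 2))" for us
  define g where "g x = (\<Sum>k. e (replicate k x))" for x
  have diag: "bounded_linear (\<lambda>u::'v. (u, u))" by (intro bounded_linear_Pair bounded_linear_ident)
  have two: "(2::real) \<le> 2 ^ k - 2" if "\<not> k < 2" for k :: nat
    using power_increasing[of 2 k "2::real"] that by simp
  have e_le: "\<bar>e us\<bar> \<le> \<bar>c (map (\<lambda>u. (u, u)) us)\<bar>" for us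
  proof (cases "length us < 2")
    case False
    have "\<bar>c (map (\<lambda>u. (u, u)) us)\<bar> / (2 ^ length us - 2) \<le> \<bar>c (map (\<lambda>u. (u, u)) us)\<bar> / 1"
      using two[OF False] by (intro divide_left_mono) auto
    then show ?thesis using False two[OF False] by (simp add: e_def abs_divide)
  qed (simp add: e_def)
  \<comment> \<open>The diagonal at most doubles the norm, so the radius of the primitive's series
    is \<open>r / 2\<close>.\<close>
  have norm_diag: "norm (u, u) \<le> 2 * norm u" for u :: 'v using norm_Pair_le[of u u] by simp
  have e_bound: "\<bar>e us\<bar> \<le> C * (\<Prod>u\<leftarrow>us. norm u / (r / 2))" for us
  proof -
    have "(\<Prod>v\<leftarrow>map (\<lambda>u. (u, u)) us. norm v / r) \<le> (\<Prod>u\<leftarrow>us. norm u / (r / 2))"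
      unfolding map_map o_def using p(1) norm_diag
      by (intro prod_list_mono) (auto simp: divide_simps mult.commute)
    then have "C * (\<Prod>v\<leftarrow>map (\<lambda>u. (u, u)) us. norm v / r) \<le> C * (\<Prod>u\<leftarrow>us. norm u / (r / 2))"
      using p(5) by (intro mult_left_mono)
    then show ?thesis using e_le[of us] p(3)[of "map (\<lambda>u. (u, u)) us"] by simp
  qed
  have e_sums: "(\<lambda>k. e (replicate k x)) sums g x" if "norm x < r / 2" for x
  proof -
    have "summable (\<lambda>k. C * (norm x / (r / 2)) ^ k)"
      using that p(1) by (intro summable_mult summable_geometric) (simp add: field_simps)
    then have "summable (\<lambda>k. e (replicate k x))"
      by (rule summable_comparison_test') (use e_bound[of "replicate _ x"] in \<open>simp add: prod_list_replicate\<close>)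
    then show ?thesis by (simp add: g_def summable_sums)
  qed
  have e_lin: "linear (\<lambda>h. e (us @ h # vs))" for us vs
  proof (cases "length us + length vs < 1")
    case True
    then show ?thesis by (simp add: e_def linear_zero)
  next
    case False
    have "linear (\<lambda>h. c (map (\<lambda>u. (u, u)) us @ (h, h) # map (\<lambda>u. (u, u)) vs))"
      using linear_compose[OF bounded_linear.linear[OF diag] p(2)] by (simp add: o_def)
    then have "linear (\<lambda>h. (1 / (2 ^ (length us + Suc (length vs)) - 2)) *\<^sub>R
        c (map (\<lambda>u. (u, u)) us @ (h, h) # map (\<lambda>u. (u, u)) vs))"
      by (rule linear_compose_scale_right)
    moreover have "e (us @ h # vs) = (1 / (2 ^ (length us + Suc (length vs)) - 2)) *\<^sub>R
        c (map (\<lambda>u. (u, u)) us @ (h, h) # map (\<lambda>u. (u, u)) vs)" for h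
      using False by (simp add: e_def)
    ultimately show ?thesis by simp
  qed
  have g_ps: "power_series_at e (r / 2) C g 0"
    unfolding power_series_at_def using p(1) e_lin e_bound e_sums by simp
  have g_quad: "\<bar>g x\<bar> \<le> 2 * C * (2 / r)\<^sup>2 * (norm x)\<^sup>2" if "norm x \<le> r / 2 / 2" for x
    using power_series_at_remainder[OF g_ps that, of 2]
    by (simp add: e_def eval_nat_numeral mult_ac)
  have g_double: "g x = 2 * g ((1 / 2) *\<^sub>R x) + s ((1 / 2) *\<^sub>R x) ((1 / 2) *\<^sub>R x)" if x: "norm x < r / 2" for x
  proof -
    define y where "y = (1 / 2) *\<^sub>R x"
    have y: "norm y < r / 2" "norm (y, y) < r" using x norm_diag[of y] p(1) by (auto simp: y_def)
    have xy: "x = 2 *\<^sub>R y" by (simp add: y_def)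
    have "(\<lambda>k. 2 * e (replicate k y) + c (replicate k (y, y))) sums (2 * g y + s y y)"
      using p(4)[OF y(2)] by (intro sums_add sums_mult e_sums y) simp
    moreover have "2 * e (replicate k y) + c (replicate k (y, y)) = e (replicate k x)" for k
    proof -
      have ex: "e (replicate k x) = 2 ^ k * e (replicate k y)"
        using power_series_atD(7)[OF g_ps] by (simp add: xy)
      show ?thesis
      proof (cases "k < 2")
        case True
        then have "k = 0 \<or> k = 1" by auto
        then show ?thesis using c0 c1 by (auto simp: e_def)
      next
        case False
        then show ?thesis using two[OF False] unfolding ex by (simp add: e_def map_replicate field_simps)
      qed
    qed
    ultimately have "(\<lambda>k. e (replicate k x)) sums (2 * g y + s y y)" by simp
    then show ?thesis using e_sums[OF x] sums_unique2 unfolding y_def by blast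
  qed
  \<comment> \<open>\<open>g_double\<close> iterated N times; the remainder vanishes in the limit
    since \<open>g\<close> starts in degree 2.\<close>
  have partial_g: "g x = partial N x + 2 ^ N * g ((1 / 2 ^ N) *\<^sub>R x)" if x: "norm x < r / 2" for x N
  proof (induction N)
    case (Suc N)
    have "norm ((1 / 2 ^ N) *\<^sub>R x) \<le> norm x" 
      using divide_left_mono[of 1 "2 ^ N" "norm x"] by simp
    then have "norm ((1 / 2 ^ N) *\<^sub>R x) < r / 2" using x by linarith
    from g_double[OF this] Suc show ?case by (simp add: partial_def algebra_simps)
  qed (simp add: partial_def)
  have lim_g: "(\<lambda>N. partial N x) \<longlonglongrightarrow> g x" if x: "norm x < r / 2" for x
  proof -
    have "(\<lambda>N. 2 ^ N * g ((1 / 2 ^ N) *\<^sub>R x)) \<longlonglongrightarrow> 0"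
      using p(1) g_quad by (intro scaled_tendsto_0[of "r / 2 / 2"]) auto
    then have "(\<lambda>N. g x - 2 ^ N * g ((1 / 2 ^ N) *\<^sub>R x)) \<longlonglongrightarrow> g x - 0" by (intro tendsto_intros)
    moreover have "g x - 2 ^ N * g ((1 / 2 ^ N) *\<^sub>R x) = partial N x" for N
      using partial_g[OF x, of N] by simp
    ultimately show ?thesis by simp
  qed
  \<comment> \<open>The limit exists at every vector, while the series \<open>g\<close> describes it
    only near the origin.\<close>
  define h where "h x = lim (\<lambda>N. partial N x)" for x
  have lim_h: "(\<lambda>N. partial N x) \<longlonglongrightarrow> h x" for x
  proof -
    have "(\<lambda>M. norm x * (1 / 2) ^ M) \<longlonglongrightarrow> norm x * 0"
      by (intro tendsto_intros LIMSEQ_power_zero) simp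
    then have "eventually (\<lambda>M. norm x * (1 / 2) ^ M < r / 2) sequentially"
      using p(1) by (intro order_tendstoD) auto
    then obtain M where "norm x * (1 / 2) ^ M < r / 2" by (auto simp: eventually_sequentially)
    then have "norm ((1 / 2 ^ M) *\<^sub>R x) < r / 2" by (simp add: power_one_over field_simps)
    from lim_g[OF this]
    have "(\<lambda>N. partial M x + 2 ^ M * partial N ((1 / 2 ^ M) *\<^sub>R x)) \<longlonglongrightarrow>
        partial M x + 2 ^ M * g ((1 / 2 ^ M) *\<^sub>R x)" by (intro tendsto_intros)
    then have "(\<lambda>N. partial (N + M) x) \<longlonglongrightarrow> partial M x + 2 ^ M * g ((1 / 2 ^ M) *\<^sub>R x)"
      by (simp only: partial_add[symmetric] add.commute[of _ M])
    then have "(\<lambda>N. partial N x) \<longlonglongrightarrow> partial M x + 2 ^ M * g ((1 / 2 ^ M) *\<^sub>R x)"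
      by (rule LIMSEQ_offset)
    then show ?thesis unfolding h_def by (simp add: limI)
  qed
  have h_cob: "s x y = h (x + y) - h x - h y" for x y
  proof -
    have "(\<lambda>N. partial N (x + y) - partial N x - partial N y) \<longlonglongrightarrow> h (x + y) - h x - h y"
      by (intro tendsto_intros lim_h)
    moreover have "(\<lambda>N. s x y - 2 ^ N * (\<lambda>(x, y). s x y) ((1 / 2 ^ N) *\<^sub>R (x, y))) \<longlonglongrightarrow> s x y - 0"
      by (intro tendsto_diff tendsto_const scaled_tendsto_0[of "r / 2"]) (use p(1) quad in auto)
    ultimately show ?thesis
      by (simp add: partial_coboundary LIMSEQ_unique)
  qed
  have h_g: "h x = g x" if "norm x < r / 2" for x
    using lim_g[OF that] lim_h LIMSEQ_unique by blast
  have h0: "h 0 = 0" using h_cob[of 0 0] zero by simp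
  have "real_analytic_at g 0" using g_ps real_analytic_at_iff by blast
  moreover have "eventually (\<lambda>x. g x = h x) (nhds 0)"
    unfolding eventually_nhds_metric using p(1) h_g by (intro exI[of _ "r / 2"]) auto
  ultimately have h_0: "real_analytic_at h 0" by (rule real_analytic_at_cong)
  have "real_analytic_at h a" for a
  proof -
    have "real_analytic_at (\<lambda>q. (\<lambda>(x, y). s x y) ((a, 0) + q)) (0, 0)"
      unfolding real_analytic_at_translate by (rule analytic)
    from real_analytic_at_linear_right[where L = "Pair 0", OF this[unfolded zero_prod_def]]
    have "real_analytic_at (\<lambda>x. s a x) 0"
      by (simp add: bounded_linear_Pair bounded_linear_zero bounded_linear_ident)
    then have "real_analytic_at (\<lambda>x. h a + h x + s a x) 0"
      by (intro real_analytic_at_add real_analytic_at_const h_0)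
    then have "real_analytic_at (\<lambda>x. h (a + x)) 0" by (simp add: h_cob)
    then show ?thesis using real_analytic_at_translate[of h a 0] by simp
  qed
  then show ?thesis using that h0 h_cob by blast
qed

end

section \<open>Lattices\<close>

locale lattice_basis = finite_basis b
  for b :: "'v::real_normed_vector set" +
  fixes \<iota> :: "'l::ab_group_add \<Rightarrow> 'v"
  assumes additive_\<iota>: "Modules.additive \<iota>" and inj_\<iota>: "inj \<iota>"
    and range_\<iota>: "range \<iota> = {v. \<exists>c :: 'v \<Rightarrow> int. v = (\<Sum>e\<in>b. of_int (c e) *\<^sub>R e)}"
begin

lemma \<iota>_simps [simp]: "\<iota> (m + n) = \<iota> m + \<iota> n" "\<iota> 0 = 0" "\<iota> (- m) = - \<iota> m" "\<iota> (m - n) = \<iota> m - \<iota> n"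
  using additive.add[OF additive_\<iota>] additive.zero[OF additive_\<iota>] additive.minus[OF additive_\<iota>]
    additive.diff[OF additive_\<iota>] by auto

lemma \<iota>_eq_iff [simp]: "\<iota> m = \<iota> n \<longleftrightarrow> m = n"
  using inj_\<iota> by (simp add: inj_eq)

lemma \<iota>_eq_0_iff [simp]: "\<iota> m = 0 \<longleftrightarrow> m = 0"
  using \<iota>_eq_iff[of m 0] by (simp del: \<iota>_eq_iff)

definition gen :: "'v \<Rightarrow> 'l" where "gen = inv_into UNIV \<iota>"

lemma \<iota>_gen [simp]:
  assumes e: "e \<in> b"
  shows "\<iota> (gen e) = e"
proof -
  have "e = (\<Sum>e'\<in>b. of_int (if e' = e then 1 else 0) *\<^sub>R e')"
    using e finite_b by (simp add: if_distrib if_distribR sum.delta cong: if_cong)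
  then have "e \<in> range \<iota>" unfolding range_\<iota> by (intro CollectI exI)
  then show ?thesis unfolding gen_def by (rule f_inv_into_f)
qed

text \<open>Closure under differences already yields negatives, sums and integer multiples, so one
  closure step suffices besides the generators.\<close>

lemma lattice_induct [case_names zero gen diff]:
  assumes "P 0" and gen: "\<And>e. e \<in> b \<Longrightarrow> P (gen e)" and diff: "\<And>m n. P m \<Longrightarrow> P n \<Longrightarrow> P (m - n)"
  shows "P m"
proof -
  have minus: "P (- m)" if "P m" for m using diff[OF \<open>P 0\<close> that] by simp
  have add: "P (m + n)" if "P m" "P n" for m n using diff[OF that(1) minus[OF that(2)]] by simp
  have nat: "\<exists>n. \<iota> n = of_nat k *\<^sub>R e \<and> P n" if "e \<in> b" for e k
  proof (induction k)
    case 0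
    show ?case using \<open>P 0\<close> by (intro exI[of _ 0]) simp
  next
    case (Suc k)
    then obtain n where "\<iota> n = of_nat k *\<^sub>R e" "P n" by blast
    then show ?case using add[OF gen[OF that]] that
      by (intro exI[of _ "gen e + n"]) (simp add: algebra_simps)
  qed
  have int: "\<exists>n. \<iota> n = of_int i *\<^sub>R e \<and> P n" if e: "e \<in> b" for e i
  proof (cases i rule: int_cases2)
    case (nonneg k)
    then show ?thesis using nat[OF e, of k] by simp
  next
    case (nonpos k)
    obtain n where "\<iota> n = of_nat k *\<^sub>R e" "P n" using nat[OF e, of k] by blast
    then show ?thesis using nonpos minus by (intro exI[of _ "- n"]) simp
  qed
  obtain c :: "'v \<Rightarrow> int" where c: "\<iota> m = (\<Sum>e\<in>b. of_int (c e) *\<^sub>R e)"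
    using range_\<iota> by blast
  have "\<exists>n. \<iota> n = (\<Sum>e\<in>S. of_int (c e) *\<^sub>R e) \<and> P n" if "S \<subseteq> b" for S
    using finite_subset[OF that finite_b] that
  proof (induction S rule: finite_induct)
    case empty
    show ?case using \<open>P 0\<close> by (intro exI[of _ 0]) simp
  next
    case (insert e S)
    obtain n where n: "\<iota> n = (\<Sum>e\<in>S. of_int (c e) *\<^sub>R e)" "P n" using insert by auto
    obtain n' where n': "\<iota> n' = of_int (c e) *\<^sub>R e" "P n'" using int[of e "c e"] insert.prems by auto
    show ?case using n n' insert.hyps add by (intro exI[of _ "n' + n"]) simp
  qed
  from this[OF order_refl] c show ?thesis by (metis \<iota>_eq_iff)
qed

text \<open>Only the values at the generators enter, so the definition also makes sense for maps
  that are additive merely modulo the integers, as in \<open>lift_character\<close>.\<close>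

definition lin_ext :: "('l \<Rightarrow> 'w::real_vector) \<Rightarrow> 'v \<Rightarrow> 'w" where
  "lin_ext \<phi> v = (\<Sum>e\<in>b. rep v e *\<^sub>R \<phi> (gen e))"

lemma linear_lin_ext: "linear (lin_ext \<phi>)"
  by (intro linearI) (simp_all add: lin_ext_def rep_add rep_scale scaleR_add_left sum.distrib scaleR_sum_right)

lemma lin_ext_gen: "e \<in> b \<Longrightarrow> lin_ext \<phi> e = \<phi> (gen e)"
  using finite_b by (simp add: lin_ext_def rep_basis if_distrib if_distribR sum.delta cong: if_cong)

lemma lin_ext_\<iota> [simp]:
  assumes "Modules.additive \<phi>"
  shows "lin_ext \<phi> (\<iota> m) = \<phi> m"
proof (induction m rule: lattice_induct)
  case zero
  show ?case by (simp add: linear_0[OF linear_lin_ext] additive.zero[OF assms])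
next
  case (diff m n)
  then show ?case by (simp add: linear_diff[OF linear_lin_ext] additive.diff[OF assms])
qed (simp add: lin_ext_gen)

lemma linear_eq_on_lattice:
  fixes F G :: "'v \<Rightarrow> 'w::real_vector"
  assumes F: "linear F" and G: "linear G" and eq: "\<And>m. F (\<iota> m) = G (\<iota> m)"
  shows "F = G"
proof
  fix v
  have e: "F e = G e" if "e \<in> b" for e using eq[of "gen e"] that by simp
  have "F v = (\<Sum>e\<in>b. rep v e *\<^sub>R F e)"
    using arg_cong[OF rep_sum, of F v] by (simp add: linear_sum[OF F] linear_scale[OF F])
  also have "\<dots> = (\<Sum>e\<in>b. rep v e *\<^sub>R G e)" using e by simp
  also have "\<dots> = G v"
    using arg_cong[OF rep_sum, of G v] by (simp add: linear_sum[OF G] linear_scale[OF G])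
  finally show "F v = G v" .
qed

lemma bilinear_eq_on_lattice:
  fixes F G :: "'v \<Rightarrow> 'v \<Rightarrow> 'w::real_vector"
  assumes F: "bilinear F" and G: "bilinear G" and eq: "\<And>m n. F (\<iota> m) (\<iota> n) = G (\<iota> m) (\<iota> n)"
  shows "F = G"
proof (intro ext)
  fix x y
  have "F (\<iota> m) = G (\<iota> m)" for m
    by (rule linear_eq_on_lattice) (use F G eq in \<open>auto simp: bilinear_def\<close>)
  then have "(\<lambda>x. F x y) = (\<lambda>x. G x y)"
    by (intro linear_eq_on_lattice) (use F G in \<open>auto simp: bilinear_def\<close>)
  then show "F x y = G x y" by metis
qed

lemma integral_formsD:
  assumes "B \<in> integral_forms"
  shows "B (m + m') n = B m n + B m' n" "B m (n + n') = B m n + B m n'"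
    "B 0 n = 0" "B m 0 = 0" "B (- m) n = - B m n" "B m (- n) = - B m n"
    "Modules.additive (B m)" "Modules.additive (\<lambda>m. B m n)"
proof -
  show a: "Modules.additive (B m)" "Modules.additive (\<lambda>m. B m n)" for m n
    using assms by (auto simp: integral_forms_def)
  show "B (m + m') n = B m n + B m' n" "B 0 n = 0" "B (- m) n = - B m n"
    using additive.add[OF a(2)] additive.zero[OF a(2)] additive.minus[OF a(2)] by auto
  show "B m (n + n') = B m n + B m n'" "B m 0 = 0" "B m (- n) = - B m n"
    using additive.add[OF a(1)] additive.zero[OF a(1)] additive.minus[OF a(1)] by auto
qed

lemma additive_of_int: "Modules.additive f \<Longrightarrow> Modules.additive (\<lambda>m. of_int (f m) :: real)"
  by (simp add: Modules.additive_def)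

lemma real_form:
  assumes B: "B \<in> integral_forms"
  shows "bilinear (real_form \<iota> B)" "real_form \<iota> B (\<iota> m) (\<iota> n) = of_int (B m n)"
proof -
  define F where "F v w = lin_ext (\<lambda>m. lin_ext (\<lambda>n. of_int (B m n) :: real) w) v" for v w
  have "Modules.additive (\<lambda>m. lin_ext (\<lambda>n. of_int (B m n) :: real) w)" for w
    by (auto simp: Modules.additive_def lin_ext_def integral_formsD[OF B] distrib_left sum.distrib)
  then have F_on: "F (\<iota> m) (\<iota> n) = of_int (B m n)" for m n
    by (simp add: F_def additive_of_int integral_formsD(7,8)[OF B])
  have "linear (F v)" for v
    by (intro linearI) (simp_all add: F_def lin_ext_def rep_add rep_scale distrib_left distrib_right
        sum.distrib sum_distrib_left mult_ac)
  moreover have "linear (\<lambda>v. F v w)" for w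
    by (simp add: F_def linear_lin_ext)
  ultimately have F: "bilinear F" by (auto simp: bilinear_def)
  have "real_form \<iota> B = F"
    unfolding real_form_def
  proof (rule the_equality)
    show "bilinear F \<and> (\<forall>m n. F (\<iota> m) (\<iota> n) = of_int (B m n))" using F F_on by blast
    show "G = F" if "bilinear G \<and> (\<forall>m n. G (\<iota> m) (\<iota> n) = of_int (B m n))" for G
      using that F F_on by (intro bilinear_eq_on_lattice) auto
  qed
  then show "bilinear (real_form \<iota> B)" "real_form \<iota> B (\<iota> m) (\<iota> n) = of_int (B m n)"
    using F F_on by auto
qed

lemma real_form_unique:
  assumes "B \<in> integral_forms" "bilinear F" "\<And>m n. F (\<iota> m) (\<iota> n) = of_int (B m n)"
  shows "real_form \<iota> B = F"
  using assms real_form[OF assms(1)] by (intro bilinear_eq_on_lattice) auto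

lemma bounded_bilinear_real_form: "B \<in> integral_forms \<Longrightarrow> bounded_bilinear (real_form \<iota> B)"
  by (intro bounded_bilinear_bilinear real_form)

lemma real_form_simps:
  assumes "B \<in> integral_forms"
  shows "real_form \<iota> B (x + x') y = real_form \<iota> B x y + real_form \<iota> B x' y"
    "real_form \<iota> B x (y + y') = real_form \<iota> B x y + real_form \<iota> B x y'"
    "real_form \<iota> B 0 y = 0" "real_form \<iota> B x 0 = 0"
  using real_form(1)[OF assms]
  by (simp_all add: bilinear_ladd bilinear_radd bilinear_lzero bilinear_rzero)

lemma integral_forms_add:
  "B \<in> integral_forms \<Longrightarrow> B' \<in> integral_forms \<Longrightarrow> (\<lambda>m n. B m n + B' m n) \<in> integral_forms"
  by (auto simp: integral_forms_def Modules.additive_def)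

lemma integral_forms_minus: "B \<in> integral_forms \<Longrightarrow> (\<lambda>m n. - B m n) \<in> integral_forms"
  by (auto simp: integral_forms_def Modules.additive_def)

lemma integral_forms_pullback:
  "B \<in> integral_forms \<Longrightarrow> Modules.additive f \<Longrightarrow> pullback_form f B \<in> integral_forms"
  by (auto simp: integral_forms_def Modules.additive_def pullback_form_def)

lemma real_form_add:
  assumes "B \<in> integral_forms" "B' \<in> integral_forms"
  shows "real_form \<iota> (\<lambda>m n. B m n + B' m n) = (\<lambda>x y. real_form \<iota> B x y + real_form \<iota> B' x y)"
  using real_form[OF assms(1)] real_form[OF assms(2)]
  by (intro real_form_unique integral_forms_add assms) (auto simp: bilinear_def linear_compose_add)

definition real_ext :: "('l \<Rightarrow> 'l) \<Rightarrow> 'v \<Rightarrow> 'v" where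
  "real_ext f = lin_ext (\<iota> \<circ> f)"

lemma linear_real_ext: "linear (real_ext f)"
  by (simp add: real_ext_def linear_lin_ext)

lemma real_ext_\<iota> [simp]: "Modules.additive f \<Longrightarrow> real_ext f (\<iota> m) = \<iota> (f m)"
  unfolding real_ext_def by (subst lin_ext_\<iota>) (auto simp: Modules.additive_def)

lemma real_ext_unique:
  assumes "Modules.additive f" "linear F" "\<And>m. F (\<iota> m) = \<iota> (f m)"
  shows "real_ext f = F"
  using assms by (intro linear_eq_on_lattice linear_real_ext) auto

lemma additive_compose: "Modules.additive f \<Longrightarrow> Modules.additive g \<Longrightarrow> Modules.additive (f \<circ> g)"
  by (simp add: Modules.additive_def)

lemma real_ext_id: "real_ext id = id"
  by (rule real_ext_unique) (auto simp: Modules.additive_def linear_id)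

lemma real_ext_compose:
  assumes "Modules.additive f" "Modules.additive g"
  shows "real_ext (f \<circ> g) = real_ext f \<circ> real_ext g"
  using assms by (intro real_ext_unique additive_compose linear_compose linear_real_ext) auto

lemma real_form_pullback:
  assumes B: "B \<in> integral_forms" and f: "Modules.additive f"
  shows "real_form \<iota> (pullback_form f B) = (\<lambda>x y. real_form \<iota> B (real_ext f x) (real_ext f y))"
proof (rule real_form_unique[OF integral_forms_pullback[OF B f]])
  show "bilinear (\<lambda>x y. real_form \<iota> B (real_ext f x) (real_ext f y))"
    using real_form(1)[OF B] linear_compose[OF linear_real_ext[of f]]
    by (auto simp: bilinear_def o_def)
qed (simp add: f real_form(2)[OF B] pullback_form_def)

text \<open>B is the strictly upper triangular part of D for some ordering of the basis: an
  alternating matrix is that part minus its transpose. An integral B is available because no halving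
  occurs.\<close>

lemma alternating_integral_form:
  fixes D :: "'l \<Rightarrow> 'l \<Rightarrow> int"
  assumes D: "D \<in> integral_forms" and alt: "\<And>m. D m m = 0"
  obtains B where "B \<in> integral_forms" "\<And>m n. B m n - B n m = D m n"
proof -
  \<comment> \<open>Lattice vectors have integer coordinates, so the floor only changes the
    type.\<close>
  define coord where "coord m e = \<lfloor>rep (\<iota> m) e\<rfloor>" for m e
  have coord: "of_int (coord m e) = rep (\<iota> m) e" for m e
  proof (induction m rule: lattice_induct)
    case zero
    show ?case by (simp add: coord_def)
  next
    case (gen e')
    then show ?case by (simp add: coord_def rep_basis)
  next
    case (diff m n)
    have "rep (\<iota> (m - n)) e = rep (\<iota> m + (-1) *\<^sub>R \<iota> n) e" by simp
    also have "\<dots> = of_int (coord m e - coord n e)"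
      unfolding rep_add rep_scale diff[symmetric] by simp
    finally show ?case by (simp add: coord_def)
  qed
  have coord_add: "coord (m + n) e = coord m e + coord n e" for m n e
    by (subst of_int_eq_iff[where ?'a = real, symmetric]) (simp add: coord rep_add)
  have expand: "\<phi> m = (\<Sum>e\<in>b. coord m e * \<phi> (gen e))" if \<phi>: "Modules.additive \<phi>" for \<phi> :: "'l \<Rightarrow> int" and m
  proof -
    have "real_of_int (\<phi> m) = lin_ext (\<lambda>m. of_int (\<phi> m)) (\<iota> m)"
      using additive_of_int[OF \<phi>] by simp
    also have "\<dots> = of_int (\<Sum>e\<in>b. coord m e * \<phi> (gen e))" by (simp add: lin_ext_def coord)
    finally show ?thesis by linarith
  qed
  \<comment> \<open>An injection into the naturals supplies the order on the basis that
    \<open>'v\<close> itself does not carry.\<close>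
  obtain idx :: "'v \<Rightarrow> nat" where idx: "inj_on idx b"
    using finite_imp_inj_to_nat_seg[OF finite_b] by blast
  define B where "B m n = (\<Sum>e\<in>b. \<Sum>e'\<in>b. coord m e * coord n e' *
      (if idx e < idx e' then D (gen e) (gen e') else 0))" for m n
  have "B \<in> integral_forms"
    by (auto simp: integral_forms_def Modules.additive_def B_def coord_add algebra_simps sum.distrib)
  moreover have "B m n - B n m = D m n" for m n
  proof -
    have anti: "D m n = - D n m" for m n
      using alt[of "m + n"] alt[of m] alt[of n] by (simp add: integral_formsD(1,2)[OF D])
    have "D m n = (\<Sum>e\<in>b. coord m e * D (gen e) n)"
      by (rule expand[of "\<lambda>m. D m n"]) (rule integral_formsD[OF D])
    also have "\<dots> = (\<Sum>e\<in>b. \<Sum>e'\<in>b. coord m e * coord n e' * D (gen e) (gen e'))"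
      by (subst (1) expand[OF integral_formsD(7)[OF D]]) (simp add: sum_distrib_left mult_ac)
    also have "\<dots> = (\<Sum>e\<in>b. \<Sum>e'\<in>b.
        coord m e * coord n e' * (if idx e < idx e' then D (gen e) (gen e') else 0) -
        coord n e' * coord m e * (if idx e' < idx e then D (gen e') (gen e) else 0))"
    proof (intro sum.cong refl)
      fix e e' assume e: "e \<in> b" "e' \<in> b"
      consider "e = e'" | "idx e < idx e'" | "idx e' < idx e"
        using idx e by (metis inj_onD linorder_neqE_nat)
      then show "coord m e * coord n e' * D (gen e) (gen e') =
          coord m e * coord n e' * (if idx e < idx e' then D (gen e) (gen e') else 0) -
          coord n e' * coord m e * (if idx e' < idx e then D (gen e') (gen e) else 0)"
        by cases (use anti[of "gen e" "gen e'"] alt[of "gen e"] in auto)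
    qed
    also have "\<dots> = B m n - (\<Sum>e\<in>b. \<Sum>e'\<in>b. coord n e' * coord m e *
        (if idx e' < idx e then D (gen e') (gen e) else 0))"
      by (simp add: B_def sum_subtractf)
    also have "(\<Sum>e\<in>b. \<Sum>e'\<in>b. coord n e' * coord m e *
        (if idx e' < idx e then D (gen e') (gen e) else 0)) = B n m"
      unfolding B_def by (rule sum.swap)
    finally show ?thesis by simp
  qed
  ultimately show ?thesis using that by blast
qed

text \<open>\<open>c\<close> is a homomorphism from a free group to the circle, so it lifts through
  the linear map that takes the prescribed values at the generators.\<close>

lemma lift_character:
  fixes c :: "'l \<Rightarrow> real"
  assumes c: "\<And>m n. c (m + n) - c m - c n \<in> \<int>"
  obtains L where "linear L" "\<And>m. c m - L (\<iota> m) \<in> \<int>"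
proof -
  have "c m - lin_ext c (\<iota> m) \<in> \<int>" for m
  proof (induction m rule: lattice_induct)
    case zero
    show ?case using Ints_minus[OF c[of 0 0]] by (simp add: linear_0[OF linear_lin_ext])
  next
    case (gen e)
    then show ?case by (simp add: lin_ext_gen)
  next
    case (diff m n)
    have "(c m - lin_ext c (\<iota> m)) - (c n - lin_ext c (\<iota> n)) - (c ((m - n) + n) - c (m - n) - c n) \<in> \<int>"
      by (intro Ints_diff[OF Ints_diff[OF diff] c])
    then show ?case by (simp add: linear_diff[OF linear_lin_ext] algebra_simps)
  qed
  then show ?thesis using that linear_lin_ext by blast
qed

end

section \<open>The weak actor of a categorical torus\<close>

abbreviation cc :: "real \<Rightarrow> real set" where "cc \<equiv> circle_class"

locale categorical_torus = lattice_basis b \<iota>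
  for b :: "'v::real_normed_vector set" and \<iota> :: "'l::ab_group_add \<Rightarrow> 'v" +
  fixes J :: "'l \<Rightarrow> 'l \<Rightarrow> int"
  assumes J: "J \<in> integral_forms"
begin

abbreviation \<Theta> where "\<Theta> \<equiv> Theta \<iota> J"
abbreviation W where "W \<equiv> wAct_plus \<Theta> analytic_maps"
abbreviation finv :: "('l \<Rightarrow> 'l) \<Rightarrow> 'l \<Rightarrow> 'l" where "finv \<equiv> inv_into UNIV"
abbreviation JR where "JR \<equiv> real_form \<iota> J"

lemma Theta_deg0 [simp]:
  "carrier (deg0 \<Theta>) = UNIV" "x \<otimes>\<^bsub>deg0 \<Theta>\<^esub> y = x + y" "\<one>\<^bsub>deg0 \<Theta>\<^esub> = 0" "inv\<^bsub>deg0 \<Theta>\<^esub> x = - x"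
  using inv_additive_group[of x] by (simp_all add: Theta_def) (simp_all add: additive_group_def)

lemma Theta_deg1 [simp]:
  "carrier (deg1 \<Theta>) = UNIV \<times> range cc"
  "(m, cc s) \<otimes>\<^bsub>deg1 \<Theta>\<^esub> (n, cc t) = (m + n, cc (s + t))"
  "\<one>\<^bsub>deg1 \<Theta>\<^esub> = (0, cc 0)"
  "inv\<^bsub>deg1 \<Theta>\<^esub> (m, cc s) = (- m, cc (- s))"
proof -
  interpret A: comm_group "additive_group :: 'l monoid" by (rule comm_group_additive_group)
  interpret C: comm_group circle_group by (rule comm_group_circle)
  have a: "carrier (additive_group :: 'l monoid) = UNIV" "m \<otimes>\<^bsub>additive_group\<^esub> n = m + n"
    "\<one>\<^bsub>additive_group\<^esub> = (0 :: 'l)"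
    by (simp_all add: additive_group_def)
  show "carrier (deg1 \<Theta>) = UNIV \<times> range cc" "(m, cc s) \<otimes>\<^bsub>deg1 \<Theta>\<^esub> (n, cc t) = (m + n, cc (s + t))"
    "\<one>\<^bsub>deg1 \<Theta>\<^esub> = (0, cc 0)"
    by (simp_all add: Theta_def DirProd_def circle_group_carrier circle_group_one a)
  show "inv\<^bsub>deg1 \<Theta>\<^esub> (m, cc s) = (- m, cc (- s))"
    using inv_DirProd[OF A.is_group C.is_group, of m "cc s"]
    by (simp add: Theta_def a(1) circle_group_carrier)
qed

lemma Theta_maps [simp]: "bdry \<Theta> (m, z) = \<iota> m" "act \<Theta> (m, cc t) x = (m, cc (t + JR (\<iota> m) x))"
  by (simp_all add: Theta_def)

lemma pi1_Theta: "pi1 \<Theta> = {0} \<times> range cc"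
  by (auto simp: pi1_def kernel_def)

section \<open>Normal forms of centre-preserving weak automorphisms\<close>

text \<open>The shape that centre-preservation forces on the degree-1 component: each circle is
  carried to another one by a translation. Only the class of \<open>c\<close> modulo the integers
  matters.\<close>

definition shift_map :: "('l \<Rightarrow> 'l) \<Rightarrow> ('l \<Rightarrow> real) \<Rightarrow> 'l \<times> real set \<Rightarrow> 'l \<times> real set" where
  "shift_map f c = restrict (\<lambda>(m, z). (f m, z \<otimes>\<^bsub>circle_group\<^esub> cc (c m))) (UNIV \<times> range cc)"

lemma shift_map_simp [simp]: "shift_map f c (m, cc t) = (f m, cc (t + c m))"
  by (simp add: shift_map_def)

lemma shift_map_cong:
  assumes "\<And>m. c m - c' m \<in> \<int>"
  shows "shift_map f c = shift_map f c'"
proof -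
  have "cc (c m) = cc (c' m)" for m using assms circle_class_eq_iff by blast
  then show ?thesis by (simp add: shift_map_def)
qed

lemma shift_map_eqD:
  assumes "shift_map f c = shift_map f' c'"
  shows "f = f'" "c m - c' m \<in> \<int>"
proof -
  have "(f m, cc (0 + c m)) = (f' m, cc (0 + c' m))" for m
    using fun_cong[OF assms, of "(m, cc 0)"] by (simp only: shift_map_simp)
  then show "f = f'" "c m - c' m \<in> \<int>" by (auto simp: circle_class_eq_iff)
qed

definition weak_map :: "('l \<Rightarrow> 'l) \<Rightarrow> ('l \<Rightarrow> real) \<Rightarrow> ('v \<Rightarrow> 'v \<Rightarrow> real) \<Rightarrow> ('v, 'l \<times> real set) weak_map" where
  "weak_map f c k = (real_ext f, shift_map f c, (\<lambda>(x, y). (0, cc (k x y))))"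

text \<open>Normal form of a centre-preserving weak automorphism. The last condition is the
  compatibility of \<open>\<kappa>\<close> with the action, continued from the lattice to the whole space.\<close>

definition weak_data :: "('l \<Rightarrow> 'l) \<Rightarrow> ('l \<Rightarrow> real) \<Rightarrow> ('v \<Rightarrow> 'v \<Rightarrow> real) \<Rightarrow> bool" where
  "weak_data f c k \<longleftrightarrow> Modules.additive f \<and> bij f \<and>
    (\<forall>p. real_analytic_at (\<lambda>(x, y). k x y) p) \<and> k 0 0 = 0 \<and>
    (\<forall>x y z. k x y + k (x + y) z = k y z + k x (y + z)) \<and>
    (\<forall>m n. c m + c n + k (\<iota> m) (\<iota> n) - c (m + n) \<in> \<int>) \<and>
    (\<forall>x y. k x y - k y x = JR x y - JR (real_ext f x) (real_ext f y))"

lemma weak_dataD: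
  assumes "weak_data f c k"
  shows "Modules.additive f" "bij f" "\<And>p. real_analytic_at (\<lambda>(x, y). k x y) p" "k 0 0 = 0"
    "\<And>x y z. k x y + k (x + y) z = k y z + k x (y + z)"
    "\<And>m n. c m + c n + k (\<iota> m) (\<iota> n) - c (m + n) \<in> \<int>"
    "\<And>x y. k x y - k y x = JR x y - JR (real_ext f x) (real_ext f y)"
    "\<And>x. k x 0 = 0" "\<And>x. k 0 x = 0" "f 0 = 0" "c 0 \<in> \<int>" "cc (c 0) = cc 0"
    "real_ext f 0 = 0" "\<And>x y. real_ext f (x + y) = real_ext f x + real_ext f y"
    "linear (real_ext f)"
proof -
  note w = assms[unfolded weak_data_def]
  show "Modules.additive f" "bij f" "\<And>p. real_analytic_at (\<lambda>(x, y). k x y) p" and k0: "k 0 0 = 0"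
    and coc: "\<And>x y z. k x y + k (x + y) z = k y z + k x (y + z)"
    and c: "\<And>m n. c m + c n + k (\<iota> m) (\<iota> n) - c (m + n) \<in> \<int>"
    and "\<And>x y. k x y - k y x = JR x y - JR (real_ext f x) (real_ext f y)"
    using w by blast+
  show "k x 0 = 0" "k 0 x = 0" for x using coc[of x 0 0] coc[of 0 0 x] k0 by simp_all
  show "f 0 = 0" using w additive.zero by blast
  show "c 0 \<in> \<int>" using c[of 0 0] k0 by simp
  then show "cc (c 0) = cc 0" by (simp add: circle_class_eq_iff)
  show "linear (real_ext f)" by (rule linear_real_ext)
  then show "real_ext f 0 = 0" "real_ext f (x + y) = real_ext f x + real_ext f y" for x y
    by (simp_all add: linear_0 linear_add)
qed

lemma analytic_continuous: "(\<And>p. real_analytic_at f p) \<Longrightarrow> continuous_on UNIV f"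
  by (simp add: continuous_at_imp_continuous_on real_analytic_at_isCont)

lemma analytic_pullback:
  assumes "\<And>p. real_analytic_at (\<lambda>(x, y). k x y) p" "bounded_linear F"
  shows "real_analytic_at (\<lambda>(x, y). k (F x) (F y)) p"
proof -
  have "bounded_linear (\<lambda>p. (F (fst p), F (snd p)))"
    by (intro bounded_linear_Pair bounded_linear_compose[OF assms(2)] bounded_linear_fst bounded_linear_snd)
  from real_analytic_at_linear_right[OF assms(1) this] show ?thesis
    by (simp add: case_prod_unfold)
qed

lemma weak_data_id: "weak_data id (\<lambda>_. 0) (\<lambda>_ _. 0)"
  unfolding weak_data_def
  by (auto simp: real_ext_id Modules.additive_def case_prod_unfold real_analytic_at_const)

lemma weak_data_compose:
  assumes f: "weak_data f c k" and g: "weak_data g d l"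
  shows "weak_data (f \<circ> g) (\<lambda>m. d m + c (g m)) (\<lambda>x y. l x y + k (real_ext g x) (real_ext g y))"
  unfolding weak_data_def
proof (intro conjI allI)
  note wf = weak_dataD[OF f] and wg = weak_dataD[OF g]
  show "Modules.additive (f \<circ> g)" by (intro additive_compose wf wg)
  show "bij (f \<circ> g)" using wf wg by (intro bij_comp)
  have "real_analytic_at (\<lambda>p. (case p of (x, y) \<Rightarrow> l x y) +
      (case p of (x, y) \<Rightarrow> k (real_ext g x) (real_ext g y))) p" for p
    by (rule real_analytic_at_add[OF wg(3) analytic_pullback[OF wf(3) bounded_linear_linear[OF wg(15)]]])
  then show "real_analytic_at (\<lambda>(x, y). l x y + k (real_ext g x) (real_ext g y)) p" for p
    by (simp add: case_prod_unfold)
  show "l x y + k (real_ext g x) (real_ext g y) + (l (x + y) z + k (real_ext g (x + y)) (real_ext g z)) =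
      l y z + k (real_ext g y) (real_ext g z) + (l x (y + z) + k (real_ext g x) (real_ext g (y + z)))" for x y z
    using wg(5)[of x y z] wf(5)[of "real_ext g x" "real_ext g y" "real_ext g z"] by (simp add: wg(14))
  show "l x y + k (real_ext g x) (real_ext g y) - (l y x + k (real_ext g y) (real_ext g x)) =
      JR x y - JR (real_ext (f \<circ> g) x) (real_ext (f \<circ> g) y)" for x y
    using wg(7)[of x y] wf(7)[of "real_ext g x" "real_ext g y"]
    by (simp add: real_ext_compose[OF wf(1) wg(1)])
  show "d m + c (g m) + (d n + c (g n)) + (l (\<iota> m) (\<iota> n) + k (real_ext g (\<iota> m)) (real_ext g (\<iota> n))) -
      (d (m + n) + c (g (m + n))) \<in> \<int>" for m n
    using Ints_add[OF wg(6)[of m n] wf(6)[of "g m" "g n"]]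
    by (simp add: wg(1) additive.add[OF wg(1)] algebra_simps)
qed (use weak_dataD[OF f] weak_dataD[OF g] in auto)

lemma additive_inv:
  assumes f: "Modules.additive f" "bij f"
  shows "Modules.additive (finv f)"
proof (unfold Modules.additive_def, intro allI)
  fix x y
  have s: "f (finv f z) = z" for z using f(2) by (simp add: bij_is_surj surj_f_inv_f)
  have "f (finv f (x + y)) = f (finv f x + finv f y)"
    by (simp add: s additive.add[OF f(1)])
  then show "finv f (x + y) = finv f x + finv f y"
    using f(2) by (simp add: bij_is_inj inj_eq)
qed

lemma real_ext_inv:
  assumes f: "Modules.additive f" "bij f"
  shows "real_ext f (real_ext (finv f) x) = x" "real_ext (finv f) (real_ext f x) = x"
proof -
  have "f \<circ> finv f = id" "finv f \<circ> f = id"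
    using f(2) by (auto simp: bij_is_surj surj_f_inv_f bij_is_inj inv_f_f)
  then have "real_ext f \<circ> real_ext (finv f) = id" "real_ext (finv f) \<circ> real_ext f = id"
    using real_ext_compose[OF f(1) additive_inv[OF f]] real_ext_compose[OF additive_inv[OF f] f(1)]
    by (simp_all add: real_ext_id)
  then show "real_ext f (real_ext (finv f) x) = x" "real_ext (finv f) (real_ext f x) = x"
    by (metis comp_apply id_apply)+
qed

lemma bij_real_ext:
  assumes f: "Modules.additive f" "bij f"
  shows "bij (real_ext f)" "inv_into UNIV (real_ext f) = real_ext (finv f)"
proof -
  show b: "bij (real_ext f)"
    using real_ext_inv[OF f] by (metis bijI')
  show "inv_into UNIV (real_ext f) = real_ext (finv f)"
    by (rule inv_equality[symmetric, THEN sym]) (simp_all add: real_ext_inv[OF f])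
qed

lemma weak_data_inv:
  assumes f: "weak_data f c k"
  shows "weak_data (finv f) (\<lambda>m. - c (finv f m))
      (\<lambda>x y. - k (real_ext (finv f) x) (real_ext (finv f) y))"
  unfolding weak_data_def
proof (intro conjI allI)
  note wf = weak_dataD[OF f]
  define g where "g = inv_into UNIV f"
  have g: "Modules.additive g" unfolding g_def by (intro additive_inv wf)
  have lg: "linear (real_ext g)" by (rule linear_real_ext)
  note G = linear_add[OF lg] linear_0[OF lg] and fg = real_ext_inv[OF wf(1,2), folded g_def]
  show "Modules.additive (finv f)" by (intro additive_inv wf)
  show "bij (finv f)" using wf(2) by (rule bij_imp_bij_inv)
  have "real_analytic_at (\<lambda>p. - (case p of (x, y) \<Rightarrow> k (real_ext g x) (real_ext g y))) p" for p
    by (rule real_analytic_at_minus[OF analytic_pullback[OF wf(3) bounded_linear_linear[OF lg]]])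
  then show "real_analytic_at (\<lambda>(x, y). - k (real_ext (finv f) x) (real_ext (finv f) y)) p" for p
    by (simp add: case_prod_unfold g_def)
  show "- k (real_ext (finv f) 0) (real_ext (finv f) 0) = 0"
    using G wf(4) by (simp add: g_def)
  show "- k (real_ext (finv f) x) (real_ext (finv f) y) +
        - k (real_ext (finv f) (x + y)) (real_ext (finv f) z) =
        - k (real_ext (finv f) y) (real_ext (finv f) z) +
        - k (real_ext (finv f) x) (real_ext (finv f) (y + z))" for x y z
    using wf(5)[of "real_ext g x" "real_ext g y" "real_ext g z"] G(1) by (simp add: g_def[symmetric])
  show "- k (real_ext (finv f) x) (real_ext (finv f) y) -
        - k (real_ext (finv f) y) (real_ext (finv f) x) =
        JR x y - JR (real_ext (finv f) x) (real_ext (finv f) y)" for x y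
    using wf(7)[of "real_ext g x" "real_ext g y"] fg by (simp add: g_def[symmetric])
  show "- c (finv f m) + - c (finv f n) +
        - k (real_ext (finv f) (\<iota> m)) (real_ext (finv f) (\<iota> n)) -
        - c (finv f (m + n)) \<in> \<int>" for m n
    using Ints_minus[OF wf(6)[of "g m" "g n"]]
    by (simp add: g_def[symmetric] g additive.add[OF g] algebra_simps)
qed

lemma shift_map_compose: "compose (UNIV \<times> range cc) (shift_map f c) (shift_map g d) =
    shift_map (f \<circ> g) (\<lambda>m. d m + c (g m))"
  by (rule extensionalityI[where A = "UNIV \<times> range cc"]) (auto simp: compose_def shift_map_def add.assoc)

lemma shift_map_id: "shift_map id (\<lambda>_. 0) = restrict id (UNIV \<times> range cc)"
  by (rule extensionalityI[where A = "UNIV \<times> range cc"]) (auto simp: shift_map_def)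

lemma bij_shift_map:
  assumes "bij f"
  shows "bij_betw (shift_map f c) (UNIV \<times> range cc) (UNIV \<times> range cc)"
    "restrict (inv_into (UNIV \<times> range cc) (shift_map f c)) (UNIV \<times> range cc) =
      shift_map (finv f) (\<lambda>m. - c (finv f m))"
proof -
  define g where "g = inv_into UNIV f"
  have fg: "f (g m) = m" "g (f m) = m" for m
    using assms by (simp_all add: g_def bij_is_surj surj_f_inv_f bij_is_inj inv_f_f)
  show b: "bij_betw (shift_map f c) (UNIV \<times> range cc) (UNIV \<times> range cc)"
    by (rule bij_betw_byWitness[where f' = "shift_map g (\<lambda>m. - c (g m))"]) (auto simp: fg)
  show "restrict (inv_into (UNIV \<times> range cc) (shift_map f c)) (UNIV \<times> range cc) =
      shift_map (finv f) (\<lambda>m. - c (finv f m))"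
    unfolding g_def[symmetric]
  proof (rule extensionalityI[where A = "UNIV \<times> range cc"])
    show "shift_map g (\<lambda>m. - c (g m)) \<in> extensional (UNIV \<times> range cc)" by (simp add: shift_map_def)
    fix p :: "'l \<times> real set" assume p: "p \<in> UNIV \<times> range cc"
    then obtain m t where mt: "p = (m, cc t)" by auto
    have "inv_into (UNIV \<times> range cc) (shift_map f c) (shift_map f c (g m, cc (t - c (g m)))) = (g m, cc (t - c (g m)))"
      using b by (intro inv_into_f_f) (auto simp: bij_betw_def)
    then show "restrict (inv_into (UNIV \<times> range cc) (shift_map f c)) (UNIV \<times> range cc) p =
        shift_map g (\<lambda>m. - c (g m)) p"
      using p by (simp add: mt fg)
  qed simp
qed

lemma shift_map_analytic: "shift_map f c \<in> reg_f1 analytic_maps"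
proof -
  have "real_analytic_at (\<lambda>t. t + c m) a" for m and a :: real
    by (intro real_analytic_at_add real_analytic_at_const real_analytic_at_bounded_linear bounded_linear_ident)
  then show ?thesis by (simp add: analytic_maps_def analytic_to_deg1I)
qed

lemma real_ext_analytic: "real_ext f \<in> reg_f0 analytic_maps"
proof -
  have "\<forall>a. real_analytic_at (real_ext f) a"
    by (intro allI real_analytic_at_bounded_linear bounded_linear_linear linear_real_ext)
  then show ?thesis by (simp add: analytic_maps_def)
qed

lemma W_deg0_carrier:
  "carrier (deg0 W) = {(f0, f1, \<kappa>) \<in> carrier (weak_automorphism_group \<Theta> analytic_maps). \<forall>z. f1 (0, cc z) = (0, cc z)}"
  by (auto simp: wAct_plus_def wAct_def Let_def pi1_Theta)

lemma W_selectors: "monoid.mult (deg0 W) = monoid.mult (weak_automorphism_group \<Theta> analytic_maps)"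
  "one (deg0 W) = one (weak_automorphism_group \<Theta> analytic_maps)"
  "deg1 W = units_of (pointed_map_monoid \<Theta> analytic_maps)"
  "bdry W = bdry (wAct \<Theta> analytic_maps)" "act W = act (wAct \<Theta> analytic_maps)"
  by (simp_all add: wAct_plus_def wAct_def Let_def)

lemma weak_map_in_carrier:
  assumes w: "weak_data f c k"
  shows "weak_map f c k \<in> carrier (deg0 W)"
proof -
  note wd = weak_dataD[OF w]
  have "weak_endomorphism \<Theta> (real_ext f) (shift_map f c) (\<lambda>(x, y). (0, cc (k x y)))"
    unfolding weak_endomorphism_def Let_def
  proof (intro conjI ballI)
    show "shift_map f c \<in> carrier (deg1 \<Theta>) \<rightarrow>\<^sub>E carrier (deg1 \<Theta>)"
      by (auto simp: shift_map_def)
    fix x y z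
    show "kappa3 \<Theta> (real_ext f) (\<lambda>(x, y). (0, cc (k x y))) x y z =
       (case (y, z) of (x, y) \<Rightarrow> (0, cc (k x y))) \<otimes>\<^bsub>deg1 \<Theta>\<^esub>
       (case (x, y \<otimes>\<^bsub>deg0 \<Theta>\<^esub> z) of (x, y) \<Rightarrow> (0, cc (k x y)))"
      using wd(5)[of x y z] by (simp add: kappa3_def real_form_simps[OF J])
  next
    fix \<alpha> \<beta> assume "\<alpha> \<in> carrier (deg1 \<Theta>)" "\<beta> \<in> carrier (deg1 \<Theta>)"
    then obtain m s n t where ab: "\<alpha> = (m, cc s)" "\<beta> = (n, cc t)" by auto
    show "shift_map f c \<alpha> \<otimes>\<^bsub>deg1 \<Theta>\<^esub> shift_map f c \<beta> \<otimes>\<^bsub>deg1 \<Theta>\<^esub>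
        (case (bdry \<Theta> \<alpha>, bdry \<Theta> \<beta>) of (x, y) \<Rightarrow> (0, cc (k x y))) = shift_map f c (\<alpha> \<otimes>\<^bsub>deg1 \<Theta>\<^esub> \<beta>)"
      using wd(6)[of m n] by (simp add: ab additive.add[OF wd(1)] circle_class_eq_iff algebra_simps)
  next
    fix \<alpha> x assume "\<alpha> \<in> carrier (deg1 \<Theta>)"
    then obtain m s where a: "\<alpha> = (m, cc s)" by auto
    show "act \<Theta> (shift_map f c \<alpha>) (real_ext f x) \<otimes>\<^bsub>deg1 \<Theta>\<^esub> (case (bdry \<Theta> \<alpha>, x) of (x, y) \<Rightarrow> (0, cc (k x y))) =
       shift_map f c (act \<Theta> \<alpha> x) \<otimes>\<^bsub>deg1 \<Theta>\<^esub> (case (x, bdry \<Theta> (act \<Theta> \<alpha> x)) of (x, y) \<Rightarrow> (0, cc (k x y)))"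
    proof -
      \<comment> \<open>The compatibility of \<open>\<kappa>\<close> with the action is the
        antisymmetry clause of \<open>weak_data\<close> with one argument on the lattice.\<close>
      have "k (\<iota> m) x = k x (\<iota> m) + JR (\<iota> m) x - JR (\<iota> (f m)) (real_ext f x)"
        using wd(7)[of "\<iota> m" x] wd(1) by simp
      then show ?thesis using wd(1) by (simp add: a algebra_simps)
    qed
  next
    fix \<alpha> assume "\<alpha> \<in> carrier (deg1 \<Theta>)"
    then obtain m s where a: "\<alpha> = (m, cc s)" by auto
    show "real_ext f (bdry \<Theta> \<alpha>) = bdry \<Theta> (shift_map f c \<alpha>)" using wd(1) by (simp add: a)
  qed (use wd in \<open>auto\<close>)
  moreover have "bij (real_ext f)" "inv_into UNIV (real_ext f) = real_ext (finv f)"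
    using bij_real_ext wd by auto
  moreover have "(\<lambda>(x, y). (0 :: 'l, cc (k x y))) \<in> reg_kappa analytic_maps"
    using analytic_to_deg1I[OF wd(3), of "0 :: 'l"] by (simp add: analytic_maps_def case_prod_unfold)
  moreover have "shift_map f c (0, cc z) = (0, cc z)" for z
    using wd(10,11) by (simp add: circle_class_eq_iff)
  ultimately show ?thesis
    using bij_shift_map[OF wd(2), of c]
    by (simp add: W_deg0_carrier weak_automorphism_group_def Let_def weak_map_def real_ext_analytic
        shift_map_analytic restrict_UNIV)
qed

end

context categorical_torus begin

text \<open>The maps are lifted to real functions, where the axioms hold modulo the integers;
  continuity together with the normalisation at 0 makes those over the vector space exact.\<close>

lemma weak_map_cases:
  assumes p: "p \<in> carrier (deg0 W)"
  obtains f c k where "weak_data f c k" "p = weak_map f c k"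
proof -
  obtain p0 p1 \<kappa> where pe: "p = (p0, p1, \<kappa>)" by (cases p) auto
  have we: "weak_endomorphism \<Theta> p0 p1 \<kappa>" and bij0: "bij p0"
    and bij1: "bij_betw p1 (UNIV \<times> range cc) (UNIV \<times> range cc)"
    and an0: "\<And>a. real_analytic_at p0 a" and ank: "analytic_to_deg1 \<kappa>"
    and central: "\<And>z. p1 (0, cc z) = (0, cc z)"
    using p unfolding pe W_deg0_carrier weak_automorphism_group_def Let_def
    by (auto simp: analytic_maps_def)
  obtain m0 K where K: "\<And>a. real_analytic_at K a" and \<kappa>: "\<kappa> = (\<lambda>x. (m0, cc (K x)))"
    using analytic_to_deg1_lift[OF ank] by blast
  note w = we[unfolded weak_endomorphism_def Let_def]
  have p0_0: "p0 0 = 0" and p1_ext: "p1 \<in> extensional (UNIV \<times> range cc)"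
    and p1_in: "\<And>m t. p1 (m, cc t) \<in> UNIV \<times> range cc"
    using w by (auto simp: PiE_def)
  have e1: "p0 (\<iota> m) = \<iota> (fst (p1 (m, cc t)))" for m t
  proof -
    have "p0 (bdry \<Theta> (m, cc t)) = bdry \<Theta> (p1 (m, cc t))" using w by simp
    then show ?thesis by (cases "p1 (m, cc t)") simp
  qed
  have e2: "p0 x + p0 y + \<iota> m0 = p0 (x + y)" for x y
  proof -
    have "p0 x + p0 y + bdry \<Theta> (\<kappa> (x, y)) = p0 (x + y)" using w by simp
    then show ?thesis by (simp add: \<kappa>)
  qed
  have e3: "p1 (m, cc s) \<otimes>\<^bsub>deg1 \<Theta>\<^esub> p1 (n, cc t) \<otimes>\<^bsub>deg1 \<Theta>\<^esub> \<kappa> (\<iota> m, \<iota> n) = p1 (m + n, cc (s + t))" for m n s t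
  proof -
    have "\<forall>\<alpha>\<in>carrier (deg1 \<Theta>). \<forall>\<beta>\<in>carrier (deg1 \<Theta>).
        p1 \<alpha> \<otimes>\<^bsub>deg1 \<Theta>\<^esub> p1 \<beta> \<otimes>\<^bsub>deg1 \<Theta>\<^esub> \<kappa> (bdry \<Theta> \<alpha>, bdry \<Theta> \<beta>) = p1 (\<alpha> \<otimes>\<^bsub>deg1 \<Theta>\<^esub> \<beta>)"
      using w by blast
    from bspec[OF bspec[OF this, of "(m, cc s)"], of "(n, cc t)"] show ?thesis by simp
  qed
  have e5: "act \<Theta> (p1 (m, cc t)) (p0 x) \<otimes>\<^bsub>deg1 \<Theta>\<^esub> \<kappa> (\<iota> m, x) =
      p1 (m, cc (t + JR (\<iota> m) x)) \<otimes>\<^bsub>deg1 \<Theta>\<^esub> \<kappa> (x, \<iota> m)" for m t x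
  proof -
    have "\<forall>\<alpha>\<in>carrier (deg1 \<Theta>). \<forall>x\<in>carrier (deg0 \<Theta>).
         act \<Theta> (p1 \<alpha>) (p0 x) \<otimes>\<^bsub>deg1 \<Theta>\<^esub> \<kappa> (bdry \<Theta> \<alpha>, x) =
         p1 (act \<Theta> \<alpha> x) \<otimes>\<^bsub>deg1 \<Theta>\<^esub> \<kappa> (x, bdry \<Theta> (act \<Theta> \<alpha> x))"
      using w by blast
    from bspec[OF bspec[OF this, of "(m, cc t)"], of x] show ?thesis by simp
  qed
  have coc: "cc (K (x, y) + K (x + y, z)) = cc (K (y, z) + K (x, y + z))" if m0: "m0 = 0" for x y z
  proof -
    have "kappa3 \<Theta> p0 \<kappa> x y z = \<kappa> (y, z) \<otimes>\<^bsub>deg1 \<Theta>\<^esub> \<kappa> (x, y + z)" using w by simp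
    then show ?thesis by (simp add: kappa3_def \<kappa> m0 real_form_simps[OF J])
  qed
  \<comment> \<open>The lattice component of \<open>\<kappa>\<close> is constant, and pointedness of
    \<open>p0\<close> forces it to be 0. Then \<open>p0\<close> is additive, hence linear by
    continuity.\<close>
  have "\<iota> m0 = 0" using e2[of 0 0] p0_0 by simp
  then have m0: "m0 = 0" by simp
  have p0_add: "p0 (x + y) = p0 x + p0 y" for x y using e2[of x y] m0 by simp
  have p0_lin: "linear p0"
    by (rule linear_of_additive_continuous[OF p0_add]) (intro analytic_continuous an0)
  have K0: "K (0, 0) \<in> \<int>"
    using e3[of 0 0 0 0] by (simp add: central \<kappa> m0 circle_class_eq_iff)
  \<comment> \<open>The lift \<open>K\<close> is determined up to an integer constant; this
    normalises it to vanish at the origin.\<close>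
  define k where "k x y = K (x, y) - K (0, 0)" for x y
  have \<kappa>': "\<kappa> (x, y) = (0, cc (k x y))" for x y
    using K0 by (simp add: \<kappa> m0 k_def circle_class_eq_iff)
  have k_an: "real_analytic_at (\<lambda>(x, y). k x y) q" for q
    using real_analytic_at_diff[OF K[of q] real_analytic_at_const[of "K (0, 0)"]]
    by (simp add: k_def case_prod_unfold)
  have k_cont: "continuous_on S (\<lambda>q. k (g q) (h q))" if "continuous_on S g" "continuous_on S h"
    for S :: "'x::topological_space set" and g h
  proof -
    have "continuous_on UNIV (\<lambda>(x, y). k x y)" by (intro analytic_continuous k_an)
    from continuous_on_compose2[OF this, of S "\<lambda>q. (g q, h q)"] that show ?thesis
      by (simp add: continuous_on_Pair)
  qed
  have k00: "k 0 0 = 0" by (simp add: k_def)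
  have k_coc: "k x y + k (x + y) z = k y z + k x (y + z)" for x y z
  proof -
    define d where "d = (\<lambda>(x, y, z). k x y + k (x + y) z - k y z - k x (y + z))"
    have "continuous_on UNIV d" unfolding d_def case_prod_unfold
      by (intro continuous_intros k_cont)
    moreover have "d q \<in> \<int>" for q
    proof -
      obtain x y z where q: "q = (x, y, z)" by (cases q) auto
      have "K (x, y) + K (x + y, z) - (K (y, z) + K (x, y + z)) \<in> \<int>"
        using coc[OF m0] circle_class_eq_iff by blast
      then show ?thesis by (simp add: d_def q k_def algebra_simps)
    qed
    moreover have "d 0 = 0" by (simp add: d_def zero_prod_def k00)
    ultimately have "d (x, y, z) = 0" by (rule Ints_valued_eq_0)
    then show ?thesis by (simp add: d_def)
  qed
  have k0: "k x 0 = 0" "k 0 x = 0" for x using k_coc[of x 0 0] k_coc[of 0 0 x] k00 by simp_all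
  define f where "f m = fst (p1 (m, cc 0))" for m
  have "\<exists>u. p1 (m, cc 0) = (f m, cc u)" for m using p1_in[of m 0] by (auto simp: f_def)
  then obtain c where c: "\<And>m. p1 (m, cc 0) = (f m, cc (c m))" by metis
  \<comment> \<open>Since \<open>p1\<close> fixes the circle over 0, multiplying by an element of
    that circle is a pure translation.\<close>
  have p1: "p1 (m, cc t) = (f m, cc (t + c m))" for m t
    using e3[of m 0 0 t] by (simp add: c central \<kappa>' k0 add.commute)
  have p1': "p1 = shift_map f c"
    by (rule extensionalityI[OF p1_ext, where g = "shift_map f c"]) (auto simp: shift_map_def p1)
  have p0_\<iota>: "p0 (\<iota> m) = \<iota> (f m)" for m using e1[of m 0] by (simp add: f_def)
  have f_add: "Modules.additive f"
  proof (unfold Modules.additive_def, intro allI)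
    fix m n
    have "\<iota> (f (m + n)) = \<iota> (f m + f n)" by (simp add: p0_\<iota>[symmetric] p0_add)
    then show "f (m + n) = f m + f n" by (simp only: \<iota>_eq_iff)
  qed
  have p0': "p0 = real_ext f"
    by (rule real_ext_unique[OF f_add p0_lin p0_\<iota>, symmetric])
  have f_bij: "bij f"
  proof (rule bijI)
    show "inj f"
    proof (rule injI)
      fix m n assume "f m = f n"
      then have "p0 (\<iota> m) = p0 (\<iota> n)" by (simp add: p0_\<iota>)
      then show "m = n" using bij_is_inj[OF bij0] by (simp add: inj_eq)
    qed
    show "surj f"
      unfolding surj_def
    proof
      fix n
      have "(n, cc 0) \<in> p1 ` (UNIV \<times> range cc)" using bij1 by (auto simp: bij_betw_def)
      then obtain m t where "(n, cc 0) = p1 (m, cc t)" by auto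
      then show "\<exists>m. n = f m" by (auto simp: p1)
    qed
  qed
  have c_add: "c m + c n + k (\<iota> m) (\<iota> n) - c (m + n) \<in> \<int>" for m n
    using e3[of m 0 n 0] by (simp add: p1 \<kappa>' circle_class_eq_iff)
  \<comment> \<open>\<open>R\<close> measures the failure of the antisymmetry clause. The action
    axiom makes it integral, hence 0, when the first argument lies on the lattice. The
    antisymmetrisation of a cocycle is additive, so \<open>R\<close> is linear in that argument and
    vanishes everywhere.\<close>
  define R where "R x y = k x y - k y x + JR (p0 x) (p0 y) - JR x y" for x y
  have JR_cont: "continuous_on S (\<lambda>q. JR (g q) (h q))" if "continuous_on S g" "continuous_on S h"
    for S :: "'x::topological_space set" and g h
    using bounded_bilinear.continuous_on[OF bounded_bilinear_real_form[OF J] that] .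
  have p0_cont: "continuous_on S (\<lambda>q. p0 (g q))" if "continuous_on S g"
    for S :: "'x::topological_space set" and g
    using continuous_on_compose2[OF analytic_continuous[OF an0] that] by simp
  have R_lattice: "R (\<iota> m) x = 0" for m x
  proof (rule Ints_valued_eq_0[where f = "R (\<iota> m)"])
    show "continuous_on UNIV (R (\<iota> m))"
      unfolding R_def by (intro continuous_intros k_cont JR_cont p0_cont)
    show "R (\<iota> m) x \<in> \<int>" for x
      using e5[of m 0 x] by (simp add: p1 \<kappa>' circle_class_eq_iff R_def p0_\<iota> algebra_simps)
    show "R (\<iota> m) 0 = 0" by (simp add: R_def k0 p0_0 real_form_simps[OF J])
  qed
  have R0: "R x y = 0" for x y
  proof -
    have "R (x + x') y = R x y + R x' y" for x x'
      using k_coc[of x x' y] k_coc[of x y x'] k_coc[of y x x']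
      by (simp add: R_def p0_add real_form_simps[OF J] add.commute)
    moreover have "continuous_on UNIV (\<lambda>x. R x y)"
      unfolding R_def by (intro continuous_intros k_cont JR_cont p0_cont)
    ultimately have "linear (\<lambda>x. R x y)" by (intro linear_of_additive_continuous)
    from linear_eq_on_lattice[OF this linear_zero] R_lattice show ?thesis by metis
  qed
  have "k x y - k y x = JR x y - JR (real_ext f x) (real_ext f y)" for x y
    using R0[of x y] unfolding R_def p0' by linarith
  then have "weak_data f c k"
    unfolding weak_data_def using f_add f_bij k_an k00 k_coc c_add by blast
  moreover have "p = weak_map f c k"
    by (auto simp: weak_map_def pe p0' p1' \<kappa>')
  ultimately show ?thesis using that by blast
qed

lemma compose_UNIV: "compose UNIV f g = f \<circ> g"
  by (simp add: compose_def restrict_UNIV o_def)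

lemma weak_map_mult:
  assumes f: "weak_data f c k" and g: "weak_data g d l"
  shows "weak_map f c k \<otimes>\<^bsub>deg0 W\<^esub> weak_map g d l =
    weak_map (f \<circ> g) (\<lambda>m. d m + c (g m)) (\<lambda>x y. l x y + k (real_ext g x) (real_ext g y))"
proof -
  note wf = weak_dataD[OF f] and wg = weak_dataD[OF g]
  \<comment> \<open>The degree-1 component of the first factor acts on an element of the circle over
    0, where it only adds the integer \<open>c 0\<close>; the third argument of
    \<open>kappa3\<close> is 0.\<close>
  have "cc (l x y + c 0 + (k (real_ext g x) (real_ext g y))) = cc (l x y + k (real_ext g x) (real_ext g y))" for x y
    using wf(11) by (simp add: circle_class_eq_iff)
  then show ?thesis
    by (simp add: W_selectors weak_automorphism_group_def Let_def weak_map_def shift_map_compose restrict_UNIV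
        real_ext_compose[OF wf(1) wg(1)] compose_UNIV kappa3_def real_form_simps[OF J] wf add.assoc)
qed

lemma weak_map_one: "\<one>\<^bsub>deg0 W\<^esub> = weak_map id (\<lambda>_. 0) (\<lambda>_ _. 0)"
  by (simp add: W_selectors weak_automorphism_group_def Let_def weak_map_def shift_map_id real_ext_id
      restrict_UNIV fun_eq_iff)

lemma weak_map_cong:
  assumes "f = f'" "\<And>m. c m - c' m \<in> \<int>" "\<And>x y. k x y = k' x y"
  shows "weak_map f c k = weak_map f' c' k'"
  using assms shift_map_cong[of c c' f] by (simp add: weak_map_def)

text \<open>The cocycles live on a connected space and agree exactly; the shifts live on the
  discrete lattice and agree modulo the integers.\<close>

lemma weak_map_eqD:
  assumes f: "weak_data f c k" and g: "weak_data g d l" and eq: "weak_map f c k = weak_map g d l"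
  shows "f = g" "c m - d m \<in> \<int>" "k x y = l x y"
proof -
  show "f = g" "c m - d m \<in> \<int>" using eq shift_map_eqD by (auto simp: weak_map_def)
  have e: "(\<lambda>(x, y). (0 :: 'l, cc (k x y))) = (\<lambda>(x, y). (0, cc (l x y)))"
    using eq by (simp add: weak_map_def)
  have "k x y - l x y \<in> \<int>" for x y
    using fun_cong[OF e, of "(x, y)"] by (simp add: circle_class_eq_iff)
  note int = this
  define d where "d = (\<lambda>(x, y). k x y - l x y)"
  have cont: "continuous_on UNIV d"
    using continuous_on_diff[OF analytic_continuous[OF weak_dataD(3)[OF f]] analytic_continuous[OF weak_dataD(3)[OF g]]]
    by (simp add: d_def case_prod_unfold)
  have "d (x, y) = 0"
  proof (rule Ints_valued_eq_0[OF cont])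
    show "d q \<in> \<int>" for q using int by (cases q) (simp add: d_def)
    show "d 0 = 0" by (simp add: d_def zero_prod_def weak_dataD(4)[OF f] weak_dataD(4)[OF g])
  qed
  then have "k x y - l x y = 0" by (simp add: d_def)
  then show "k x y = l x y" by simp
qed

lemma group_W0: "group (deg0 W)"
proof (rule groupI)
  fix p q assume "p \<in> carrier (deg0 W)" "q \<in> carrier (deg0 W)"
  then show "p \<otimes>\<^bsub>deg0 W\<^esub> q \<in> carrier (deg0 W)"
    by (elim weak_map_cases) (simp add: weak_map_mult weak_map_in_carrier weak_data_compose)
next
  show "\<one>\<^bsub>deg0 W\<^esub> \<in> carrier (deg0 W)"
    by (simp add: weak_map_one weak_map_in_carrier weak_data_id)
next
  fix p q r assume "p \<in> carrier (deg0 W)" "q \<in> carrier (deg0 W)" "r \<in> carrier (deg0 W)"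
  then show "p \<otimes>\<^bsub>deg0 W\<^esub> q \<otimes>\<^bsub>deg0 W\<^esub> r = p \<otimes>\<^bsub>deg0 W\<^esub> (q \<otimes>\<^bsub>deg0 W\<^esub> r)"
  proof (elim weak_map_cases)
    fix f c k g d l h e j
    assume w: "weak_data f c k" "weak_data g d l" "weak_data h e j"
      and pqr: "p = weak_map f c k" "q = weak_map g d l" "r = weak_map h e j"
    show ?thesis
      unfolding pqr weak_map_mult[OF w(1,2)] weak_map_mult[OF w(2,3)]
        weak_map_mult[OF w(1) weak_data_compose[OF w(2,3)]] weak_map_mult[OF weak_data_compose[OF w(1,2)] w(3)]
      by (rule weak_map_cong)
        (simp_all add: o_assoc add.assoc real_ext_compose[OF weak_dataD(1)[OF w(2)] weak_dataD(1)[OF w(3)]])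
  qed
next
  fix p assume "p \<in> carrier (deg0 W)"
  then show "\<one>\<^bsub>deg0 W\<^esub> \<otimes>\<^bsub>deg0 W\<^esub> p = p"
    by (elim weak_map_cases) (simp add: weak_map_one weak_map_mult weak_data_id)
  show "\<exists>q\<in>carrier (deg0 W). q \<otimes>\<^bsub>deg0 W\<^esub> p = \<one>\<^bsub>deg0 W\<^esub>"
    using \<open>p \<in> carrier (deg0 W)\<close>
  proof (elim weak_map_cases)
    fix f c k assume w: "weak_data f c k" and p: "p = weak_map f c k"
    note wf = weak_dataD[OF w]
    have i: "finv f \<circ> f = id" "\<And>m. finv f (f m) = m"
      using wf(2) by (auto simp: bij_is_inj inv_f_f)
    show ?thesis
      unfolding p weak_map_one
      by (rule bexI[OF _ weak_map_in_carrier[OF weak_data_inv[OF w]]])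
        (simp add: weak_map_mult[OF weak_data_inv[OF w] w] i real_ext_inv[OF wf(1,2)])
  qed
qed

section \<open>The degree-1 part and the structure of the weak actor\<close>

definition circle_map :: "('v \<Rightarrow> real) \<Rightarrow> 'v \<Rightarrow> 'l \<times> real set" where
  "circle_map h = (\<lambda>x. (0, cc (h x)))"

definition pointed_analytic :: "('v \<Rightarrow> real) \<Rightarrow> bool" where
  "pointed_analytic h \<longleftrightarrow> (\<forall>a. real_analytic_at h a) \<and> h 0 = 0"

lemma pointed_analyticD:
  "pointed_analytic h \<Longrightarrow> real_analytic_at h a" "pointed_analytic h \<Longrightarrow> h 0 = 0"
  by (auto simp: pointed_analytic_def)

lemma pointed_analytic_add: "pointed_analytic h \<Longrightarrow> pointed_analytic h' \<Longrightarrow> pointed_analytic (\<lambda>x. h x + h' x)"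
  by (simp add: pointed_analytic_def real_analytic_at_add)

lemma pointed_analytic_minus: "pointed_analytic h \<Longrightarrow> pointed_analytic (\<lambda>x. - h x)"
  by (simp add: pointed_analytic_def real_analytic_at_minus)

lemma pointed_analytic_0: "pointed_analytic (\<lambda>_. 0)"
  by (simp add: pointed_analytic_def real_analytic_at_const)

lemma pointed_analytic_linear: "linear L \<Longrightarrow> pointed_analytic L"
  by (simp add: pointed_analytic_def real_analytic_at_bounded_linear bounded_linear_linear linear_0)

lemma pointed_analytic_comp: "pointed_analytic h \<Longrightarrow> linear F \<Longrightarrow> pointed_analytic (\<lambda>x. h (F x))"
  unfolding pointed_analytic_def
  using real_analytic_at_linear_right[OF _ bounded_linear_linear, of h F] by (auto simp: linear_0)

lemma circle_map_eq_iff: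
  assumes h: "pointed_analytic h" and h': "pointed_analytic h'"
  shows "circle_map h = circle_map h' \<longleftrightarrow> h = h'"
proof
  assume "circle_map h = circle_map h'"
  then have int: "h x - h' x \<in> \<int>" for x
    by (metis circle_map_def circle_class_eq_iff snd_conv)
  have cont: "continuous_on UNIV (\<lambda>x. h x - h' x)"
    by (intro analytic_continuous real_analytic_at_diff pointed_analyticD(1) h h')
  have "h x - h' x = 0" for x
    by (rule Ints_valued_eq_0[OF cont int]) (simp add: pointed_analyticD(2)[OF h] pointed_analyticD(2)[OF h'])
  then show "h = h'" by (simp add: fun_eq_iff)
qed simp

abbreviation pointed_map_group ("\<P>") where "\<P> \<equiv> pointed_map_monoid \<Theta> analytic_maps"

text \<open>The lattice component of a pointed analytic map is constant, hence 0, and subtracting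
  the integer \<open>H 0\<close> makes the real lift pointed.\<close>

lemma pointed_maps:
  "carrier \<P> = circle_map ` Collect pointed_analytic"
proof (intro equalityI subsetI)
  fix \<eta> assume "\<eta> \<in> carrier \<P>"
  then have e: "analytic_to_deg1 \<eta>" "\<eta> 0 = (0, cc 0)"
    by (auto simp: pointed_map_monoid_def Let_def analytic_maps_def)
  obtain m H where H: "\<And>a. real_analytic_at H a" "\<eta> = (\<lambda>x. (m, cc (H x)))"
    using analytic_to_deg1_lift[OF e(1)] by blast
  have m: "m = 0" and i: "H 0 \<in> \<int>" using e(2) H(2) by (auto simp: circle_class_eq_iff)
  have "pointed_analytic (\<lambda>x. H x - H 0)"
    using H(1) by (simp add: pointed_analytic_def real_analytic_at_diff real_analytic_at_const)
  moreover have "\<eta> = circle_map (\<lambda>x. H x - H 0)"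
    using i by (simp add: H(2) m circle_map_def fun_eq_iff circle_class_eq_iff)
  ultimately show "\<eta> \<in> circle_map ` Collect pointed_analytic" by blast
next
  fix \<eta> :: "'v \<Rightarrow> 'l \<times> real set" assume "\<eta> \<in> circle_map ` Collect pointed_analytic"
  then show "\<eta> \<in> carrier \<P>"
    by (auto simp: pointed_map_monoid_def Let_def analytic_maps_def circle_map_def pointed_analytic_def
        intro: analytic_to_deg1I)
qed

text \<open>The boundaries of the values are 0, so the twisted product degenerates to pointwise
  addition. In particular the semigroup is already a commutative group.\<close>

lemma circle_map_mult:
  "circle_map h \<otimes>\<^bsub>\<P>\<^esub> circle_map h' = circle_map (\<lambda>x. h x + h' x)"
  by (simp add: pointed_map_monoid_def Let_def circle_map_def restrict_UNIV add.commute)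

lemma circle_map_one: "\<one>\<^bsub>\<P>\<^esub> = circle_map (\<lambda>_. 0)"
  by (simp add: pointed_map_monoid_def Let_def circle_map_def restrict_UNIV)

lemma comm_group_pointed_maps: "comm_group \<P>"
proof (rule comm_groupI)
  fix x assume "x \<in> carrier \<P>"
  then obtain h where h: "pointed_analytic h" "x = circle_map h" by (auto simp: pointed_maps)
  show "\<exists>y\<in>carrier \<P>.
      y \<otimes>\<^bsub>\<P>\<^esub> x = \<one>\<^bsub>\<P>\<^esub>"
    using h pointed_analytic_minus
    by (intro bexI[of _ "circle_map (\<lambda>x. - h x)"]) (auto simp: pointed_maps circle_map_mult circle_map_one)
qed (auto simp: pointed_maps circle_map_mult circle_map_one add_ac pointed_analytic_add pointed_analytic_0)

lemma W_deg1:
  "carrier (deg1 W) = circle_map ` Collect pointed_analytic"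
  "circle_map h \<otimes>\<^bsub>deg1 W\<^esub> circle_map h' = circle_map (\<lambda>x. h x + h' x)"
  "\<one>\<^bsub>deg1 W\<^esub> = circle_map (\<lambda>_. 0)"
  "comm_group (deg1 W)"
proof -
  interpret P: comm_group \<P> by (rule comm_group_pointed_maps)
  show "carrier (deg1 W) = circle_map ` Collect pointed_analytic"
    by (simp add: W_selectors units_of_carrier P.Units_eq pointed_maps)
  show "circle_map h \<otimes>\<^bsub>deg1 W\<^esub> circle_map h' = circle_map (\<lambda>x. h x + h' x)" "\<one>\<^bsub>deg1 W\<^esub> = circle_map (\<lambda>_. 0)"
    by (simp_all add: W_selectors units_of_mult units_of_one circle_map_mult circle_map_one)
  show "comm_group (deg1 W)" unfolding W_selectors by (rule P.units_comm_group)
qed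

lemma circle_map_inv:
  assumes "pointed_analytic h"
  shows "inv\<^bsub>deg1 W\<^esub> circle_map h = circle_map (\<lambda>x. - h x)"
proof -
  interpret comm_group "deg1 W" by (rule W_deg1)
  show ?thesis using assms by (intro inv_equality) (auto simp: W_deg1 pointed_analytic_minus)
qed

text \<open>\<open>h\<close> enters twice: its values on the lattice give the shift, and its
  coboundary gives the cocycle. The action drops out because the values lie over 0.\<close>

lemma W_bdry:
  "bdry W (circle_map h) = weak_map id (\<lambda>m. h (\<iota> m)) (\<lambda>x y. h (x + y) - h x - h y)"
proof -
  have "restrict (\<lambda>\<alpha>. \<alpha> \<otimes>\<^bsub>deg1 \<Theta>\<^esub> (0, cc (h (bdry \<Theta> \<alpha>)))) (UNIV \<times> range cc) = shift_map id (\<lambda>m. h (\<iota> m))"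
    by (rule extensionalityI[where A = "UNIV \<times> range cc"]) (auto simp: shift_map_def)
  then show ?thesis
    by (simp add: W_selectors wAct_def Let_def circle_map_def weak_map_def restrict_UNIV real_ext_id fun_eq_iff
        real_form_simps[OF J] algebra_simps)
qed

lemma weak_data_bdry:
  assumes h: "pointed_analytic h"
  shows "weak_data id (\<lambda>m. h (\<iota> m)) (\<lambda>x y. h (x + y) - h x - h y)"
proof -
  have "real_analytic_at (\<lambda>p. h (fst p + snd p) - h (fst p) - h (snd p)) q" for q
    by (intro real_analytic_at_diff
        real_analytic_at_linear_right[OF pointed_analyticD(1)[OF h] bounded_linear_fst]
        real_analytic_at_linear_right[OF pointed_analyticD(1)[OF h] bounded_linear_snd]
        real_analytic_at_linear_right[OF pointed_analyticD(1)[OF h]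
          bounded_linear_add[OF bounded_linear_fst bounded_linear_snd]])
  then show ?thesis
    unfolding weak_data_def
    by (auto simp: case_prod_unfold Modules.additive_def pointed_analyticD(2)[OF h] real_ext_id algebra_simps)
qed

text \<open>As the values of \<eta> have boundary 0, the element u in the formula for the action is
  0, its correction term is trivial, and the inverse of the degree-1 component fixes the circle over
  0. Only the precomposition remains.\<close>

lemma W_act:
  assumes h: "pointed_analytic h" and w: "weak_data f c k"
  shows "act W (circle_map h) (weak_map f c k) = circle_map (\<lambda>x. h (real_ext f x))"
proof
  fix x
  note wf = weak_dataD[OF w]
  have inv0: "inv_into UNIV (real_ext f) (real_ext f x) = x"
    by (simp add: bij_real_ext[OF wf(1,2)] real_ext_inv[OF wf(1,2)])
  have "inv_into (UNIV \<times> range cc) (shift_map f c) (0, cc t) = (0, cc t)" for t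
  proof -
    have "shift_map f c (0, cc t) = (0, cc t)" using wf(10,11) by (simp add: circle_class_eq_iff)
    then have "inv_into (UNIV \<times> range cc) (shift_map f c) (0, cc t) =
        inv_into (UNIV \<times> range cc) (shift_map f c) (shift_map f c (0, cc t))" by simp
    also have "\<dots> = (0, cc t)"
      using bij_shift_map(1)[OF wf(2), of c] by (intro inv_into_f_f) (auto simp: bij_betw_def)
    finally show ?thesis .
  qed
  then show "act W (circle_map h) (weak_map f c k) x = circle_map (\<lambda>x. h (real_ext f x)) x"
    by (simp add: W_selectors wAct_def Let_def circle_map_def weak_map_def inv0 wf)
qed

theorem crossed_module_W: "crossed_module W"
proof -
  interpret W0: group "deg0 W" by (rule group_W0)
  interpret W1: comm_group "deg1 W" by (rule W_deg1)
  have bdry_closed: "bdry W (circle_map h) \<in> carrier (deg0 W)" if "pointed_analytic h" for h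
    unfolding W_bdry by (intro weak_map_in_carrier weak_data_bdry that)
  have conj: "bdry W (circle_map (\<lambda>x. h (real_ext f x))) =
      inv\<^bsub>deg0 W\<^esub> (weak_map f c k) \<otimes>\<^bsub>deg0 W\<^esub> bdry W (circle_map h) \<otimes>\<^bsub>deg0 W\<^esub> weak_map f c k"
    if h: "pointed_analytic h" and w: "weak_data f c k" for h f c k
  proof -
    note wf = weak_dataD[OF w]
    have hf: "pointed_analytic (\<lambda>x. h (real_ext f x))" by (rule pointed_analytic_comp[OF h wf(15)])
    \<comment> \<open>Moving the inverse to the other side leaves an identity between two products
      of known normal forms.\<close>
    have "weak_map f c k \<otimes>\<^bsub>deg0 W\<^esub> bdry W (circle_map (\<lambda>x. h (real_ext f x))) =
        bdry W (circle_map h) \<otimes>\<^bsub>deg0 W\<^esub> weak_map f c k"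
      unfolding W_bdry weak_map_mult[OF w weak_data_bdry[OF hf]] weak_map_mult[OF weak_data_bdry[OF h] w]
      by (rule weak_map_cong) (simp_all add: real_ext_id wf algebra_simps)
    from this[symmetric] show ?thesis
      using bdry_closed[OF hf] bdry_closed[OF h] weak_map_in_carrier[OF w]
      by (simp add: W0.m_assoc)
  qed
  show ?thesis
    unfolding crossed_module_def
  proof (intro conjI ballI)
    show "bdry W \<in> hom (deg1 W) (deg0 W)"
    proof (rule homI)
      fix x y assume "x \<in> carrier (deg1 W)" "y \<in> carrier (deg1 W)"
      then obtain h h' where h: "pointed_analytic h" "x = circle_map h" "pointed_analytic h'" "y = circle_map h'"
        by (auto simp: W_deg1)
      show "bdry W x \<in> carrier (deg0 W)" using h bdry_closed by simp
      show "bdry W (x \<otimes>\<^bsub>deg1 W\<^esub> y) = bdry W x \<otimes>\<^bsub>deg0 W\<^esub> bdry W y"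
        unfolding h(2,4) W_deg1(2) W_bdry weak_map_mult[OF weak_data_bdry[OF h(1)] weak_data_bdry[OF h(3)]]
        by (rule weak_map_cong) (simp_all add: real_ext_id)
    qed
  next
    fix p assume "p \<in> carrier (deg0 W)"
    then obtain f c k where p: "weak_data f c k" "p = weak_map f c k" by (elim weak_map_cases)
    note F = weak_dataD(15)[OF p(1)]
    show "(\<lambda>\<alpha>. act W \<alpha> p) \<in> hom (deg1 W) (deg1 W)"
    proof (rule homI)
      fix x y assume "x \<in> carrier (deg1 W)" "y \<in> carrier (deg1 W)"
      then obtain h h' where h: "pointed_analytic h" "x = circle_map h" "pointed_analytic h'" "y = circle_map h'"
        by (auto simp: W_deg1)
      show "act W x p \<in> carrier (deg1 W)"
        unfolding h(2) p(2) W_act[OF h(1) p(1)] W_deg1(1) by (intro imageI CollectI pointed_analytic_comp[OF h(1) F])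
      show "act W (x \<otimes>\<^bsub>deg1 W\<^esub> y) p = act W x p \<otimes>\<^bsub>deg1 W\<^esub> act W y p"
        unfolding h(2,4) p(2) W_deg1(2) W_act[OF h(1) p(1)] W_act[OF h(3) p(1)]
          W_act[OF pointed_analytic_add[OF h(1,3)] p(1)] ..
    qed
    fix \<alpha> assume "\<alpha> \<in> carrier (deg1 W)"
    then obtain h where h: "pointed_analytic h" "\<alpha> = circle_map h" by (auto simp: W_deg1)
    show "bdry W (act W \<alpha> p) = inv\<^bsub>deg0 W\<^esub> p \<otimes>\<^bsub>deg0 W\<^esub> bdry W \<alpha> \<otimes>\<^bsub>deg0 W\<^esub> p"
      using h p conj by (simp add: W_act)
    fix q assume "q \<in> carrier (deg0 W)"
    then obtain g d l where q: "weak_data g d l" "q = weak_map g d l" by (elim weak_map_cases)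
    show "act W \<alpha> (p \<otimes>\<^bsub>deg0 W\<^esub> q) = act W (act W \<alpha> p) q"
      unfolding h(2) p(2) q(2) weak_map_mult[OF p(1) q(1)] W_act[OF h(1) p(1)]
        W_act[OF h(1) weak_data_compose[OF p(1) q(1)]] W_act[OF pointed_analytic_comp[OF h(1) F] q(1)]
      by (simp add: real_ext_compose[OF weak_dataD(1)[OF p(1)] weak_dataD(1)[OF q(1)]])
  next
    fix \<alpha> assume "\<alpha> \<in> carrier (deg1 W)"
    then obtain h where h: "pointed_analytic h" "\<alpha> = circle_map h" by (auto simp: W_deg1)
    show "act W \<alpha> \<one>\<^bsub>deg0 W\<^esub> = \<alpha>"
      using h by (simp add: weak_map_one W_act weak_data_id real_ext_id)
    fix \<beta> assume "\<beta> \<in> carrier (deg1 W)"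
    then obtain h' where h': "pointed_analytic h'" "\<beta> = circle_map h'" by (auto simp: W_deg1)
    show "act W \<beta> (bdry W \<alpha>) = inv\<^bsub>deg1 W\<^esub> \<alpha> \<otimes>\<^bsub>deg1 W\<^esub> \<beta> \<otimes>\<^bsub>deg1 W\<^esub> \<alpha>"
      unfolding h(2) h'(2) W_bdry W_act[OF h'(1) weak_data_bdry[OF h(1)]] circle_map_inv[OF h(1)] W_deg1(2)
      by (simp add: real_ext_id)
  qed (rule group_W0 W1.is_group)+
qed

end

section \<open>The crossed module \<open>\<Xi>\<close>\<close>

context categorical_torus begin

abbreviation H where "H \<equiv> O_tilde J"
abbreviation N where "N \<equiv> {id :: 'l \<Rightarrow> 'l} \<times> (even_symmetric_forms :: ('l \<Rightarrow> 'l \<Rightarrow> int) set)"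
abbreviation coset where "coset p \<equiv> N #>\<^bsub>H\<^esub> p"

lemma H_carrier_iff: "(f, B) \<in> carrier H \<longleftrightarrow> bij f \<and> Modules.additive f \<and>
    (\<forall>m n. J (f m) (f n) + J (f n) (f m) = J m n + J n m) \<and> B \<in> integral_forms \<and>
    (\<forall>m n. B m n - B n m = J m n - J (f m) (f n))"
  by (auto simp: O_tilde_def form_semidirect_def orthogonal_group_def symmetrisation_def pullback_form_def)

lemma H_carrierD:
  assumes "(f, B) \<in> carrier H"
  shows "bij f" "Modules.additive f" "B \<in> integral_forms"
    "\<And>m n. B m n - B n m = J m n - J (f m) (f n)"
    "\<And>m n. J (f m) (f n) + J (f n) (f m) = J m n + J n m"
  using assms unfolding H_carrier_iff by blast+

lemma H_mult [simp]: "(f, B) \<otimes>\<^bsub>H\<^esub> (g, B') = (f \<circ> g, \<lambda>m n. B (g m) (g n) + B' m n)"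
  and H_one: "\<one>\<^bsub>H\<^esub> = (id, \<lambda>_ _. 0)"
  by (simp_all add: O_tilde_def form_semidirect_def pullback_form_def)

lemma H_compose_in:
  assumes "(f, B) \<in> carrier H" "(g, B') \<in> carrier H"
  shows "(f \<circ> g, \<lambda>m n. B (g m) (g n) + B' m n) \<in> carrier H"
proof -
  note a = H_carrierD[OF assms(1)] and b = H_carrierD[OF assms(2)]
  have "(\<lambda>m n. B (g m) (g n)) \<in> integral_forms"
    using integral_forms_pullback[OF a(3) b(2)] by (simp add: pullback_form_def[abs_def])
  moreover have "B (g m) (g n) + B' m n - (B (g n) (g m) + B' n m) = J m n - J (f (g m)) (f (g n))" for m n
    using a(4)[of "g m" "g n"] b(4)[of m n] by simp
  ultimately show ?thesis
    unfolding H_carrier_iff using a b by (auto simp: bij_comp additive_compose integral_forms_add)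
qed

lemma H_inverse_in:
  assumes p: "(f, B) \<in> carrier H"
  shows "(finv f, \<lambda>m n. - B (finv f m) (finv f n)) \<in> carrier H"
proof -
  note a = H_carrierD[OF p]
  define g where "g = inv_into UNIV f"
  have fg: "f (g m) = m" for m using a(1) by (simp add: g_def bij_is_surj surj_f_inv_f)
  have g: "Modules.additive g" "bij g"
    unfolding g_def using a by (simp_all add: additive_inv bij_imp_bij_inv)
  have "(\<lambda>m n. - B (g m) (g n)) \<in> integral_forms"
    using integral_forms_minus[OF integral_forms_pullback[OF a(3) g(1)]] by (simp add: pullback_form_def[abs_def])
  moreover have "- B (g m) (g n) - - B (g n) (g m) = J m n - J (g m) (g n)" for m n
    using a(4)[of "g m" "g n"] by (simp add: fg)
  ultimately have "(g, \<lambda>m n. - B (g m) (g n)) \<in> carrier H"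
    unfolding H_carrier_iff using g a(5)[of "g _" "g _"] by (auto simp: fg)
  then show ?thesis by (simp add: g_def)
qed

lemma group_H: "group H"
proof (rule groupI)
  show "\<one>\<^bsub>H\<^esub> \<in> carrier H"
    by (auto simp: H_one H_carrier_iff integral_forms_def Modules.additive_def)
  fix p q r assume "p \<in> carrier H" "q \<in> carrier H"
  then show "p \<otimes>\<^bsub>H\<^esub> q \<in> carrier H" by (cases p; cases q) (auto simp: H_compose_in)
  show "p \<otimes>\<^bsub>H\<^esub> q \<otimes>\<^bsub>H\<^esub> r = p \<otimes>\<^bsub>H\<^esub> (q \<otimes>\<^bsub>H\<^esub> r)"
    by (cases p; cases q; cases r) (simp add: o_assoc add.assoc)
next
  fix p assume p: "p \<in> carrier H"
  then show "\<one>\<^bsub>H\<^esub> \<otimes>\<^bsub>H\<^esub> p = p" by (cases p) (simp add: H_one)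
  show "\<exists>q\<in>carrier H. q \<otimes>\<^bsub>H\<^esub> p = \<one>\<^bsub>H\<^esub>"
  proof (cases p)
    case (Pair f B)
    note a = H_carrierD[OF p[unfolded Pair]]
    have "finv f (f m) = m" for m using a(1) by (simp add: bij_is_inj inv_f_f)
    then show ?thesis
      by (intro bexI[OF _ H_inverse_in[OF p[unfolded Pair]]]) (simp add: Pair H_one fun_eq_iff)
  qed
qed

sublocale H: group H by (rule group_H)

lemma H_inv:
  assumes p: "(f, B) \<in> carrier H"
  shows "inv\<^bsub>H\<^esub> (f, B) = (finv f, \<lambda>m n. - B (finv f m) (finv f n))"
proof (rule H.inv_equality)
  have "finv f (f m) = m" for m using H_carrierD(1)[OF p] by (simp add: bij_is_inj inv_f_f)
  then show "(finv f, \<lambda>m n. - B (finv f m) (finv f n)) \<otimes>\<^bsub>H\<^esub> (f, B) = \<one>\<^bsub>H\<^esub>"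
    by (simp add: H_one fun_eq_iff)
qed (use p H_inverse_in in auto)

lemma H_conj:
  assumes p: "(f, B) \<in> carrier H"
  shows "inv\<^bsub>H\<^esub> (f, B) \<otimes>\<^bsub>H\<^esub> (id, S) \<otimes>\<^bsub>H\<^esub> (f, B) = (id, \<lambda>m n. S (f m) (f n))"
proof -
  have "finv f (f m) = m" for m using H_carrierD(1)[OF p] by (simp add: bij_is_inj inv_f_f)
  then show ?thesis by (simp add: H_inv[OF p] fun_eq_iff)
qed

lemma even_formsD:
  assumes "S \<in> even_symmetric_forms"
  shows "S \<in> integral_forms" "\<And>m n. S m n = S n m" "\<And>m. even (S m m)"
  using assms unfolding even_symmetric_forms_def by auto

lemma N_in_H: "S \<in> even_symmetric_forms \<Longrightarrow> (id, S) \<in> carrier H"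
  using even_formsD[of S] by (auto simp: H_carrier_iff Modules.additive_def)

lemma even_forms_add:
  "S \<in> even_symmetric_forms \<Longrightarrow> S' \<in> even_symmetric_forms \<Longrightarrow> (\<lambda>m n. S m n + S' m n) \<in> even_symmetric_forms"
  by (auto simp: even_symmetric_forms_def integral_forms_add)

lemma even_forms_pullback:
  fixes S :: "'l \<Rightarrow> 'l \<Rightarrow> int" and f :: "'l \<Rightarrow> 'l"
  shows "S \<in> even_symmetric_forms \<Longrightarrow> Modules.additive f \<Longrightarrow> (\<lambda>m n. S (f m) (f n)) \<in> even_symmetric_forms"
  using integral_forms_pullback[of S f] by (auto simp: even_symmetric_forms_def pullback_form_def[abs_def])

lemma N_normal: "N \<lhd> H"
  unfolding H.normal_inv_iff
proof (intro conjI ballI)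
  show "subgroup N H"
  proof (rule H.subgroupI)
    show "N \<subseteq> carrier H" using N_in_H by auto
    have "(\<lambda>_ _. 0) \<in> even_symmetric_forms"
      by (auto simp: even_symmetric_forms_def integral_forms_def Modules.additive_def)
    then show "N \<noteq> {}" by auto
    fix p assume "p \<in> N"
    then obtain S where S: "S \<in> even_symmetric_forms" "p = (id, S)" by auto
    then show "inv\<^bsub>H\<^esub> p \<in> N"
      by (auto simp: H_inv[OF N_in_H] even_symmetric_forms_def integral_forms_minus inv_id)
    fix q assume "q \<in> N"
    then show "p \<otimes>\<^bsub>H\<^esub> q \<in> N" using S by (auto simp: even_forms_add)
  qed
  fix p n assume p: "p \<in> carrier H" and "n \<in> N"
  then obtain S where S: "S \<in> even_symmetric_forms" "n = (id, S)" by auto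
  obtain f B where fB: "p = (f, B)" by (cases p)
  obtain g C where gC: "inv\<^bsub>H\<^esub> p = (g, C)" by (cases "inv\<^bsub>H\<^esub> p")
  have gC_in: "(g, C) \<in> carrier H" using H.inv_closed[OF p] gC by simp
  \<comment> \<open>\<open>H_conj\<close> treats conjugation with the inverse on the left, whereas
    normality asks for the opposite order; hence \<open>p\<close> is rewritten as an
    inverse.\<close>
  have "p = inv\<^bsub>H\<^esub> (g, C)" using H.inv_inv[OF p] gC by simp
  then have "p \<otimes>\<^bsub>H\<^esub> n \<otimes>\<^bsub>H\<^esub> inv\<^bsub>H\<^esub> p = (id, \<lambda>m n. S (g m) (g n))"
    using H_conj[OF gC_in, of S] S(2) gC by simp
  then show "p \<otimes>\<^bsub>H\<^esub> n \<otimes>\<^bsub>H\<^esub> inv\<^bsub>H\<^esub> p \<in> N"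
    using even_forms_pullback[OF S(1) H_carrierD(2)[OF gC_in]] by simp
qed

sublocale N: normal N H by (rule N_normal)

lemma mem_coset: "(g, C) \<in> coset (f, B) \<longleftrightarrow>
    g = f \<and> (\<exists>S\<in>even_symmetric_forms. C = (\<lambda>m n. S (f m) (f n) + B m n))"
  by (auto simp: r_coset_def)

lemma coset_self: "p \<in> carrier H \<Longrightarrow> p \<in> coset p"
  by (rule H.rcos_self[OF _ N.is_subgroup])

lemma fst_some_coset:
  assumes "(f, B) \<in> carrier H"
  shows "fst (SOME p. p \<in> coset (f, B)) = f"
proof -
  have "(SOME p. p \<in> coset (f, B)) \<in> coset (f, B)" by (rule someI) (rule coset_self[OF assms])
  then show ?thesis by (cases "SOME p. p \<in> coset (f, B)") (simp add: mem_coset)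
qed

lemma coset_id_eqI:
  assumes "(id, B) \<in> carrier H" "(\<lambda>m n. C m n - B m n) \<in> even_symmetric_forms"
  shows "coset (id, B) = coset (id, C)"
proof (rule H.repr_independence[OF _ assms(1) N.is_subgroup])
  show "(id, C) \<in> coset (id, B)"
    unfolding mem_coset using assms(2) by (auto intro!: bexI[OF _ assms(2)])
qed

lemma Xi_simps:
  "deg0 (Xi J) = H Mod N" "carrier (deg1 (Xi J)) = dual_lattice"
  "l \<otimes>\<^bsub>deg1 (Xi J)\<^esub> l' = (\<lambda>m. l m + l' m)" "\<one>\<^bsub>deg1 (Xi J)\<^esub> = (\<lambda>_. 0)"
  "bdry (Xi J) l = coset (id, \<lambda>m n. l m * l n)" "act (Xi J) l e = l \<circ> fst (SOME p. p \<in> e)"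
  by (simp_all add: Xi_def E_group_def)

lemma comm_group_Xi1: "comm_group (deg1 (Xi J))"
proof (rule comm_groupI)
  fix l assume l: "l \<in> carrier (deg1 (Xi J))"
  show "\<exists>k\<in>carrier (deg1 (Xi J)). k \<otimes>\<^bsub>deg1 (Xi J)\<^esub> l = \<one>\<^bsub>deg1 (Xi J)\<^esub>"
    using l by (intro bexI[of _ "\<lambda>m. - l m"]) (auto simp: Xi_simps dual_lattice_def Modules.additive_def)
qed (auto simp: Xi_simps dual_lattice_def Modules.additive_def add_ac)

lemma E_cases:
  assumes "e \<in> carrier (H Mod N)"
  obtains f B where "(f, B) \<in> carrier H" "e = coset (f, B)"
  using assms by (auto simp: carrier_FactGroup)

lemma coset_hom: "(\<lambda>p. coset p) \<in> hom H (H Mod N)"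
  by (rule N.r_coset_hom_Mod)

lemma coset_mult: "p \<in> carrier H \<Longrightarrow> q \<in> carrier H \<Longrightarrow> coset p \<otimes>\<^bsub>H Mod N\<^esub> coset q = coset (p \<otimes>\<^bsub>H\<^esub> q)"
  using hom_mult[OF coset_hom] by simp

lemma group_E: "group (H Mod N)"
  by (rule N.factorgroup_is_group)

lemma coset_inv: "p \<in> carrier H \<Longrightarrow> inv\<^bsub>H Mod N\<^esub> coset p = coset (inv\<^bsub>H\<^esub> p)"
  using group_hom.hom_inv[of H "H Mod N" "\<lambda>p. coset p"] coset_hom group_H group_E
  by (auto simp: group_hom_def group_hom_axioms_def)

lemma coset_one: "coset (id, \<lambda>_ _. 0) = N"
  using H.coset_mult_one[OF N.subset] by (simp add: H_one)

lemma dual_latticeD: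
  assumes "l \<in> dual_lattice"
  shows "l (m + n) = l m + l n" "Modules.additive l"
  using assms by (auto simp: dual_lattice_def additive.add)

lemma tensor_in_H: "l \<in> dual_lattice \<Longrightarrow> (id, \<lambda>m n. l m * l n) \<in> carrier H"
  by (auto simp: H_carrier_iff integral_forms_def Modules.additive_def dual_latticeD algebra_simps)

theorem crossed_module_Xi: "crossed_module (Xi J)"
proof -
  interpret E: group "H Mod N" by (rule group_E)
  interpret L: comm_group "deg1 (Xi J)" by (rule comm_group_Xi1)
  show ?thesis
    unfolding crossed_module_def Xi_simps(1)
  proof (intro conjI ballI)
    show "bdry (Xi J) \<in> hom (deg1 (Xi J)) (H Mod N)"
    proof (rule homI)
      fix l l' assume "l \<in> carrier (deg1 (Xi J))" "l' \<in> carrier (deg1 (Xi J))"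
      then have l: "l \<in> dual_lattice" "l' \<in> dual_lattice" by (simp_all add: Xi_simps)
      note t = tensor_in_H[OF l(1)] tensor_in_H[OF l(2)]
      show "bdry (Xi J) l \<in> carrier (H Mod N)"
        using t(1) by (auto simp: Xi_simps carrier_FactGroup)
      have sum: "(\<lambda>m. l m + l' m) \<in> dual_lattice"
        using l by (auto simp: dual_lattice_def Modules.additive_def)
      \<comment> \<open>The tensor square fails to be additive by the mixed terms, a symmetric form
        with diagonal 2 l(m) l'(m). This is why the boundary becomes a homomorphism after dividing
        by the even forms.\<close>
      have "(\<lambda>m n. - (l m * l' n + l' m * l n)) \<in> even_symmetric_forms"
        using l by (auto simp: even_symmetric_forms_def integral_forms_def Modules.additive_def dual_latticeD algebra_simps)
      then have "coset (id, \<lambda>m n. (l m + l' m) * (l n + l' n)) = coset (id, \<lambda>m n. l m * l n + l' m * l' n)"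
        by (intro coset_id_eqI tensor_in_H[OF sum]) (simp add: algebra_simps)
      then show "bdry (Xi J) (l \<otimes>\<^bsub>deg1 (Xi J)\<^esub> l') = bdry (Xi J) l \<otimes>\<^bsub>H Mod N\<^esub> bdry (Xi J) l'"
        by (simp add: Xi_simps coset_mult[OF t] del: mult_FactGroup)
    qed
  next
    fix e assume "e \<in> carrier (H Mod N)"
    then obtain f B where p: "(f, B) \<in> carrier H" "e = coset (f, B)" by (rule E_cases)
    note f = H_carrierD[OF p(1)]
    have act: "act (Xi J) l e = l \<circ> f" for l by (simp add: Xi_simps p(2) fst_some_coset[OF p(1)])
    have lf: "l \<circ> f \<in> dual_lattice" if "l \<in> dual_lattice" for l
      using that f(2) by (auto simp: dual_lattice_def Modules.additive_def)
    show "(\<lambda>l. act (Xi J) l e) \<in> hom (deg1 (Xi J)) (deg1 (Xi J))"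
      using lf by (intro homI) (auto simp: act Xi_simps(2,3))
    fix l assume "l \<in> carrier (deg1 (Xi J))"
    then have l: "l \<in> dual_lattice" by (simp add: Xi_simps)
    have "inv\<^bsub>H Mod N\<^esub> e \<otimes>\<^bsub>H Mod N\<^esub> coset (id, \<lambda>m n. l m * l n) \<otimes>\<^bsub>H Mod N\<^esub> e =
        coset (inv\<^bsub>H\<^esub> (f, B) \<otimes>\<^bsub>H\<^esub> (id, \<lambda>m n. l m * l n) \<otimes>\<^bsub>H\<^esub> (f, B))"
      using p(1) tensor_in_H[OF l]
      by (simp add: p(2) coset_inv coset_mult H.inv_closed H.m_closed del: mult_FactGroup H_mult)
    then show "bdry (Xi J) (act (Xi J) l e) =
        inv\<^bsub>H Mod N\<^esub> e \<otimes>\<^bsub>H Mod N\<^esub> bdry (Xi J) l \<otimes>\<^bsub>H Mod N\<^esub> e"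
      by (simp add: act Xi_simps(5) H_conj[OF p(1)] del: mult_FactGroup H_mult)
    fix e' assume "e' \<in> carrier (H Mod N)"
    then obtain g C where q: "(g, C) \<in> carrier H" "e' = coset (g, C)" by (rule E_cases)
    show "act (Xi J) l (e \<otimes>\<^bsub>H Mod N\<^esub> e') = act (Xi J) (act (Xi J) l e) e'"
      using fst_some_coset[OF H_compose_in[OF p(1) q(1)]] fst_some_coset[OF q(1)]
      by (simp add: Xi_simps(6) p(2) q(2) coset_mult[OF p(1) q(1)] fst_some_coset[OF p(1)] o_assoc
          del: mult_FactGroup)
  next
    fix l assume "l \<in> carrier (deg1 (Xi J))"
    then have l: "l \<in> dual_lattice" by (simp add: Xi_simps)
    have "fst (SOME p. p \<in> N) = id"
      using fst_some_coset[of id "\<lambda>_ _. 0"] H.one_closed by (simp add: coset_one H_one)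
    then show "act (Xi J) l \<one>\<^bsub>H Mod N\<^esub> = l" by (simp add: Xi_simps(6))
    fix l' assume "l' \<in> carrier (deg1 (Xi J))"
    \<comment> \<open>The boundary lies over the identity isometry, so it acts trivially;
      commutativity of the dual lattice makes conjugation trivial as well.\<close>
    then show "act (Xi J) l' (bdry (Xi J) l) = inv\<^bsub>deg1 (Xi J)\<^esub> l \<otimes>\<^bsub>deg1 (Xi J)\<^esub> l' \<otimes>\<^bsub>deg1 (Xi J)\<^esub> l"
      using \<open>l \<in> carrier (deg1 (Xi J))\<close>
      by (simp add: Xi_simps(5,6) fst_some_coset[OF tensor_in_H[OF l]] L.m_comm[of _ l'] L.m_assoc)
  qed (rule group_E L.is_group)+
qed

section \<open>The equivalence\<close>

lemma real_form_weak_data: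
  assumes p: "(f, B) \<in> carrier H"
  shows "weak_data f (\<lambda>_. 0) (real_form \<iota> B)"
proof -
  note a = H_carrierD[OF p]
  interpret B: bounded_bilinear "real_form \<iota> B" by (rule bounded_bilinear_real_form[OF a(3)])
  \<comment> \<open>Analyticity in the pair (x, y): the form is the diagonal of a bilinear map on
    the product space.\<close>
  have "bounded_bilinear (\<lambda>p q. real_form \<iota> B (fst p) (snd q))"
    by (rule B.comp[OF bounded_linear_fst bounded_linear_snd])
  then have an: "real_analytic_at (\<lambda>(x, y). real_form \<iota> B x y) q" for q
    using real_analytic_at_bounded_bilinear by (simp add: case_prod_unfold)
  have "(\<lambda>x y. real_form \<iota> B x y - real_form \<iota> B y x) =
      (\<lambda>x y. JR x y - JR (real_ext f x) (real_ext f y))"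
  proof (rule bilinear_eq_on_lattice)
    show "bilinear (\<lambda>x y. real_form \<iota> B x y - real_form \<iota> B y x)"
      using real_form(1)[OF a(3)] by (auto simp: bilinear_def linear_compose_sub)
    have "bilinear (\<lambda>x y. JR (real_ext f x) (real_ext f y))"
      using real_form(1)[OF integral_forms_pullback[OF J a(2)]] by (simp add: real_form_pullback[OF J a(2)])
    then show "bilinear (\<lambda>x y. JR x y - JR (real_ext f x) (real_ext f y))"
      using real_form(1)[OF J] by (auto simp: bilinear_def linear_compose_sub)
    fix m n
    have "real_of_int (B m n - B n m) = of_int (J m n - J (f m) (f n))" using a(4) by simp
    then show "real_form \<iota> B (\<iota> m) (\<iota> n) - real_form \<iota> B (\<iota> n) (\<iota> m) =
        JR (\<iota> m) (\<iota> n) - JR (real_ext f (\<iota> m)) (real_ext f (\<iota> n))"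
      by (simp add: a(2) real_form(2)[OF a(3)] real_form(2)[OF J])
  qed
  then have anti: "real_form \<iota> B x y - real_form \<iota> B y x = JR x y - JR (real_ext f x) (real_ext f y)" for x y
    by (simp add: fun_eq_iff)
  show ?thesis
    unfolding weak_data_def
    using a an anti by (auto simp: real_form_simps[OF a(3)] real_form(2)[OF a(3)])
qed

definition realise :: "('l \<Rightarrow> 'l) \<times> ('l \<Rightarrow> 'l \<Rightarrow> int) \<Rightarrow> ('v, 'l \<times> real set) weak_map" where
  "realise = (\<lambda>(f, B). weak_map f (\<lambda>_. 0) (real_form \<iota> B))"

lemma realise_hom: "realise \<in> hom H (deg0 W)"
proof (rule homI)
  fix p q assume "p \<in> carrier H" "q \<in> carrier H"
  moreover obtain f B g C where pq: "p = (f, B)" "q = (g, C)" by (cases p; cases q) auto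
  ultimately have p: "(f, B) \<in> carrier H" and q: "(g, C) \<in> carrier H" by auto
  show "realise p \<in> carrier (deg0 W)"
    using weak_map_in_carrier[OF real_form_weak_data[OF p]] by (simp add: realise_def pq)
  note B = H_carrierD[OF p] and C = H_carrierD[OF q]
  have "real_form \<iota> (\<lambda>m n. pullback_form g B m n + C m n) =
      (\<lambda>x y. real_form \<iota> B (real_ext g x) (real_ext g y) + real_form \<iota> C x y)"
    using real_form_add[OF integral_forms_pullback[OF B(3) C(2)] C(3)]
    by (simp add: real_form_pullback[OF B(3) C(2)])
  then show "realise (p \<otimes>\<^bsub>H\<^esub> q) = realise p \<otimes>\<^bsub>deg0 W\<^esub> realise q"
    by (simp add: realise_def pq weak_map_mult[OF real_form_weak_data[OF p] real_form_weak_data[OF q]]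
        pullback_form_def add.commute)
qed

text \<open>Well defined by \<open>circle_map_eq_iff\<close>: the normalisation at 0 removes the
  integer ambiguity of a real lift.\<close>

definition lift :: "('v \<Rightarrow> 'l \<times> real set) \<Rightarrow> 'v \<Rightarrow> real" where
  "lift \<gamma> = (THE h. pointed_analytic h \<and> circle_map h = \<gamma>)"

lemma lift_circle_map [simp]: "pointed_analytic h \<Longrightarrow> lift (circle_map h) = h"
  unfolding lift_def by (rule the_equality) (auto simp: circle_map_eq_iff)

text \<open>If \<open>h\<close> has coboundary \<open>B\<close> and is integral on the lattice, then
  \<open>h x = (B x x + \<lambda> x) / 2\<close> for a unique \<open>\<lambda>\<close> in the dual lattice.\<close>

definition character :: "('l \<Rightarrow> 'l) \<times> ('l \<Rightarrow> 'l \<Rightarrow> int) \<Rightarrow> ('v \<Rightarrow> 'l \<times> real set) \<Rightarrow> 'l \<Rightarrow> int" where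
  "character = (\<lambda>(f, B) \<gamma> m. 2 * \<lfloor>lift \<gamma> (\<iota> m)\<rfloor> - B m m)"

text \<open>Compares normal forms. The shift of the realised pair is 0, so \<open>h\<close> must be
  integral on the lattice, which makes the floor in \<open>character\<close> exact.\<close>

lemma realise_eq_bdryD:
  assumes p: "(f, B) \<in> carrier H" and h: "pointed_analytic h"
    and eq: "realise (f, B) = bdry W (circle_map h)"
  shows "f = id" "h (\<iota> m) \<in> \<int>" "real_form \<iota> B x y = h (x + y) - h x - h y"
    "B m n = B n m" "of_int (character (f, B) (circle_map h) m) = 2 * h (\<iota> m) - of_int (B m m)"
proof -
  note e = weak_map_eqD[OF real_form_weak_data[OF p] weak_data_bdry[OF h] eq[unfolded W_bdry realise_def prod.case]]
  show f: "f = id" and "real_form \<iota> B x y = h (x + y) - h x - h y" using e by auto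
  have i: "h (\<iota> m) \<in> \<int>" for m using Ints_minus[OF e(2)[of m]] by simp
  then show "h (\<iota> m) \<in> \<int>" .
  show "B m n = B n m" using H_carrierD(4)[OF p, of m n] by (simp add: f)
  show "of_int (character (f, B) (circle_map h) m) = 2 * h (\<iota> m) - of_int (B m m)"
    using i[of m] by (simp add: character_def h)
qed

lemma realise_eq_bdryI:
  assumes p: "(id, B) \<in> carrier H" and h: "pointed_analytic h"
    and "\<And>m. h (\<iota> m) \<in> \<int>" "\<And>x y. real_form \<iota> B x y = h (x + y) - h x - h y"
  shows "realise (id, B) = bdry W (circle_map h)"
  unfolding realise_def prod.case W_bdry using assms by (intro weak_map_cong) auto

text \<open>An integral form B absorbs the antisymmetric part of the cocycle. The symmetric
  remainder is trivialised by its analytic primitive, and the shift that is left is a character,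
  trivialised by a linear map.\<close>

lemma realise_essentially_surjective:
  assumes "p \<in> carrier (deg0 W)"
  shows "\<exists>a\<in>carrier H. \<exists>\<gamma>\<in>carrier (deg1 W). realise a = p \<otimes>\<^bsub>deg0 W\<^esub> bdry W \<gamma>"
proof -
  obtain f c k where w: "weak_data f c k" and p: "p = weak_map f c k" using assms by (rule weak_map_cases)
  note wf = weak_dataD[OF w]
  define D where "D m n = J m n + - pullback_form f J m n" for m n
  have D: "D \<in> integral_forms"
    unfolding D_def[abs_def] by (intro integral_forms_add integral_forms_minus integral_forms_pullback J wf)
  have kD: "of_int (D m n) = k (\<iota> m) (\<iota> n) - k (\<iota> n) (\<iota> m)" for m n
    using wf(7)[of "\<iota> m" "\<iota> n"] wf(1) by (simp add: D_def pullback_form_def real_form(2)[OF J])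
  have "D m m = 0" for m using kD[of m m] by simp
  then obtain B where B: "B \<in> integral_forms" "\<And>m n. B m n - B n m = D m n"
    using alternating_integral_form[OF D] by blast
  \<comment> \<open>That \<open>f\<close> preserves the symmetrisation of J is a consequence: B
    minus its transpose is antisymmetric, so J and its pullback have the same symmetric
    part.\<close>
  have a: "(f, B) \<in> carrier H"
    unfolding H_carrier_iff
  proof (intro conjI allI wf B(1))
    show "B m n - B n m = J m n - J (f m) (f n)" for m n
      using B(2)[of m n] by (simp add: D_def pullback_form_def)
    show "J (f m) (f n) + J (f n) (f m) = J m n + J n m" for m n
      using B(2)[of m n] B(2)[of n m] by (simp add: D_def pullback_form_def)
  qed
  note wB = weak_dataD[OF real_form_weak_data[OF a]]
  interpret s: symmetric_cocycle "\<lambda>x y. k x y - real_form \<iota> B x y"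
  proof
    show "k x y - real_form \<iota> B x y + (k (x + y) z - real_form \<iota> B (x + y) z) =
        k y z - real_form \<iota> B y z + (k x (y + z) - real_form \<iota> B x (y + z))" for x y z
      using wf(5)[of x y z] wB(5)[of x y z] by simp
    show "k x y - real_form \<iota> B x y = k y x - real_form \<iota> B y x" for x y
      using wf(7)[of x y] wB(7)[of x y] by simp
    show "k 0 0 - real_form \<iota> B 0 0 = 0" using wf(4) wB(4) by simp
    show "real_analytic_at (\<lambda>(x, y). k x y - real_form \<iota> B x y) q" for q
      using real_analytic_at_diff[OF wf(3) wB(3)] by (simp add: case_prod_unfold)
  qed
  obtain h where h: "\<And>a. real_analytic_at h a" "h 0 = 0"
    and hs: "\<And>x y. k x y - real_form \<iota> B x y = h (x + y) - h x - h y"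
    using s.analytic_primitive by blast
  \<comment> \<open>On the lattice the coboundary of \<open>h\<close> differs from \<open>k\<close>
    by the integer B(m, n), so \<open>c\<close> minus \<open>h\<close> is additive modulo the
    integers.\<close>
  have "(c (m + n) - h (\<iota> (m + n))) - (c m - h (\<iota> m)) - (c n - h (\<iota> n)) \<in> \<int>" for m n
  proof -
    have "of_int (B m n) - (c m + c n + k (\<iota> m) (\<iota> n) - c (m + n)) \<in> \<int>"
      by (intro Ints_diff wf(6)) simp
    moreover have "of_int (B m n) - (c m + c n + k (\<iota> m) (\<iota> n) - c (m + n)) =
        (c (m + n) - h (\<iota> (m + n))) - (c m - h (\<iota> m)) - (c n - h (\<iota> n))"
      using hs[of "\<iota> m" "\<iota> n"] by (simp add: real_form(2)[OF B(1)])
    ultimately show ?thesis by simp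
  qed
  then obtain L where L: "linear L" "\<And>m. (c m - h (\<iota> m)) - L (\<iota> m) \<in> \<int>"
    using lift_character[of "\<lambda>m. c m - h (\<iota> m)"] by blast
  \<comment> \<open>The sign makes the boundary cancel both \<open>h\<close> in the cocycle and
    \<open>h + L\<close> in the shift.\<close>
  define \<eta> where "\<eta> x = - (h x + L x)" for x
  have \<eta>: "pointed_analytic \<eta>"
    unfolding \<eta>_def[abs_def]
    by (rule pointed_analytic_minus[OF pointed_analytic_add[OF _ pointed_analytic_linear[OF L(1)]]])
      (simp add: pointed_analytic_def h)
  have "realise (f, B) = p \<otimes>\<^bsub>deg0 W\<^esub> bdry W (circle_map \<eta>)"
    unfolding realise_def prod.case p W_bdry weak_map_mult[OF w weak_data_bdry[OF \<eta>]]
  proof (rule weak_map_cong)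
    show "0 - (\<eta> (\<iota> m) + c (id m)) \<in> \<int>" for m
      using Ints_minus[OF L(2)[of m]] by (simp add: \<eta>_def algebra_simps)
    show "real_form \<iota> B x y = \<eta> (x + y) - \<eta> x - \<eta> y + k (real_ext id x) (real_ext id y)" for x y
      using hs[of x y] by (simp add: \<eta>_def real_ext_id linear_add[OF L(1)])
  qed simp
  then show ?thesis using a \<eta> by (auto simp: W_deg1)
qed

theorem weak_actor_equivalent_Xi:
  "monoidally_equivalent (strict_cat_group_of W) (strict_cat_group_of (Xi J))"
proof -
  interpret crossed_module_span W "Xi J" H realise "\<lambda>p. coset p" character
  proof (unfold_locales)
    show "crossed_module W" by (rule crossed_module_W)
    show "crossed_module (Xi J)" by (rule crossed_module_Xi)
    show "realise \<in> hom H (deg0 W)" by (rule realise_hom)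
    show "(\<lambda>p. coset p) \<in> hom H (deg0 (Xi J))" unfolding Xi_simps by (rule coset_hom)
    show "\<exists>a\<in>carrier H. \<exists>\<gamma>\<in>carrier (deg1 W). realise a = p \<otimes>\<^bsub>deg0 W\<^esub> bdry W \<gamma>"
      if "p \<in> carrier (deg0 W)" for p using that by (rule realise_essentially_surjective)
    show "\<exists>a\<in>carrier H. \<exists>\<delta>\<in>carrier (deg1 (Xi J)). coset a = d \<otimes>\<^bsub>deg0 (Xi J)\<^esub> bdry (Xi J) \<delta>"
      if "d \<in> carrier (deg0 (Xi J))" for d
    proof -
      have d: "d \<in> carrier (H Mod N)" using that by (simp add: Xi_simps)
      obtain f B where p: "(f, B) \<in> carrier H" "d = coset (f, B)" using d by (rule E_cases)
      have "coset (f, B) = d \<otimes>\<^bsub>H Mod N\<^esub> \<one>\<^bsub>H Mod N\<^esub>"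
        using p group.is_monoid[OF group_E] d by (simp add: monoid.r_one del: mult_FactGroup one_FactGroup)
      then have "coset (f, B) = d \<otimes>\<^bsub>deg0 (Xi J)\<^esub> bdry (Xi J) (\<lambda>_. 0)"
        by (simp add: Xi_simps coset_one)
      moreover have "(\<lambda>_. 0) \<in> carrier (deg1 (Xi J))"
        by (simp add: Xi_simps dual_lattice_def Modules.additive_def)
      ultimately show ?thesis using p(1) by blast
    qed
  next
    fix a \<gamma> assume "a \<in> carrier H" and "\<gamma> \<in> carrier (deg1 W)" and eq: "realise a = bdry W \<gamma>"
    then obtain f B h where p: "(f, B) \<in> carrier H" "a = (f, B)" and h: "pointed_analytic h" "\<gamma> = circle_map h"
      by (cases a) (auto simp: W_deg1)
    note e = realise_eq_bdryD[OF p(1) h(1) eq[unfolded p(2) h(2)]]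
    note a = H_carrierD[OF p(1)]
    define l where "l = character a \<gamma>"
    have l: "real_of_int (l m) = 2 * h (\<iota> m) - of_int (B m m)" for m using e(5) by (simp add: l_def p h)
    have l_dual: "l \<in> dual_lattice"
    proof (unfold dual_lattice_def Modules.additive_def, intro CollectI allI)
      fix m n
      have "real_of_int (l (m + n)) = of_int (l m + l n)"
        using e(3)[of "\<iota> m" "\<iota> n"] e(4)[of n m]
        by (simp add: l real_form(2)[OF a(3)] integral_formsD(1,2)[OF a(3)])
      then show "l (m + n) = l m + l n" by linarith
    qed
    \<comment> \<open>Integrality of \<open>h\<close> gives \<open>l m\<close> the parity of
      \<open>B m m\<close>, and an integer has the parity of its square.\<close>
    have "even (B m m - l m * l m)" for m
    proof -
      obtain i where "h (\<iota> m) = of_int i" using e(2)[of m] by (auto elim: Ints_cases)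
      then have "real_of_int (l m) = of_int (2 * i - B m m)" using l[of m] by simp
      then have "l m = 2 * i - B m m" by linarith
      then show ?thesis by simp
    qed
    then have "(\<lambda>m n. B m n - l m * l n) \<in> even_symmetric_forms"
      using e(4) integral_forms_add[OF a(3) integral_forms_minus[OF H_carrierD(3)[OF tensor_in_H[OF l_dual]]]]
      by (auto simp: even_symmetric_forms_def)
    then have "coset (id, \<lambda>m n. l m * l n) = coset (id, B)"
      by (rule coset_id_eqI[OF tensor_in_H[OF l_dual]])
    then show "character a \<gamma> \<in> carrier (deg1 (Xi J)) \<and> bdry (Xi J) (character a \<gamma>) = coset a"
      using l_dual unfolding l_def[symmetric] by (simp add: Xi_simps p(2) e(1))
    \<comment> \<open>Two primitives of the same form differ by a linear function, and equal
      characters make it vanish on the lattice.\<close>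
    show "\<gamma> = \<gamma>'" if g: "\<gamma>' \<in> carrier (deg1 W)" "realise a = bdry W \<gamma>'" "character a \<gamma> = character a \<gamma>'" for \<gamma>'
    proof -
      obtain h' where h': "pointed_analytic h'" "\<gamma>' = circle_map h'" using g(1) by (auto simp: W_deg1)
      note e' = realise_eq_bdryD[OF p(1) h'(1) g(2)[unfolded p(2) h'(2)]]
      have lat: "h (\<iota> m) - h' (\<iota> m) = 0" for m
        using e(5)[of m] e'(5)[of m] g(3) by (simp add: p h h')
      have "linear (\<lambda>x. h x - h' x)"
      proof (rule linear_of_additive_continuous)
        show "h (x + y) - h' (x + y) = h x - h' x + (h y - h' y)" for x y
          using e(3)[of x y] e'(3)[of x y] by simp
        show "continuous_on UNIV (\<lambda>x. h x - h' x)"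
          by (intro analytic_continuous real_analytic_at_diff pointed_analyticD(1) h h')
      qed
      from linear_eq_on_lattice[OF this linear_zero lat] have "h x - h' x = 0" for x by (simp add: fun_eq_iff)
      then have "h = h'" by (simp add: fun_eq_iff)
      then show ?thesis by (simp add: h h')
    qed
    show "character (inv\<^bsub>H\<^esub> g \<otimes>\<^bsub>H\<^esub> a \<otimes>\<^bsub>H\<^esub> g) (act W \<gamma> (realise g)) = act (Xi J) (character a \<gamma>) (coset g)"
      if g_in: "g \<in> carrier H" for g
    proof -
      obtain g0 C where g: "(g0, C) \<in> carrier H" "g = (g0, C)" using g_in by (cases g) auto
      note G = H_carrierD[OF g(1)] and lin = linear_real_ext[of g0]
      have conj: "inv\<^bsub>H\<^esub> g \<otimes>\<^bsub>H\<^esub> a \<otimes>\<^bsub>H\<^esub> g = (id, \<lambda>m n. B (g0 m) (g0 n))"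
        using H_conj[OF g(1), of B] by (simp add: g(2) p(2) e(1) del: H_mult)
      have act: "act W \<gamma> (realise g) = circle_map (\<lambda>x. h (real_ext g0 x))"
        by (simp add: realise_def g(2) h(2) W_act[OF h(1) real_form_weak_data[OF g(1)]])
      show ?thesis
        unfolding conj act
        by (simp add: character_def pointed_analytic_comp[OF h(1) lin] fun_eq_iff Xi_simps(6) g(2)
            fst_some_coset[OF g(1)] p(2) h G(2))
    qed
    fix a' \<gamma>' assume "a' \<in> carrier H" "\<gamma>' \<in> carrier (deg1 W)" and eq': "realise a' = bdry W \<gamma>'"
    then obtain f' B' h' where p': "(f', B') \<in> carrier H" "a' = (f', B')"
        and h': "pointed_analytic h'" "\<gamma>' = circle_map h'"
      by (cases a') (auto simp: W_deg1)
    note e' = realise_eq_bdryD[OF p'(1) h'(1) eq'[unfolded p'(2) h'(2)]]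
    \<comment> \<open>The floor is additive here because all values on the lattice are
      integers.\<close>
    have "\<lfloor>h (\<iota> m) + h' (\<iota> m)\<rfloor> = \<lfloor>h (\<iota> m)\<rfloor> + \<lfloor>h' (\<iota> m)\<rfloor>" for m
      using e(2)[of m] e'(2)[of m] by (auto elim!: Ints_cases)
    then show "character (a \<otimes>\<^bsub>H\<^esub> a') (\<gamma> \<otimes>\<^bsub>deg1 W\<^esub> \<gamma>') = character a \<gamma> \<otimes>\<^bsub>deg1 (Xi J)\<^esub> character a' \<gamma>'"
      by (simp add: character_def p p' h h' W_deg1(2) pointed_analytic_add[OF h(1) h'(1)] Xi_simps(3) e'(1)
          fun_eq_iff)
  next
    fix a \<delta> assume a: "a \<in> carrier H" and "\<delta> \<in> carrier (deg1 (Xi J))" and eq: "coset a = bdry (Xi J) \<delta>"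
    then have \<delta>: "\<delta> \<in> dual_lattice" by (simp add: Xi_simps)
    have "a \<in> coset (id, \<lambda>m n. \<delta> m * \<delta> n)" using coset_self[OF a] eq by (simp add: Xi_simps)
    then obtain S where S: "S \<in> even_symmetric_forms" and aS: "a = (id, \<lambda>m n. S m n + \<delta> m * \<delta> n)"
      by (cases a) (auto simp: mem_coset)
    define B where "B m n = S m n + \<delta> m * \<delta> n" for m n
    have aB: "a = (id, B)" by (simp add: aS B_def[abs_def])
    have p: "(id, B) \<in> carrier H" using a aB by simp
    note HB = H_carrierD[OF p]
    define L where "L = lin_ext (\<lambda>m. of_int (\<delta> m) :: real)"
    have L: "linear L" "L (\<iota> m) = of_int (\<delta> m)" for m
      using dual_latticeD(2)[OF \<delta>] by (simp_all add: L_def linear_lin_ext additive_of_int)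
    \<comment> \<open>The witness inverts the formula for \<open>character\<close>: the quadratic
      part has coboundary B once B is symmetric, and the linear part realises
      \<open>\<delta>\<close>.\<close>
    define h where "h x = (1 / 2) * L x + (1 / 2) * real_form \<iota> B x x" for x
    have "real_analytic_at h x" for x
    proof -
      have "bounded_linear (\<lambda>x. (1 / 2) * L x)"
        by (intro bounded_linear_const_mult bounded_linear_linear L)
      moreover have "bounded_bilinear (\<lambda>x y. (1 / 2) * real_form \<iota> B x y)"
        using bounded_bilinear_bilinear[of "\<lambda>x y. (1 / 2) * real_form \<iota> B x y"] real_form(1)[OF HB(3)]
        by (auto simp: bilinear_def linear_iff algebra_simps)
      ultimately show ?thesis
        using real_analytic_at_quadratic[of "\<lambda>x. (1 / 2) * L x" "\<lambda>x y. (1 / 2) * real_form \<iota> B x y" 0 x]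
        by (simp add: h_def[abs_def])
    qed
    then have h: "pointed_analytic h"
      by (simp add: pointed_analytic_def h_def linear_0[OF L(1)] real_form_simps[OF HB(3)])
    have sym: "real_form \<iota> B x y = real_form \<iota> B y x" for x y
      using weak_dataD(7)[OF real_form_weak_data[OF p], of x y] by (simp add: real_ext_id)
    have h_\<iota>: "2 * h (\<iota> m) = of_int (\<delta> m + B m m)" for m
      by (simp add: h_def L real_form(2)[OF HB(3)])
    have int: "h (\<iota> m) \<in> \<int>" for m
    proof -
      \<comment> \<open>Here B(m, m) is the even number S(m, m) plus the square of
        \<open>\<delta> m\<close>, and an integer plus its square is even.\<close>
      have "even (\<delta> m + B m m)" using even_formsD(3)[OF S, of m] by (simp add: B_def)
      then obtain i where "\<delta> m + B m m = 2 * i" by (rule evenE)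
      then have "h (\<iota> m) = of_int i" using h_\<iota>[of m] by simp
      then show ?thesis by simp
    qed
    have "realise a = bdry W (circle_map h)"
      unfolding aB
      by (rule realise_eq_bdryI[OF p h int])
        (use sym in \<open>simp add: h_def linear_add[OF L(1)] real_form_simps[OF HB(3)] algebra_simps\<close>)
    moreover have "character a (circle_map h) = \<delta>"
    proof
      fix m
      have "real_of_int (character a (circle_map h) m) = of_int (\<delta> m)"
        using realise_eq_bdryD(5)[OF p h calculation[unfolded aB], of m] h_\<iota>[of m] by (simp add: aB)
      then show "character a (circle_map h) m = \<delta> m" by linarith
    qed
    ultimately show "\<exists>\<gamma>\<in>carrier (deg1 W). realise a = bdry W \<gamma> \<and> character a \<gamma> = \<delta>"
      using h by (auto simp: W_deg1)
  qed
  show ?thesis by (rule monoidally_equivalent_span)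
qed

end

theorem theorem6p2:
  fixes \<iota> :: "'l::ab_group_add \<Rightarrow> 'v::real_normed_vector"
    and J :: "'l \<Rightarrow> 'l \<Rightarrow> int"
  assumes "lattice_extension \<iota>"
    and "J \<in> integral_forms"
  shows "crossed_module (wAct_plus (Theta \<iota> J) analytic_maps) \<and>
    crossed_module (Xi J) \<and>
    monoidally_equivalent
      (strict_cat_group_of (wAct_plus (Theta \<iota> J) analytic_maps))
      (strict_cat_group_of (Xi J))"
proof -
  obtain b where b: "finite b" "independent b" "span b = UNIV" "Modules.additive \<iota>" "inj \<iota>"
    "range \<iota> = {v. \<exists>c :: 'v \<Rightarrow> int. v = (\<Sum>e\<in>b. of_int (c e) *\<^sub>R e)}"
    using assms(1) unfolding lattice_extension_def by blast
  interpret categorical_torus b \<iota> J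
    by unfold_locales (use b assms(2) additive.add[OF b(4)] in auto)
  show ?thesis
    using crossed_module_W crossed_module_Xi weak_actor_equivalent_Xi by blast
qed

end
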